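(* Let $k\ge 2$ and $\ell \ge 1$ be constant integers. Assuming SETH, distinguishing between $(k+1)$-radius $\leq 3\ell$ and $(k+1)$-radius $\geq 5\ell$ cannot be done in $O(m^{k-\delta})$ time on undirected unweighted graphs with $m$ edges, for any constant $\delta>0$. As a corollary, for any constants $\varepsilon\in (0,1)$ and $\beta\ge 0$, computing a $(\frac{5}{3}-\varepsilon,\beta)$-approximation of the $k$-radius requires $m^{k-1-o(1)}$ time under SETH.
   Context: All graphs are undirected and unweighted, with $n$ vertices and $m\ge n-1$ edges; $d(u,v)$ is the shortest-path distance. For a positive integer $k$, the $k$-radius of $G=(V,E)$ is $R_k(G)=\min_{C\subseteq V,|C|=k}\max_{v\in V} d(v,C)$, where $d(v,C)=\min_{c\in C}d(v,c)$. "Distinguishing between $k$-radius $\le a$ and $\ge b$" means: given a graph promised to satisfy either $R_k(G)\le a$ or $R_k(G)\ge b$, decide which. An $(\alpha,\beta)$-approximation of the $k$-radius is a value $\tilde R$ with $R_k(G)\le \tilde R\le \alpha R_k(G)+\beta$. SETH: for every $\varepsilon>0$ there is an integer $q\ge 3$ such that $q$-SAT on $N$ variables cannot be solved in $O((2-\varepsilon)^N)$ time. Model: word-RAM with $O(\log n)$-bit words. *)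

theory Defs
  imports "HOL-Library.Extended_Real" "HOL-Library.Log_Nat"
begin

section \<open>Deterministic word-RAM\<close>

text \<open>
  A word-RAM with word length \<open>w\<close> has a constant number of registers (those named in the program)
  and a memory addressed by words; every cell holds a number below \<open>2 ^ w\<close>. Control flow is given
  by structured commands instead of jumps. A jump program is simulated by a single loop that
  branches on a program counter, so the two styles agree up to a constant factor (depending on the
  program) in running time.
\<close>

datatype binop = Plus | Minus | Times | Quot | Rem | BitAnd | BitOr | BitXor | ShiftL | ShiftR
  | Less | Equal

text \<open>Division by zero follows the HOL conventions: quotient \<open>0\<close>, remainder \<open>x\<close>.\<close>

fun word_op :: "nat \<Rightarrow> binop \<Rightarrow> nat \<Rightarrow> nat \<Rightarrow> nat" where
  "word_op w Plus x y = (x + y) mod 2 ^ w"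
| "word_op w Minus x y = nat ((int x - int y) mod 2 ^ w)"
| "word_op w Times x y = (x * y) mod 2 ^ w"
| "word_op w Quot x y = (x div y) mod 2 ^ w"
| "word_op w Rem x y = (x mod y) mod 2 ^ w"
| "word_op w BitAnd x y = Bit_Operations.and x y mod 2 ^ w"
| "word_op w BitOr x y = Bit_Operations.or x y mod 2 ^ w"
| "word_op w BitXor x y = Bit_Operations.xor x y mod 2 ^ w"
| "word_op w ShiftL x y = push_bit y x mod 2 ^ w"
| "word_op w ShiftR x y = drop_bit y x mod 2 ^ w"
| "word_op w Less x y = (if x < y then 1 else 0) mod 2 ^ w"
| "word_op w Equal x y = (if x = y then 1 else 0) mod 2 ^ w"

type_synonym reg = nat

datatype com =
    Const reg nat
  | Op binop reg reg reg
  | Load reg reg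
  | Store reg reg
  | Seq com com
  | Cond reg com com
  | While reg com

text \<open>Register contents and memory contents.\<close>

type_synonym state = "(reg \<Rightarrow> nat) \<times> (nat \<Rightarrow> nat)"

text \<open>
  \<open>exec w p s t s'\<close>: on a machine with word length \<open>w\<close>, program \<open>p\<close> started in state \<open>s\<close> halts after
  exactly \<open>t\<close> steps in state \<open>s'\<close>. Each elementary instruction and each test is one step.
\<close>

inductive exec :: "nat \<Rightarrow> com \<Rightarrow> state \<Rightarrow> nat \<Rightarrow> state \<Rightarrow> bool" for w :: nat where
  Const: "exec w (Const r a) (R, M) 1 (R(r := a mod 2 ^ w), M)"
| Op: "exec w (Op f r x y) (R, M) 1 (R(r := word_op w f (R x) (R y)), M)"
| Load: "exec w (Load r x) (R, M) 1 (R(r := M (R x)), M)"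
| Store: "exec w (Store x y) (R, M) 1 (R, M(R x := R y))"
| Seq: "exec w p s t s' \<Longrightarrow> exec w q s' t' s'' \<Longrightarrow> exec w (Seq p q) s (t + t') s''"
| CondTrue: "fst s r \<noteq> 0 \<Longrightarrow> exec w p s t s' \<Longrightarrow> exec w (Cond r p q) s (Suc t) s'"
| CondFalse: "fst s r = 0 \<Longrightarrow> exec w q s t s' \<Longrightarrow> exec w (Cond r p q) s (Suc t) s'"
| WhileFalse: "fst s r = 0 \<Longrightarrow> exec w (While r p) s 1 s"
| WhileTrue: "fst s r \<noteq> 0 \<Longrightarrow> exec w p s t s' \<Longrightarrow> exec w (While r p) s' t' s'' \<Longrightarrow>
    exec w (While r p) s (Suc (t + t')) s''"

definition initial_state :: "nat \<Rightarrow> nat list \<Rightarrow> state" where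
  "initial_state w xs =
     ((\<lambda>_. 0), (\<lambda>i. if i < length xs then (xs ! i) mod 2 ^ w else 0))"

section \<open>Problems and running times\<close>

text \<open>
  \<open>answer x R\<close> says that the final register contents \<open>R\<close> are a correct answer on instance \<open>x\<close>.
  \<open>logsize x\<close> is the logarithm of the size parameter that determines the word length.
\<close>

record 'a problem =
  instances :: "'a set"
  encode :: "'a \<Rightarrow> nat list"
  logsize :: "'a \<Rightarrow> nat"
  answer :: "'a \<Rightarrow> (reg \<Rightarrow> nat) \<Rightarrow> bool"

text \<open>
  Solvable in \<open>O(f)\<close> time with words of \<open>O(logsize)\<close> bits. The constant \<open>c\<close> in the word length is chosen
  together with the program \<open>p\<close>. All problems below have only finitely many instances for
  every value of the parameter on which \<open>f\<close> depends, so it makes no difference to ask for the bound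
  on all instances rather than on all but finitely many.
\<close>

definition solvable_in_time :: "'a problem \<Rightarrow> ('a \<Rightarrow> real) \<Rightarrow> bool" where
  "solvable_in_time Q f \<longleftrightarrow>
     (\<exists>(p :: com) (c :: nat) (C :: real). C > 0 \<and>
        (\<forall>x \<in> instances Q. \<exists>t R M.
           exec (c * logsize Q x) p (initial_state (c * logsize Q x) (encode Q x)) t (R, M) \<and>
           answer Q x R \<and> real t \<le> C * f x))"

section \<open>Satisfiability and SETH\<close>

text \<open>A literal is a variable together with its required truth value.\<close>

type_synonym literal = "nat \<times> bool"

text \<open>A formula with its number of variables, which are \<open>0, \<dots>, N - 1\<close>.\<close>

type_synonym cnf = "nat \<times> literal list list"

definition satisfiable :: "cnf \<Rightarrow> bool" where
  "satisfiable F \<longleftrightarrow> (\<exists>\<sigma> :: nat \<Rightarrow> bool. \<forall>cl \<in> set (snd F). \<exists>(x, b) \<in> set cl. \<sigma> x = b)"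

text \<open>Clauses are not repeated, so a formula on \<open>N\<close> variables has polynomially many clauses.\<close>

definition is_qcnf :: "nat \<Rightarrow> cnf \<Rightarrow> bool" where
  "is_qcnf q F \<longleftrightarrow> distinct (snd F) \<and>
     (\<forall>cl \<in> set (snd F). length cl \<le> q \<and> (\<forall>(x, b) \<in> set cl. x < fst F))"

definition encode_clause :: "literal list \<Rightarrow> nat list" where
  "encode_clause cl = length cl # map (\<lambda>(x, b). 2 * x + of_bool b) cl"

definition encode_cnf :: "cnf \<Rightarrow> nat list" where
  "encode_cnf F = fst F # length (snd F) # concat (map encode_clause (snd F))"

text \<open>
  The search space of an \<open>N\<close>-variable formula has size \<open>2 ^ N\<close>, so words have \<open>O(N)\<close> bits; shorter words
  could not address the memory of an exponential-time algorithm. The summand 1 covers \<open>N = 0\<close>.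
\<close>

definition q_sat :: "nat \<Rightarrow> cnf problem" where
  "q_sat q = \<lparr> instances = {F. is_qcnf q F},
     encode = encode_cnf,
     logsize = (\<lambda>F. fst F + 1),
     answer = (\<lambda>F R. R 0 = (if satisfiable F then 1 else 0)) \<rparr>"

definition SETH :: bool where
  "SETH \<longleftrightarrow> (\<forall>\<epsilon>::real. \<epsilon> > 0 \<longrightarrow>
     (\<exists>q \<ge> 3. \<not> solvable_in_time (q_sat q) (\<lambda>F. (2 - \<epsilon>) ^ fst F)))"

section \<open>Graphs and the $k$-radius\<close>

definition adjacency :: "'v set set \<Rightarrow> 'v rel" where
  "adjacency E = {(u, v). {u, v} \<in> E}"

text \<open>The distance is \<open>\<infinity>\<close> for vertices in different components.\<close>

definition graph_dist :: "'v set set \<Rightarrow> 'v \<Rightarrow> 'v \<Rightarrow> enat" where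
  "graph_dist E u v = (INF i \<in> {i. (u, v) \<in> adjacency E ^^ i}. enat i)"

definition graph_setdist :: "'v set set \<Rightarrow> 'v \<Rightarrow> 'v set \<Rightarrow> enat" where
  "graph_setdist E v C = (INF c \<in> C. graph_dist E v c)"

definition k_radius :: "nat \<Rightarrow> 'v set \<Rightarrow> 'v set set \<Rightarrow> enat" where
  "k_radius k V E = (INF C \<in> {C. C \<subseteq> V \<and> card C = k}. SUP v \<in> V. graph_setdist E v C)"

text \<open>An input graph: the number of vertices, which are \<open>0, \<dots>, n - 1\<close>, and a list of its edges.\<close>

type_synonym graph = "nat \<times> (nat \<times> nat) list"

definition vertices :: "graph \<Rightarrow> nat set" where
  "vertices G = {..<fst G}"

definition edges :: "graph \<Rightarrow> nat set set" where
  "edges G = (\<lambda>(u, v). {u, v}) ` set (snd G)"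

definition num_edges :: "graph \<Rightarrow> nat" where
  "num_edges G = length (snd G)"

text \<open>Each undirected edge is listed once, in either orientation. The last conjunct is \<open>m \<ge> n - 1\<close>.\<close>

definition is_graph :: "graph \<Rightarrow> bool" where
  "is_graph G \<longleftrightarrow>
     (\<forall>(u, v) \<in> set (snd G). u < fst G \<and> v < fst G \<and> u \<noteq> v) \<and>
     distinct (map (\<lambda>(u, v). {u, v}) (snd G)) \<and>
     fst G \<le> num_edges G + 1"

definition encode_graph :: "graph \<Rightarrow> nat list" where
  "encode_graph G = fst G # num_edges G # concat (map (\<lambda>(u, v). [u, v]) (snd G))"

abbreviation radius_of :: "nat \<Rightarrow> graph \<Rightarrow> enat" where
  "radius_of k G \<equiv> k_radius k (vertices G) (edges G)"

text \<open>
  In both problems \<open>k \<le> n\<close> is required, since otherwise there is no set of \<open>k\<close> centres and the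
  \<open>k\<close>-radius is undefined. The word length is \<open>O(log n)\<close>: \<^term>\<open>floorlog 2 n\<close> is the number of
  binary digits of \<open>n\<close>.
\<close>

definition radius_gap_problem :: "nat \<Rightarrow> nat \<Rightarrow> nat \<Rightarrow> graph problem" where
  "radius_gap_problem k a b = \<lparr>
     instances = {G. is_graph G \<and> k \<le> fst G \<and>
       (radius_of k G \<le> enat a \<or> radius_of k G \<ge> enat b)},
     encode = encode_graph,
     logsize = (\<lambda>G. floorlog 2 (fst G)),
     answer = (\<lambda>G R. (radius_of k G \<le> enat a \<longrightarrow> R 0 = 1) \<and>
                     (radius_of k G \<ge> enat b \<longrightarrow> R 0 = 0)) \<rparr>"

text \<open>
  The approximate value is output as a fraction; denominator \<open>0\<close> encodes \<open>\<infinity>\<close>, which is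
  the only correct value if the \<open>k\<close>-radius is infinite.
\<close>

definition output_value :: "(reg \<Rightarrow> nat) \<Rightarrow> ereal" where
  "output_value R = (if R 1 = 0 then \<infinity> else ereal (real (R 0) / real (R 1)))"

definition is_approximation :: "real \<Rightarrow> real \<Rightarrow> enat \<Rightarrow> ereal \<Rightarrow> bool" where
  "is_approximation \<alpha> \<beta> r a \<longleftrightarrow>
     ereal_of_enat r \<le> a \<and> a \<le> ereal \<alpha> * ereal_of_enat r + ereal \<beta>"

definition radius_approx_problem :: "nat \<Rightarrow> real \<Rightarrow> real \<Rightarrow> graph problem" where
  "radius_approx_problem k \<alpha> \<beta> = \<lparr>
     instances = {G. is_graph G \<and> k \<le> fst G},
     encode = encode_graph,
     logsize = (\<lambda>G. floorlog 2 (fst G)),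
     answer = (\<lambda>G R. is_approximation \<alpha> \<beta> (radius_of k G) (output_value R)) \<rparr>"

end

theory Submission
  imports Defs
begin

text \<open>
  Split the variables of a \<open>q\<close>-CNF formula into \<open>k\<close> groups and let the left vertices be the \<open>2 ^ (N / k)\<close>
  partial assignments of each group. A satisfying assignment is a choice of one left vertex per group
  that satisfies every clause. Join each left vertex to the clauses it satisfies, and to a hub
  otherwise, by paths of length \<open>2 * l\<close>, and let each clause end in a path of length \<open>l\<close>. Then the hub and
  the chosen left vertices cover everything within \<open>3 * l\<close>. Conversely a centre at distance less than
  \<open>5 * l\<close> from the far ends of several clauses lies on a path at a left vertex, and serves only the clauses
  satisfied there.

  The centre meant for the hub can move towards a left vertex and act as one extra assignment. To make
  this useless, clauses are replaced by triples \<open>(c, c', j)\<close>: an assignment of group \<open>j\<close> has to satisfy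
  both clauses, one of another group only one of them. If neither of two assignments of group \<open>j\<close> completes
  the remaining ones, because the first fails on \<open>c\<close> and the second on \<open>c'\<close>, then \<open>(c, c', j)\<close> is uncovered.

  The graph has \<open>2 ^ (N / k)\<close> edges up to a polynomial factor, and a word-RAM writes it down in about that time
  before it simulates the given algorithm on it. For the approximation of the 2-radius the claimed bound is
  unconditional: the algorithm must read most of its input.
\<close>

section \<open>Distances\<close>

text \<open>The thresholds are lengths of two walks. From the far end of a clause, \<open>l\<close>
  steps lead to the right vertex and \<open>2 * l\<close> more to an incident left vertex; leaving
  that one on another path costs \<open>2 * l\<close> again before the next branching vertex. A
  centre closer than \<open>5 * l\<close> is therefore tied to one left vertex or to the clause
  itself.

  The right vertices that force a choice tie \<open>k\<close> of the \<open>k + 1\<close> centres to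
  distinct groups, so that a single centre is left whose behaviour is not controlled.

  On the machine side the obstacle is word length. The given algorithm may exploit overflow of its
  \<open>c * floorlog 2 nv\<close> bits, so it cannot simply be run with the longer words of the
  \<open>q\<close>-SAT solver: each of its operations has to be reduced to the short length.

  For approximations with \<open>k \<ge> 3\<close>, the gap for \<open>k - 1\<close> groups is used
  with \<open>l\<close> so large that \<open>\<beta> < 3 * l * \<epsilon>\<close>.\<close>

definition near :: "'v set set \<Rightarrow> nat \<Rightarrow> 'v \<Rightarrow> 'v \<Rightarrow> bool" where
  "near E d x y \<longleftrightarrow> (\<exists>i\<le>d. (x, y) \<in> adjacency E ^^ i)"

lemma near_refl: "near E d x x"
  unfolding near_def by (rule exI[of _ 0]) auto

lemma near_mono: "near E d x y \<Longrightarrow> d \<le> d' \<Longrightarrow> near E d' x y"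
  unfolding near_def by (meson order_trans)

lemma near_trans: "near E d x y \<Longrightarrow> near E d' y z \<Longrightarrow> near E (d + d') x z"
  unfolding near_def by (meson add_mono relpow_trans)

lemma near_edge: "{x, y} \<in> E \<Longrightarrow> near E 1 x y"
  unfolding near_def by (rule exI[of _ 1]) (auto simp: adjacency_def)

lemma sym_adjacency: "sym (adjacency E)"
  by (auto simp: sym_def adjacency_def insert_commute)

lemma sym_relpow: "sym r \<Longrightarrow> sym (r ^^ n)"
proof (induction n)
  case (Suc n)
  show ?case
  proof (rule symI)
    fix a b assume "(a, b) \<in> r ^^ Suc n"
    then obtain c where "(a, c) \<in> r ^^ n" "(c, b) \<in> r" by auto
    then have "(b, c) \<in> r" "(c, a) \<in> r ^^ n" using Suc by (auto dest: symD)
    then show "(b, a) \<in> r ^^ Suc n" by (metis relpow_Suc_I2)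
  qed
qed (auto simp: sym_def)

lemma near_sym: "near E d x y \<Longrightarrow> near E d y x"
  unfolding near_def using sym_relpow[OF sym_adjacency] by (meson symD)

lemma graph_dist_le: "near E d x y \<Longrightarrow> graph_dist E x y \<le> enat d"
  unfolding near_def graph_dist_def
  by (meson INF_lower2 enat_ord_simps(1) mem_Collect_eq)

text \<open>\<open>enat\<close> is well-ordered, so the infimum over a nonempty set of lengths is
  attained; the empty set would give \<open>\<infinity>\<close>.\<close>

lemma near_of_graph_dist: "graph_dist E x y \<le> enat d \<Longrightarrow> near E d x y"
proof -
  assume *: "graph_dist E x y \<le> enat d"
  let ?I = "{i. (x, y) \<in> adjacency E ^^ i}"
  have "graph_dist E x y = \<infinity>" if "?I = {}" unfolding graph_dist_def that by (simp add: top_enat_def)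
  then have "?I \<noteq> {}" using * by (metis enat_ord_simps(5) infinity_ileE)
  then obtain i where "i \<in> ?I" by auto
  then have "Inf (enat ` ?I) \<in> enat ` ?I" by (intro wellorder_InfI[of "enat i"]) auto
  then show ?thesis using * unfolding graph_dist_def near_def by auto
qed

lemma graph_setdist_le: "c \<in> C \<Longrightarrow> near E d v c \<Longrightarrow> graph_setdist E v C \<le> enat d"
  unfolding graph_setdist_def by (meson INF_lower2 graph_dist_le)

lemma near_of_graph_setdist:
  assumes "graph_setdist E v C \<le> enat d"
  shows "\<exists>c\<in>C. near E d v c"
proof -
  have "graph_setdist E v C = \<infinity>" if "C = {}" unfolding graph_setdist_def that by (simp add: top_enat_def)
  then have "C \<noteq> {}" using assms by (metis enat_ord_simps(5) infinity_ileE)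
  then obtain c0 where "c0 \<in> C" by auto
  then have "Inf (graph_dist E v ` C) \<in> graph_dist E v ` C"
    by (intro wellorder_InfI[of "graph_dist E v c0"]) auto
  then show ?thesis using assms near_of_graph_dist unfolding graph_setdist_def by force
qed

lemma k_radius_le:
  assumes "C \<subseteq> V" "card C = k" "\<And>v. v \<in> V \<Longrightarrow> \<exists>c\<in>C. near E d v c"
  shows "k_radius k V E \<le> enat d"
  unfolding k_radius_def
  by (rule INF_lower2[of C]) (use assms in \<open>auto intro!: SUP_least dest!: assms(3) intro: graph_setdist_le\<close>)

text \<open>The optimum over all centre sets is attained for the same reason, which turns the
  numeric radius into an actual set of centres.\<close>

lemma centres_of_k_radius_le:
  assumes "k_radius k V E \<le> enat d"
  shows "\<exists>C\<subseteq>V. card C = k \<and> (\<forall>v\<in>V. \<exists>c\<in>C. near E d v c)"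
proof -
  let ?CC = "{C. C \<subseteq> V \<and> card C = k}"
  let ?f = "\<lambda>C. SUP v \<in> V. graph_setdist E v C"
  have "k_radius k V E = \<infinity>" if "?CC = {}" unfolding k_radius_def that by (simp add: top_enat_def)
  then have "?CC \<noteq> {}" using assms by (metis enat_ord_simps(5) infinity_ileE)
  then obtain C0 where "C0 \<in> ?CC" by auto
  then have "Inf (?f ` ?CC) \<in> ?f ` ?CC" by (intro wellorder_InfI[of "?f C0"]) auto
  then obtain C where C: "C \<in> ?CC" "?f C \<le> enat d" using assms unfolding k_radius_def by auto
  show ?thesis
  proof (intro exI[of _ C] conjI ballI)
    fix v assume "v \<in> V"
    then have "graph_setdist E v C \<le> enat d" using C(2) by (meson SUP_upper order_trans)
    then show "\<exists>c\<in>C. near E d v c" by (rule near_of_graph_setdist)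
  qed (use C in auto)
qed

text \<open>A potential that changes by at most one along an edge bounds distances from below
  without any analysis of shortest walks. Integer values allow differences in its formula.\<close>

lemma lipschitz_near:
  fixes D :: "'v \<Rightarrow> int"
  assumes "\<And>x y. {x, y} \<in> E \<Longrightarrow> D x \<le> D y + 1" and "near E d x y"
  shows "D x \<le> D y + int d"
proof -
  have "(x, y) \<in> adjacency E ^^ i \<Longrightarrow> D x \<le> D y + int i" for i
  proof (induction i arbitrary: y)
    case (Suc i)
    then obtain c where "(x, c) \<in> adjacency E ^^ i" "{c, y} \<in> E" by (auto simp: adjacency_def)
    with Suc.IH[of c] assms(1)[of c y] show ?case by auto
  qed auto
  then show ?thesis using assms(2) unfolding near_def by fastforce
qed

section \<open>The incidence graph\<close>

text \<open>
  Row \<open>a < nA\<close>, column \<open>u\<close> is a path \<open>vtx a u 0, \<dots>, vtx a u (2 * l)\<close> from the left vertex \<open>a\<close> to the right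
  vertex \<open>u\<close> or to the hub. Row \<open>nA\<close> is a path with both ends free whose middle vertex \<open>vtx nA u l\<close> is the right
  vertex \<open>u\<close>. All rows have the same length, so that both ends of edge number \<open>e\<close> are arithmetic
  expressions in \<open>e\<close>.
\<close>

locale incidence_graph =
  fixes l nA nU :: nat and inc :: "nat \<Rightarrow> nat \<Rightarrow> bool"
  assumes l: "l \<ge> 1" and nA: "nA \<ge> 2" and nU: "nU \<ge> 2"
    and not_all: "\<And>a. a < nA \<Longrightarrow> \<exists>u<nU. \<not> inc a u"
begin

text \<open>Numbering: left vertices, then the \<open>nU\<close> starts and the \<open>nU\<close>
  ends of the paths in row \<open>nA\<close>, then the hub, then the \<open>2 * l - 1\<close>
  interior vertices of each path.\<close>

definition hub :: nat where "hub = nA + 2 * nU"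

definition inner :: "nat \<Rightarrow> nat \<Rightarrow> nat \<Rightarrow> nat" where
  "inner a u s = hub + (a * nU + u) * (2 * l - 1) + s"

definition vtx :: "nat \<Rightarrow> nat \<Rightarrow> nat \<Rightarrow> nat" where
  "vtx a u s =
     (if s = 0 then (if a < nA then a else nA + u)
      else if s = 2 * l then
        (if a < nA then (if inc a u then inner nA u l else hub) else nA + nU + u)
      else inner a u s)"

definition nv :: nat where "nv = hub + 1 + (nA + 1) * nU * (2 * l - 1)"
definition ne :: nat where "ne = 2 * l * nU * (nA + 1)"

definition edge :: "nat \<Rightarrow> nat \<times> nat" where
  "edge e = (let s = e mod (2 * l); u = (e div (2 * l)) mod nU; a = e div (2 * l * nU)
     in (vtx a u s, vtx a u (s + 1)))"

definition gr :: graph where "gr = (nv, map edge [0..<ne])"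

section \<open>Numbering of the edges\<close>

lemma row_less:
  assumes "a \<le> nA" "u < nU" shows "a * nU + u < (nA + 1) * nU"
  proof -
  have "a * nU \<le> nA * nU" using assms(1) by (rule mult_le_mono1)
  then have "a * nU + u < nA * nU + nU" using assms(2) by linarith
  then show ?thesis by simp
qed

lemma edge_index:
  assumes "a \<le> nA" "u < nU" "s < 2 * l"
  shows "(a * nU + u) * (2 * l) + s < ne" "edge ((a * nU + u) * (2 * l) + s) = (vtx a u s, vtx a u (s + 1))"
proof -
  have "a * nU + u + 1 \<le> (nA + 1) * nU" using row_less[OF assms(1,2)] by simp
  then have "(a * nU + u + 1) * (2*l) \<le> (nA + 1) * nU * (2 * l)" by (rule mult_le_mono1)
  then show "(a * nU + u) * (2 * l) + s < ne" using assms(3) unfolding ne_def by (simp add: algebra_simps)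
  have 1: "((a * nU + u) * (2 * l) + s) div (2 * l) = a * nU + u" using assms(3) by simp
  have 2: "((a * nU + u) * (2 * l) + s) mod (2 * l) = s" using assms(3) by simp
  have 3: "((a * nU + u) * (2 * l) + s) div (2 * l * nU) = a"
    using 1 assms(2) by (simp add: div_mult2_eq)
  show "edge ((a * nU + u) * (2 * l) + s) = (vtx a u s, vtx a u (s + 1))"
    unfolding edge_def Let_def 1 2 3 using assms(2) by simp
qed

lemma edge_index_bounds:
  assumes "e < ne"
  shows "e div (2 * l * nU) \<le> nA" "(e div (2 * l)) mod nU < nU" "e mod (2 * l) < 2 * l"
    "e = (e div (2 * l * nU) * nU + (e div (2 * l)) mod nU) * (2 * l) + e mod (2 * l)"
proof -
  have "e div (2 * l * nU) < nA + 1"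
    using assms unfolding ne_def by (simp add: less_mult_imp_div_less algebra_simps)
  then show "e div (2 * l * nU) \<le> nA" by simp
  show "(e div (2 * l)) mod nU < nU" "e mod (2 * l) < 2 * l" using nU l by auto
  show "e = (e div (2 * l * nU) * nU + (e div (2 * l)) mod nU) * (2 * l) + e mod (2 * l)"
    by (metis div_mult2_eq div_mult_mod_eq)
qed

lemma edges_gr: "edges gr = {{vtx a u s, vtx a u (s + 1)} | a u s. a \<le> nA \<and> u < nU \<and> s < 2 * l}"
proof -
  have img: "edges gr = (\<lambda>e. {fst (edge e), snd (edge e)}) ` {..<ne}"
    unfolding edges_def gr_def by (simp add: image_image case_prod_beta lessThan_atLeast0)
  show ?thesis
  proof (intro set_eqI iffI)
    fix X assume "X \<in> edges gr"
    then obtain e where e: "e < ne" "X = {fst (edge e), snd (edge e)}" by (auto simp: img)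
    then show "X \<in> {{vtx a u s, vtx a u (s + 1)} | a u s. a \<le> nA \<and> u < nU \<and> s < 2 * l}"
      using edge_index_bounds(1-3)[OF e(1)] unfolding edge_def Let_def mem_Collect_eq fst_conv snd_conv
      by blast
  next
    fix X assume "X \<in> {{vtx a u s, vtx a u (s + 1)} | a u s. a \<le> nA \<and> u < nU \<and> s < 2 * l}"
    then obtain a u s where "a \<le> nA" "u < nU" "s < 2 * l" "X = {vtx a u s, vtx a u (s + 1)}" by auto
    then show "X \<in> edges gr" using edge_index[of a u s] unfolding img
      by (intro image_eqI[of _ _ "(a * nU + u) * (2 * l) + s"]) auto
  qed
qed

lemma edge_in: "a \<le> nA \<Longrightarrow> u < nU \<Longrightarrow> s < 2 * l \<Longrightarrow> {vtx a u s, vtx a u (s + 1)} \<in> edges gr"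
  unfolding edges_gr by blast

lemma near_path:
  assumes "a \<le> nA" "u < nU" "t \<le> 2 * l" "s \<le> t"
  shows "near (edges gr) (t - s) (vtx a u s) (vtx a u t)"
  using assms(4,3)
proof (induction t rule: dec_induct)
  case base then show ?case by (simp add: near_refl)
next
  case (step n)
  have "near (edges gr) 1 (vtx a u n) (vtx a u (n + 1))"
    using step assms by (intro near_edge edge_in) auto
  then have "near (edges gr) (n - s + 1) (vtx a u s) (vtx a u (n + 1))"
    using step by (intro near_trans[of "edges gr" "n - s"]) auto
  then show ?case using step by (simp add: Suc_diff_le)
qed

lemma inner_less:
  assumes "a \<le> nA" "u < nU" "s < 2 * l" shows "inner a u s < nv"
proof -
  have "(a * nU + u + 1) * (2*l - 1) \<le> (nA + 1) * nU * (2 * l - 1)"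
    using row_less[OF assms(1,2)] by (intro mult_le_mono1) simp
  then have "(a * nU + u) * (2 * l - 1) + (2 * l - 1) \<le> (nA + 1) * nU * (2 * l - 1)"
    by (simp only: add_mult_distrib mult_1)
  then show ?thesis using assms(3) unfolding inner_def nv_def by linarith
qed

lemma vtx_less: "a \<le> nA \<Longrightarrow> u < nU \<Longrightarrow> s \<le> 2 * l \<Longrightarrow> vtx a u s < nv"
  using inner_less[of a u s] inner_less[of nA u l] l
  unfolding vtx_def by (auto simp: nv_def hub_def)

text \<open>Coordinates that undo \<open>vtx\<close>. Shared vertices need a canonical choice: a
  left vertex gets column 0, a right vertex its place in the middle of row \<open>nA\<close>, and
  the hub the row \<open>nA + 1\<close>, which no path has.\<close>

definition dec :: "nat \<Rightarrow> nat \<times> nat \<times> nat" where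
  "dec x = (if x < nA then (x, 0, 0) else if x < nA + nU then (nA, x - nA, 0)
     else if x < hub then (nA, x - nA - nU, 2 * l) else if x = hub then (nA + 1, 0, 0)
     else (let y = x - hub - 1 in
       (y div (2 * l - 1) div nU, y div (2 * l - 1) mod nU, y mod (2 * l - 1) + 1)))"

lemma dec_inner:
  assumes "u < nU" "0 < s" "s < 2 * l"
  shows "dec (inner a u s) = (a, u, s)"
proof -
  define q where "q = 2 * l - 1"
  have s: "s - 1 < q" using assms by (simp add: q_def)
  have y: "inner a u s - hub - 1 = (a * nU + u) * q + (s - 1)"
    using assms unfolding inner_def q_def by linarith
  have y1: "((a * nU + u) * q + (s - 1)) div q = a * nU + u" using s by simp
  have y2: "((a * nU + u) * q + (s - 1)) mod q = s - 1" using s by simp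
  have y3: "(a * nU + u) div nU = a" "(a * nU + u) mod nU = u" using assms by auto
  have "inner a u s > hub" using assms unfolding inner_def by linarith
  then have "\<not> inner a u s < hub" "inner a u s \<noteq> hub" "\<not> inner a u s < nA" "\<not> inner a u s < nA + nU"
    unfolding hub_def by linarith+
  then show ?thesis unfolding dec_def q_def[symmetric] Let_def y y1 y2 y3 using assms(2) by simp
qed

lemma dec_hub: "dec hub = (nA + 1, 0, 0)"
  by (auto simp: dec_def hub_def)

lemma dec_vtx:
  assumes "a \<le> nA" "u < nU" "s \<le> 2 * l"
  shows "dec (vtx a u s) =
    (if s = 0 then (if a < nA then (a, 0, 0) else (nA, u, 0))
     else if s = 2 * l \<and> a < nA then (if inc a u then (nA, u, l) else (nA + 1, 0, 0))
     else (a, u, s))"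
proof -
  consider "s = 0" | "s = 2 * l" "a < nA" "s > 0" | "s = 2 * l" "a = nA" "s > 0" | "0 < s" "s < 2 * l"
    using assms by linarith
  then show ?thesis
  proof cases
    case 1 then show ?thesis using assms by (auto simp: vtx_def dec_def)
  next
    case 2 then show ?thesis using assms l dec_inner[of u l nA] by (auto simp: vtx_def dec_hub)
  next
    case 3 then show ?thesis using assms l by (auto simp: vtx_def dec_def hub_def)
  next
    case 4 then show ?thesis using assms dec_inner[of u s a] by (auto simp: vtx_def)
  qed
qed

lemma vtx_dec:
  assumes "x < nv" "x \<noteq> hub"
  obtains a u s where "a \<le> nA" "u < nU" "s \<le> 2 * l" "x = vtx a u s"
proof -
  consider "x < nA" | "nA \<le> x" "x < nA + nU" | "nA + nU \<le> x" "x < hub" | "x > hub"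
    using assms by linarith
  then show ?thesis
  proof cases
    case 1 then show ?thesis using nU l by (intro that[of x 0 0]) (auto simp: vtx_def)
  next
    case 2 then show ?thesis using nU l by (intro that[of nA "x - nA" 0]) (auto simp: vtx_def)
  next
    case 3 then show ?thesis using nU l
      by (intro that[of nA "x - nA - nU" "2 * l"]) (auto simp: vtx_def hub_def)
  next
    case 4
    define q where "q = 2 * l - 1"
    define y where "y = x - hub - 1"
    define r where "r = y div q"
    have q: "q > 0" using l by (simp add: q_def)
    have "y < (nA + 1) * nU * q" using assms(1) 4 unfolding nv_def y_def q_def by linarith
    then have "r < (nA + 1) * nU" unfolding r_def by (rule less_mult_imp_div_less)
    then have "r div nU < nA + 1" by (rule less_mult_imp_div_less)
    then have a: "r div nU \<le> nA" by linarith
    have "y mod q < q" using q by (rule mod_less_divisor)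
    then have s: "0 < y mod q + 1" "y mod q + 1 < 2 * l" unfolding q_def by linarith+
    have "y = r * q + y mod q" unfolding r_def by simp
    moreover have "x = hub + 1 + y" using 4 unfolding y_def by linarith
    ultimately have "x = hub + r * q + (y mod q + 1)" by linarith
    then have "x = inner (r div nU) (r mod nU) (y mod q + 1)"
      unfolding inner_def q_def[symmetric] by (simp only: div_mult_mod_eq)
    then show ?thesis using a s nU
      by (intro that[of "r div nU" "r mod nU" "y mod q + 1"]) (auto simp: vtx_def)
  qed
qed

section \<open>Simplicity of the graph\<close>

lemma vtx_inj:
  assumes "a \<le> nA" "u < nU" "s \<le> 2 * l" "t \<le> 2 * l" "vtx a u s = vtx a u t"
  shows "s = t"
proof -
  have "dec (vtx a u s) = dec (vtx a u t)" using assms by simp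
  then show ?thesis unfolding dec_vtx[OF assms(1-3)] dec_vtx[OF assms(1,2,4)]
    using assms(1-4) l by (auto split: if_splits)
qed

text \<open>Since \<open>2 * l \<ge> 2\<close>, each edge has an endpoint strictly inside its path,
  at position \<open>i\<close>. For a row \<open>a < nA\<close> such a vertex lies on no other
  path.\<close>

lemma row_of_edge:
  assumes "a \<le> nA" "u < nU" "s < 2 * l" "a' \<le> nA" "u' < nU" "s' < 2 * l"
    and eq: "{vtx a u s, vtx a u (s + 1)} = {vtx a' u' s', vtx a' u' (s' + 1)}" and "a < nA"
  shows "a = a' \<and> u = u'"
proof -
  define i where "i = (if s = 0 then 1 else s)"
  have i: "0 < i" "i < 2 * l" using assms(3) l by (auto simp: i_def)
  have "vtx a u i \<in> {vtx a' u' s', vtx a' u' (s' + 1)}" unfolding eq[symmetric] by (auto simp: i_def)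
  then obtain t where t: "t \<le> 2 * l" "vtx a u i = vtx a' u' t"
      by (metis Suc_leI assms(6) Suc_eq_plus1 insertE less_imp_le singletonD)
  then have "dec (vtx a u i) = dec (vtx a' u' t)" by simp
  then show ?thesis unfolding dec_vtx[OF assms(1,2) less_imp_le[OF i(2)]] dec_vtx[OF assms(4,5) t(1)]
    using assms(1-6,8) i t(1) by (auto split: if_splits)
qed

text \<open>Rows below \<open>nA\<close> are settled by an interior vertex. In row \<open>nA\<close>
  every vertex carries its own column as a coordinate, because both ends of the path are
  free.\<close>

lemma edge_inj:
  assumes "a \<le> nA" "u < nU" "s < 2 * l" "a' \<le> nA" "u' < nU" "s' < 2 * l"
    and eq: "{vtx a u s, vtx a u (s + 1)} = {vtx a' u' s', vtx a' u' (s' + 1)}"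
  shows "a = a' \<and> u = u' \<and> s = s'"
proof -
  have row: "a = a' \<and> u = u'"
  proof (cases "a < nA \<or> a' < nA")
    case True
    then show ?thesis using row_of_edge[of a u s a' u' s'] row_of_edge[of a' u' s' a u s] assms by auto
  next
    case False
    then have A: "a = nA" "a' = nA" using assms by auto
    have "vtx a u s \<in> {vtx a' u' s', vtx a' u' (s' + 1)}" using eq by auto
    then obtain t where t: "t \<le> 2 * l" "vtx a u s = vtx a' u' t"
      by (metis Suc_leI assms(6) Suc_eq_plus1 insertE less_imp_le singletonD)
    then have "dec (vtx a u s) = dec (vtx a' u' t)" by simp
    then show ?thesis unfolding dec_vtx[OF assms(1,2) less_imp_le[OF assms(3)]] dec_vtx[OF assms(4,5) t(1)]
      using assms(1-6) t(1) A by (auto split: if_splits)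
  qed
  have "vtx a u s = vtx a u s' \<and> vtx a u (s + 1) = vtx a u (s' + 1) \<or>
    vtx a u s = vtx a u (s' + 1) \<and> vtx a u (s + 1) = vtx a u s'"
    using eq row by (auto simp: doubleton_eq_iff)
  then have "s = s' \<or> (s = s' + 1 \<and> s + 1 = s')"
    using vtx_inj[of a u s s'] vtx_inj[of a u s "s' + 1"] vtx_inj[of a u "s + 1" s'] assms by auto
  then show ?thesis using row by auto
qed

lemma is_graph_gr: "is_graph gr"
  unfolding is_graph_def
proof (intro conjI)
  have *: "fst (edge e) < nv \<and> snd (edge e) < nv \<and> fst (edge e) \<noteq> snd (edge e)" if "e < ne" for e
  proof -
    note b = edge_index_bounds[OF that]
    show ?thesis using vtx_inj[OF b(1,2), of "e mod (2 * l)" "e mod (2 * l) + 1"] b(3)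
      vtx_less[OF b(1,2), of "e mod (2 * l)"] vtx_less[OF b(1,2), of "e mod (2 * l) + 1"]
      unfolding edge_def Let_def by auto
  qed
  then show "\<forall>(u, v)\<in>set (snd gr). u < fst gr \<and> v < fst gr \<and> u \<noteq> v"
    by (auto simp: gr_def dest: * split: prod.splits) (metis fst_conv snd_conv *)+
  have "inj_on (\<lambda>e. {fst (edge e), snd (edge e)}) {0..<ne}"
  proof (rule inj_onI)
    fix e e' assume ee: "e \<in> {0..<ne}" "e' \<in> {0..<ne}"
      "{fst (edge e), snd (edge e)} = {fst (edge e'), snd (edge e')}"
    then have "e < ne" "e' < ne" by auto
    note b = edge_index_bounds[OF this(1)] and b' = edge_index_bounds[OF this(2)]
    have "e div (2 * l * nU) = e' div (2 * l * nU) \<and> (e div (2 * l)) mod nU = (e' div (2 * l)) mod nU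
      \<and> e mod (2 * l) = e' mod (2 * l)"
      using ee(3) by (intro edge_inj[OF b(1-3) b'(1-3)]) (simp add: edge_def Let_def)
    then show "e = e'" using b(4) b'(4) by metis
  qed
  then show "distinct (map (\<lambda>(u, v). {u, v}) (snd gr))"
    by (simp add: gr_def distinct_map comp_def case_prod_beta o_def)
  \<comment> \<open>The term for the interior vertices occurs in \<open>nv\<close> and in
    \<open>ne\<close> alike, so \<open>n \<le> m + 1\<close> comes down to
    \<open>nA + nU \<le> nA * nU\<close>, which holds for numbers at least 2.\<close>
  have "(nA - 1) * (nU - 1) \<ge> 1" using nA nU by (simp add: Suc_le_eq)
  then have "nA * nU \<ge> nA + nU" using nA nU by (cases nA; cases nU) auto
  moreover have "2 * l * nU * (nA + 1) = (nA + 1) * nU * (2 * l - 1) + (nA + 1) * nU"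
    using l by (cases l) (auto simp: algebra_simps)
  ultimately show "fst gr \<le> num_edges gr + 1"
    by (simp add: gr_def num_edges_def nv_def ne_def hub_def)
qed

section \<open>Radius of the incidence graph\<close>

lemma hub_less: "hub < nv" by (simp add: nv_def)

lemma vertices_gr: "vertices gr = {..<nv}" by (simp add: vertices_def gr_def)

text \<open>Cut each path in the middle: every point lies within \<open>l\<close> of a left vertex,
  of a right vertex or of the hub, and left and right vertices lie within \<open>2 * l\<close> of a
  centre.\<close>

lemma radius_upper:
  assumes S: "S \<subseteq> {..<nA}" "card S = k" and cover: "\<And>u. u < nU \<Longrightarrow> \<exists>a\<in>S. inc a u"
  shows "radius_of (k + 1) gr \<le> enat (3 * l)"
proof -
  let ?C = "insert hub S" and ?E = "edges gr"
  have fin: "finite S" using S(1) finite_subset by blast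
  have "hub \<notin> S" using S by (auto simp: hub_def)
  then have card: "card ?C = k + 1" using S fin by simp
  have a_vtx: "vtx a u 0 = a" if "a < nA" for a u using that by (simp add: vtx_def)
  have a_hub: "near ?E (2 * l) a hub" if a: "a < nA" for a
  proof -
    obtain u where u: "u < nU" "\<not> inc a u" using not_all[OF a] by auto
    have "vtx a u (2 * l) = hub" using u a l by (simp add: vtx_def)
    then show ?thesis using near_path[of a u "2 * l" 0] u a a_vtx[OF a, of u] by auto
  qed
  have mid: "\<exists>c\<in>?C. near ?E (2 * l) (vtx nA u l) c" if u: "u < nU" for u
  proof -
    obtain a where a: "a \<in> S" "inc a u" using cover[OF u] by auto
    then have "a < nA" using S by auto
    have "vtx a u (2 * l) = vtx nA u l" using u a l \<open>a < nA\<close> by (simp add: vtx_def)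
    then show ?thesis using near_path[of a u "2 * l" 0] u a a_vtx[of a u] \<open>a < nA\<close>
      by (auto intro: near_sym)
  qed
  show ?thesis unfolding vertices_gr
  proof (rule k_radius_le[OF _ card])
    show "?C \<subseteq> {..<nv}" using S hub_less by (auto simp: nv_def hub_def)
    fix x assume "x \<in> {..<nv}"
    show "\<exists>c\<in>?C. near ?E (3 * l) x c"
    proof (cases "x = hub")
      case True then show ?thesis using near_refl by auto
    next
      case False
      then obtain a u s where x: "a \<le> nA" "u < nU" "s \<le> 2 * l" "x = vtx a u s"
        using \<open>x \<in> {..<nv}\<close> by (metis vtx_dec lessThan_iff)
      consider "a = nA" | "a < nA" "s \<le> l" | "a < nA" "s > l" "inc a u" | "a < nA" "s > l" "\<not> inc a u"
        using x by linarith
      then show ?thesis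
      proof cases
        case 1
        have "near ?E l x (vtx nA u l)"
        proof (cases "s \<le> l")
          case True
          then show ?thesis using near_path[of nA u l s] x 1
            by (auto intro: near_mono)
        next
          case False
          then show ?thesis using near_path[of nA u s l] x 1
            by (auto intro: near_mono near_sym)
        qed
        then show ?thesis using mid[OF x(2)] near_trans[of ?E l x "vtx nA u l" "2 * l"] by fastforce
      next
        case 2
        then have "near ?E l x a" using near_path[of a u s 0] x a_vtx[of a u]
          by (auto intro: near_mono near_sym)
        then show ?thesis using a_hub[of a] 2 near_trans[of ?E l x a "2 * l"] by fastforce
      next
        case 3
        then have "vtx a u (2 * l) = vtx nA u l" using l by (simp add: vtx_def)
        then have "near ?E l x (vtx nA u l)" using near_path[of a u "2 * l" s] x 3
          by (auto intro: near_mono)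
        then show ?thesis using mid[OF x(2)] near_trans[of ?E l x "vtx nA u l" "2 * l"] by fastforce
      next
        case 4
        then have "vtx a u (2 * l) = hub" using l by (simp add: vtx_def)
        then have "near ?E (3 * l) x hub" using near_path[of a u "2 * l" s] x 4
          by (auto intro: near_mono)
        then show ?thesis by auto
      qed
    qed
  qed
qed

text \<open>A 1-Lipschitz lower bound, truncated at \<open>5 * l\<close>, for the distance to the end \<open>vtx nA u 0\<close>.\<close>

definition pot :: "nat \<Rightarrow> nat \<Rightarrow> int" where
  "pot u x = (case dec x of (a, w, s) \<Rightarrow>
     if a < nA then
       (if inc a u then (if w = u then 3 * int l - int s else 3 * int l + int s) else 5 * int l)
     else if a = nA \<and> w = u then int s else 5 * int l)"

text \<open>Paths share vertices, so the formula must give one value at each junction. On an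
  incident row it is \<open>3 * l\<close> at the left vertex, falls to \<open>l\<close> at the right
  vertex \<open>u\<close>, which is position \<open>l\<close> of row \<open>nA\<close>, and rises to
  \<open>5 * l\<close> at the end of every other path. The hub, the other right vertices and the
  non-incident rows all have \<open>5 * l\<close>.\<close>

lemma pot_vtx:
  assumes "a \<le> nA" "w < nU" "s \<le> 2 * l"
  shows "pot u (vtx a w s) =
    (if a < nA then
       (if inc a u then (if w = u then 3 * int l - int s else 3 * int l + int s) else 5 * int l)
     else if w = u then int s else 5 * int l)"
  using assms l unfolding pot_def dec_vtx[OF assms] by auto

lemma pot_lipschitz: "{x, y} \<in> edges gr \<Longrightarrow> pot u x \<le> pot u y + 1"
  by (auto simp: edges_gr doubleton_eq_iff pot_vtx)

lemma radius_lower: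
  assumes "radius_of k gr < enat (5 * l)"
  obtains T :: "(nat + nat) set" where "finite T" "card T \<le> k"
    "\<And>u. u < nU \<Longrightarrow> Inr u \<in> T \<or> (\<exists>a<nA. Inl a \<in> T \<and> inc a u)"
proof -
  have "radius_of k gr \<le> enat (5 * l - 1)"
    using assms l by (cases "radius_of k gr") auto
  then obtain C where C: "C \<subseteq> vertices gr" "card C = k"
    "\<forall>v\<in>vertices gr. \<exists>c\<in>C. near (edges gr) (5 * l - 1) v c"
    using centres_of_k_radius_le by metis
  have fin: "finite C" using C(1) by (rule finite_subset) (simp add: vertices_gr)
  \<comment> \<open>The hub has potential \<open>5 * l\<close> for every \<open>u\<close> and covers
    nothing, so giving it the tag \<open>Inr 0\<close> can only enlarge what the tags cover.\<close>
  define tag :: "nat \<Rightarrow> nat + nat"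
    where "tag x = (case dec x of (a, w, s) \<Rightarrow> if a < nA then Inl a else Inr w)" for x
  show ?thesis
  proof (rule that[of "tag ` C"])
    show "finite (tag ` C)" using fin by simp
    show "card (tag ` C) \<le> k" using card_image_le[OF fin, of tag] C(2) by simp
    fix u assume u: "u < nU"
    let ?x = "vtx nA u 0"
    have p: "pot u ?x = 0" using pot_vtx[of nA u 0 u] u by simp
    have "?x \<in> vertices gr" using vtx_less[of nA u 0] u by (simp add: vertices_gr)
    then obtain c where c: "c \<in> C" "near (edges gr) (5 * l - 1) ?x c" using C(3) by blast
    have "pot u c \<le> pot u ?x + int (5 * l - 1)"
      by (rule lipschitz_near[OF pot_lipschitz near_sym[OF c(2)]])
    then have "pot u c < 5 * int l" using p l by auto
    then have "tag c = Inr u \<or> (\<exists>a<nA. tag c = Inl a \<and> inc a u)"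
      unfolding pot_def tag_def by (cases "dec c") (auto split: if_splits)
    moreover have "tag c \<in> tag ` C" using c(1) by (rule imageI)
    ultimately show "Inr u \<in> tag ` C \<or> (\<exists>a<nA. Inl a \<in> tag ` C \<and> inc a u)" by metis
  qed
qed

end

section \<open>Satisfiability as a covering problem\<close>

text \<open>The summand 1 makes \<open>k\<close> blocks hold more than \<open>N\<close> variables,
  at the price of a factor of at most 2 in \<open>2 ^ B\<close>.\<close>

definition block :: "nat \<Rightarrow> cnf \<Rightarrow> nat" where
  "block k F = fst F div k + 1"

definition clause_sat :: "nat \<Rightarrow> nat \<Rightarrow> nat \<Rightarrow> literal list \<Rightarrow> bool" where
  "clause_sat B i b cl \<longleftrightarrow> (\<exists>(x, v)\<in>set cl. x div B = i \<and> odd (b div 2 ^ (x mod B)) = v)"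

text \<open>Out of range it is the empty clause, in accordance with the 0 that the program reads in
  memory behind the formula.\<close>

definition clause_at :: "cnf \<Rightarrow> nat \<Rightarrow> literal list" where
  "clause_at F c = (if c < length (snd F) then snd F ! c else [])"

text \<open>
  The left vertex \<open>a\<close> is the assignment with bits \<open>a mod 2 ^ B\<close> of group \<open>a div 2 ^ B\<close>. The right vertex \<open>j + k * v\<close>
  forces a choice in group \<open>j\<close> if \<open>v = M * M\<close>, and is the triple \<open>(v div M, v mod M, j)\<close> otherwise.
\<close>

definition incident :: "nat \<Rightarrow> cnf \<Rightarrow> nat \<Rightarrow> nat \<Rightarrow> bool" where
  "incident k F a u = (let B = block k F; M = length (snd F); i = a div 2 ^ B; b = a mod 2 ^ B;
     j = u mod k; v = u div k;
     s = clause_sat B i b (clause_at F (v div M)); s' = clause_sat B i b (clause_at F (v mod M))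
     in if v = M * M then i = j else if i = j then s \<and> s' else s \<or> s')"

definition num_left :: "nat \<Rightarrow> cnf \<Rightarrow> nat" where
  "num_left k F = k * 2 ^ block k F"

definition num_right :: "nat \<Rightarrow> cnf \<Rightarrow> nat" where
  "num_right k F = k * (length (snd F) * length (snd F) + 1)"

lemma incident_group:
  assumes "j < k"
  shows "incident k F a (j + k * (length (snd F) * length (snd F))) \<longleftrightarrow> a div 2 ^ block k F = j"
  using assms unfolding incident_def Let_def by simp

lemma pair_less: "c < M \<Longrightarrow> c' < M \<Longrightarrow> c * M + c' < M * (M::nat)"
proof -
  assume "c < M" "c' < M"
  then have "(c + 1) * M \<le> M * M" by (intro mult_le_mono1) simp
  then show ?thesis using \<open>c' < M\<close> by simp
qed

lemma div_mod_pair: "c' < M \<Longrightarrow> (c * M + c') div M = (c::nat)" "c' < M \<Longrightarrow> (c * M + c') mod M = c'"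
  by auto

lemma incident_pair:
  assumes "j < k" "c < length (snd F)" "c' < length (snd F)"
  shows "incident k F a (j + k * (c * length (snd F) + c')) \<longleftrightarrow>
    (let B = block k F; i = a div 2 ^ B; b = a mod 2 ^ B;
       s = clause_sat B i b (snd F ! c); s' = clause_sat B i b (snd F ! c')
     in if i = j then s \<and> s' else s \<or> s')"
proof -
  let ?M = "length (snd F)" and ?u = "j + k * (c * length (snd F) + c')"
  have v: "?u div k = c * ?M + c'" "?u mod k = j" using assms by auto
  have w: "(c * ?M + c') div ?M = c" "(c * ?M + c') mod ?M = c'" using div_mod_pair[OF assms(3)] by auto
  have "c * ?M + c' \<noteq> ?M * ?M" using pair_less[OF assms(2,3)] by simp
  then show ?thesis unfolding incident_def v w Let_def clause_at_def using assms by simp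
qed

lemma right_less: "j < k \<Longrightarrow> v \<le> length (snd F) * length (snd F) \<Longrightarrow> j + k * v < num_right k F"
proof -
  let ?M = "length (snd F)"
  assume "j < k" "v \<le> ?M * ?M"
  then have "k * v \<le> k * (?M * ?M)" by (intro mult_le_mono2)
  then have "j + k * v < k * (?M * ?M) + k" using \<open>j < k\<close> by linarith
  then show ?thesis unfolding num_right_def by simp
qed

lemma incidence_graph_incident:
  assumes "k \<ge> 2" "l \<ge> 1"
  shows "incidence_graph l (num_left k F) (num_right k F) (incident k F)"
proof
  show "l \<ge> 1" by fact
  have "k * 1 \<le> num_left k F" unfolding num_left_def by (intro mult_le_mono2) simp
  then show "num_left k F \<ge> 2" using assms by linarith
  have "k * 1 \<le> num_right k F" unfolding num_right_def by (intro mult_le_mono2) simp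
  then show "num_right k F \<ge> 2" using assms by linarith
  fix a :: nat
  \<comment> \<open>A group other than that of \<open>a\<close>: the right vertex that forces a
    choice in it is not incident to \<open>a\<close>.\<close>
  define j where "j = (if a div 2 ^ block k F = 0 then 1 else 0 :: nat)"
  have j: "j < k" "a div 2 ^ block k F \<noteq> j" using assms by (auto simp: j_def)
  show "\<exists>u<num_right k F. \<not> incident k F a u"
    using incident_group[OF j(1), of F a] j right_less[OF j(1), of _ F] by blast
qed

lemma ex_bits: "\<exists>b<2 ^ B. \<forall>t<B. odd ((b::nat) div 2 ^ t) = f t"
proof (induction B arbitrary: f)
  case (Suc B)
  obtain b' :: nat where b: "b' < 2 ^ B" "\<And>t. t < B \<Longrightarrow> odd (b' div 2 ^ t) = f (Suc t)"
    using Suc[of "\<lambda>t. f (Suc t)"] by auto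
  have "odd ((of_bool (f 0) + 2 * b') div 2 ^ t) = f t" if "t < Suc B" for t
  proof (cases t)
    case (Suc t')
    have "(of_bool (f 0) + 2 * b') div 2 ^ t = b' div 2 ^ t'"
      unfolding Suc power_Suc div_mult2_eq by simp
    then show ?thesis using b(2)[of t'] that Suc by simp
  qed simp
  then show ?case using b(1) by (intro exI[of _ "of_bool (f 0) + 2 * b'"]) auto
qed simp

lemma block_bound: "k > 0 \<Longrightarrow> x < fst F \<Longrightarrow> x div block k F < k"
proof -
  assume k: "k > 0" and "x < fst F"
  have "fst F < k * block k F" unfolding block_def using dividend_less_times_div[OF k, of "fst F"] by simp
  then show ?thesis using \<open>x < fst F\<close> by (intro less_mult_imp_div_less) simp
qed

text \<open>Cut a satisfying assignment into blocks. For a triple \<open>(c, c', j)\<close> let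
  groups \<open>i\<close> and \<open>i'\<close> satisfy the two clauses. If both are
  \<open>j\<close>, the vertex of group \<open>j\<close> satisfies both as demanded; otherwise the
  one outside \<open>j\<close> needs to satisfy only one.\<close>

lemma satisfiable_imp_cover:
  assumes "k \<ge> 2" "is_qcnf q F" "satisfiable F"
  shows "\<exists>S\<subseteq>{..<num_left k F}. card S = k \<and> (\<forall>u<num_right k F. \<exists>a\<in>S. incident k F a u)"
proof -
  let ?B = "block k F" and ?M = "length (snd F)"
  obtain \<sigma> where \<sigma>: "\<And>cl. cl \<in> set (snd F) \<Longrightarrow> \<exists>(x, v)\<in>set cl. \<sigma> x = v"
    using assms(3) unfolding satisfiable_def by auto
  have "\<exists>b<2 ^ ?B. \<forall>t<?B. odd ((b::nat) div 2 ^ t) = \<sigma> (i * ?B + t)" for i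
    using ex_bits[of ?B "\<lambda>t. \<sigma> (i * ?B + t)"] by auto
  then obtain b :: "nat \<Rightarrow> nat" where b: "\<And>i. b i < 2 ^ ?B"
    "\<And>i t. t < ?B \<Longrightarrow> odd (b i div 2 ^ t) = \<sigma> (i * ?B + t)" by metis
  define h where "h i = i * 2 ^ ?B + b i" for i
  have h: "h i div 2 ^ ?B = i" "h i mod 2 ^ ?B = b i" for i using b(1)[of i] unfolding h_def by auto
  have sat: "\<exists>i<k. clause_sat ?B i (b i) (snd F ! c)" if c: "c < ?M" for c
  proof -
    have mem: "snd F ! c \<in> set (snd F)" using c by simp
    obtain x v where xv: "(x, v) \<in> set (snd F ! c)" "\<sigma> x = v" using \<sigma>[OF mem] by auto
    have x: "x < fst F" using assms(2) mem xv unfolding is_qcnf_def by auto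
    have "x mod ?B < ?B" unfolding block_def by simp
    then have "odd (b (x div ?B) div 2 ^ (x mod ?B)) = v"
      using b(2)[of "x mod ?B" "x div ?B"] xv(2) div_mult_mod_eq[of x ?B] by metis
    then show ?thesis using block_bound[of k x F] assms(1) x xv unfolding clause_sat_def by force
  qed
  show ?thesis
  proof (intro exI[of _ "h ` {..<k}"] conjI allI impI)
    show "h ` {..<k} \<subseteq> {..<num_left k F}"
    proof
      fix y assume "y \<in> h ` {..<k}"
      then obtain i where i: "i < k" "y = h i" by auto
      have "(i + 1) * 2 ^ ?B \<le> k * 2 ^ ?B" using i by (intro mult_le_mono1) simp
      then show "y \<in> {..<num_left k F}" using i b(1)[of i] unfolding h_def num_left_def by simp
    qed
    have "inj_on h {..<k}" using h(1) by (metis inj_onI)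
    then show "card (h ` {..<k}) = k" by (simp add: card_image)
    fix u assume u: "u < num_right k F"
    define j where "j = u mod k"
    define v where "v = u div k"
    have ujv: "u = j + k * v" "j < k" unfolding j_def v_def using assms(1) by auto
    have "v < ?M * ?M + 1" unfolding v_def
      using u unfolding num_right_def by (intro less_mult_imp_div_less) (simp add: mult.commute)
    then consider "v = ?M * ?M" | "v < ?M * ?M" by linarith
    then show "\<exists>a\<in>h ` {..<k}. incident k F a u"
    proof cases
      case 1
      then show ?thesis using incident_group[OF ujv(2), of F "h j"] h ujv by auto
    next
      case 2
      then have "0 < ?M" by (cases ?M) auto
      define c where "c = v div ?M"
      define c' where "c' = v mod ?M"
      have c: "c < ?M" "c' < ?M" "v = c * ?M + c'" unfolding c_def c'_def
        using \<open>0 < ?M\<close> less_mult_imp_div_less[OF 2] by auto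
      obtain i i' where i: "i < k" "clause_sat ?B i (b i) (snd F ! c)"
        and i': "i' < k" "clause_sat ?B i' (b i') (snd F ! c')" using sat c by blast
      have *: "incident k F (h n) u \<longleftrightarrow> (if n = j then clause_sat ?B n (b n) (snd F ! c) \<and> clause_sat ?B n (b n) (snd F ! c')
         else clause_sat ?B n (b n) (snd F ! c) \<or> clause_sat ?B n (b n) (snd F ! c'))" for n
        using incident_pair[OF ujv(2) c(1,2), of "h n"] unfolding ujv(1) c(3) Let_def h .
      show ?thesis
      proof (cases "i = j \<and> i' = j")
        case True then show ?thesis using * i i' by auto
      next
        case False then show ?thesis using * i i' by (metis imageI lessThan_iff)
      qed
    qed
  qed
qed

text \<open>Partial assignments glue together because the groups are disjoint. The tuple
  \<open>\<beta>\<close> is arbitrary since this is applied twice: to the tuple read off a cover,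
  and to that tuple with one entry exchanged.\<close>

lemma unsatisfiable_tuple:
  assumes "\<not> satisfiable F"
  shows "\<exists>c<length (snd F). \<forall>i. \<not> clause_sat B i (\<beta> i) (snd F ! c)"
proof (rule ccontr)
  assume "\<not> ?thesis"
  then have *: "\<exists>i. clause_sat B i (\<beta> i) cl" if "cl \<in> set (snd F)" for cl
    using that by (metis in_set_conv_nth)
  have "satisfiable F"
    unfolding satisfiable_def
  proof (intro exI[of _ "\<lambda>x. odd (\<beta> (x div B) div 2 ^ (x mod B))"] ballI)
    fix cl assume "cl \<in> set (snd F)"
    then obtain i x v where "(x, v) \<in> set cl" "x div B = i" "odd (\<beta> i div 2 ^ (x mod B)) = v"
      using * unfolding clause_sat_def by fastforce
    then show "\<exists>(x, b)\<in>set cl. odd (\<beta> (x div B) div 2 ^ (x mod B)) = b" by force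
  qed
  then show False using assms by simp
qed

text \<open>A tag \<open>Inl a\<close> stands for a centre that acts as the left vertex \<open>a\<close>, a tag \<open>Inr u\<close> for one that covers
  the right vertex \<open>u\<close> only.\<close>

lemma cover_imp_satisfiable:
  fixes T :: "(nat + nat) set"
  assumes k: "k \<ge> 2" and T: "finite T" "card T \<le> k + 1"
    and cover: "\<And>u. u < num_right k F \<Longrightarrow> Inr u \<in> T \<or> (\<exists>a<num_left k F. Inl a \<in> T \<and> incident k F a u)"
  shows "satisfiable F"
proof (rule ccontr)
  assume unsat: "\<not> satisfiable F"
  let ?B = "block k F" and ?M = "length (snd F)"
  let ?P = "2 ^ ?B :: nat"
  define g where "g j = j + k * (?M * ?M)" for j
  \<comment> \<open>The vertex \<open>g j\<close> is served only by a tag of group \<open>j\<close>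
    or by its own tag, so these vertices select \<open>k\<close> distinct tags.\<close>
  have "\<exists>t. t \<in> T \<and> (t = Inr (g j) \<or> (\<exists>a. t = Inl a \<and> a div ?P = j))" if j: "j < k" for j
    using cover[OF right_less[OF j order_refl]] incident_group[OF j] unfolding g_def by metis
  then obtain \<tau> where \<tau>: "\<And>j. j < k \<Longrightarrow> \<tau> j \<in> T"
    "\<And>j. j < k \<Longrightarrow> \<tau> j = Inr (g j) \<or> (\<exists>a. \<tau> j = Inl a \<and> a div ?P = j)" by metis
  have inj: "inj_on \<tau> {..<k}"
  proof (rule inj_onI)
    fix i j assume "i \<in> {..<k}" "j \<in> {..<k}" "\<tau> i = \<tau> j"
    then show "i = j" using \<tau>(2)[of i] \<tau>(2)[of j] unfolding g_def by auto
  qed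
  let ?T' = "\<tau> ` {..<k}"
  have "card ?T' = k" using inj by (simp add: card_image)
  then have "card (T - ?T') \<le> 1" using T \<tau>(1) by (subst card_Diff_subset) auto
  \<comment> \<open>At most one tag lies outside the selection; if there is none, \<open>e\<close>
    is arbitrary.\<close>
  then have "\<exists>e. T - ?T' \<subseteq> {e}"
    using card_le_Suc0_iff_eq[of "T - ?T'"] T by (metis One_nat_def finite_Diff insertI1 subsetI)
  then obtain e where e: "T \<subseteq> insert e ?T'" by blast
  \<comment> \<open>A group whose tag is \<open>Inr\<close> has no assignment. The default 0 does no
    harm, as that tag covers no triple.\<close>
  define \<beta> where "\<beta> j = (case \<tau> j of Inl a \<Rightarrow> a mod ?P | Inr _ \<Rightarrow> 0)" for j
  let ?s = "\<lambda>a c. clause_sat ?B (a div ?P) (a mod ?P) (snd F ! c)"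
  obtain c where c: "c < ?M" "\<And>i. \<not> clause_sat ?B i (\<beta> i) (snd F ! c)"
    using unsatisfiable_tuple[OF unsat, of ?B \<beta>] by auto
  \<comment> \<open>On the triple \<open>(c, c', j)\<close>, \<open>\<tau> j\<close> fails because
    of \<open>c\<close>, where both clauses are demanded, and the other \<open>\<tau> i\<close> fail
    on both clauses. Only \<open>e\<close> remains.\<close>
  have uncovered: "Inr (j + k * (c * ?M + c')) = e \<or> (\<exists>a<num_left k F. e = Inl a \<and> (if a div ?P = j then ?s a c \<and> ?s a c' else ?s a c \<or> ?s a c'))"
    if j: "j < k" and c': "c' < ?M" "\<And>i. i \<noteq> j \<Longrightarrow> \<not> clause_sat ?B i (\<beta> i) (snd F ! c')" for j c'
  proof -
    let ?u = "j + k * (c * ?M + c')"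
    have v: "c * ?M + c' < ?M * ?M" using pair_less c c' by auto
    have "?u < num_right k F" using right_less[OF j] v by simp
    then consider "Inr ?u \<in> T" | a where "a < num_left k F" "Inl a \<in> T" "incident k F a ?u" using cover by blast
    then show ?thesis
    proof cases
      case 1
      have "Inr ?u \<notin> ?T'"
      proof
        assume "Inr ?u \<in> ?T'"
        then obtain i where i: "i < k" "?u = g i" using \<tau>(2) by force
        have "?u div k = c * ?M + c'" using j by simp
        moreover have "g i div k = ?M * ?M" using i unfolding g_def by simp
        ultimately show False using i v by simp
      qed
      then show ?thesis using 1 e by auto
    next
      case 2
      have inc: "if a div ?P = j then ?s a c \<and> ?s a c' else ?s a c \<or> ?s a c'"
        using 2(3) incident_pair[OF j c(1) c'(1), of a] unfolding Let_def by simp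
      have "Inl a \<notin> ?T'"
      proof
        assume "Inl a \<in> ?T'"
        then obtain i where i: "i < k" "\<tau> i = Inl a" by auto
        then have "a div ?P = i" "\<beta> i = a mod ?P" using \<tau>(2)[of i] by (auto simp: \<beta>_def)
        then show False using inc c(2)[of i] c'(2)[of i] by (auto split: if_splits)
      qed
      then show ?thesis using 2 e inc by auto
    qed
  qed
  show False
  proof (cases e)
    \<comment> \<open>Then \<open>e\<close> would have to be the tag of \<open>(c, c, 0)\<close> and
      of \<open>(c, c, 1)\<close> at once.\<close>
    case (Inr w)
    then have "0 + k * (c * ?M + c) = w" "1 + k * (c * ?M + c) = w"
      using uncovered[of 0 c] uncovered[of 1 c] c k by auto
    then show False by simp
  next
    case (Inl a)
    let ?j = "a div ?P"
    have "a < num_left k F" using uncovered[of 0 c] c k Inl by auto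
    then have j: "?j < k" unfolding num_left_def by (rule less_mult_imp_div_less)
    \<comment> \<open>With the assignment of \<open>e\<close> put into group \<open>?j\<close>, some
      clause \<open>c'\<close> fails everywhere. So \<open>e\<close> fails on \<open>c'\<close>,
      although \<open>(c, c', ?j)\<close> demands both clauses of it.\<close>
    obtain c' where c': "c' < ?M" "\<And>i. \<not> clause_sat ?B i ((\<beta>(?j := a mod ?P)) i) (snd F ! c')"
      using unsatisfiable_tuple[OF unsat, of ?B "\<beta>(?j := a mod ?P)"] by auto
    have n: "\<not> clause_sat ?B i (\<beta> i) (snd F ! c')" if "i \<noteq> ?j" for i using c'(2)[of i] that by simp
    have "\<not> ?s a c'" using c'(2)[of ?j] by simp
    then show False using uncovered[OF j c'(1) n] Inl by auto
  qed
qed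

section \<open>Programs with a total semantics\<close>

text \<open>Upper bounds on the time compose without exact step counts.\<close>

definition runs :: "nat \<Rightarrow> com \<Rightarrow> state \<Rightarrow> nat \<Rightarrow> state \<Rightarrow> bool" where
  "runs w c s T s' \<longleftrightarrow> (\<exists>t\<le>T. exec w c s t s')"

lemma runs_mono: "runs w c s T s' \<Longrightarrow> T \<le> T' \<Longrightarrow> runs w c s T' s'"
  unfolding runs_def by (meson order_trans)

lemma runs_Const: "runs w (Const r a) (R, M) 1 (R(r := a mod 2 ^ w), M)"
  unfolding runs_def by (blast intro: exec.Const)

lemma runs_Op: "runs w (Op f r x y) (R, M) 1 (R(r := word_op w f (R x) (R y)), M)"
  unfolding runs_def by (blast intro: exec.Op)

lemma runs_Load: "runs w (Load r x) (R, M) 1 (R(r := M (R x)), M)"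
  unfolding runs_def by (blast intro: exec.Load)

lemma runs_Store: "runs w (Store x y) (R, M) 1 (R, M(R x := R y))"
  unfolding runs_def by (blast intro: exec.Store)

lemma runs_Seq: "runs w p s T s' \<Longrightarrow> runs w q s' T' s'' \<Longrightarrow> runs w (Seq p q) s (T + T') s''"
  unfolding runs_def by (meson add_mono exec.Seq)

lemma runs_CondTrue: "fst s r \<noteq> 0 \<Longrightarrow> runs w p s T s' \<Longrightarrow> runs w (Cond r p q) s (Suc T) s'"
  unfolding runs_def by (meson Suc_le_mono exec.CondTrue)

lemma runs_CondFalse: "fst s r = 0 \<Longrightarrow> runs w q s T s' \<Longrightarrow> runs w (Cond r p q) s (Suc T) s'"
  unfolding runs_def by (meson Suc_le_mono exec.CondFalse)

lemma runs_WhileFalse: "fst s r = 0 \<Longrightarrow> runs w (While r p) s 1 s"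
  unfolding runs_def by (meson exec.WhileFalse order_refl)

lemma runs_WhileTrue:
  "fst s r \<noteq> 0 \<Longrightarrow> runs w p s T s' \<Longrightarrow> runs w (While r p) s' T' s'' \<Longrightarrow>
    runs w (While r p) s (Suc (T + T')) s''"
  unfolding runs_def by (meson Suc_le_mono add_mono exec.WhileTrue)

fun max_reg :: "com \<Rightarrow> nat" where
  "max_reg (Const r a) = r"
| "max_reg (Op f r x y) = Max {r, x, y}"
| "max_reg (Load r x) = max r x"
| "max_reg (Store x y) = max x y"
| "max_reg (Seq p q) = max (max_reg p) (max_reg q)"
| "max_reg (Cond r p q) = Max {r, max_reg p, max_reg q}"
| "max_reg (While r p) = max r (max_reg p)"

text \<open>Ensures that the registers set aside for the simulated program are still 0 once the
  graph has been written.\<close>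

lemma exec_max_reg: "exec w c s t s' \<Longrightarrow> max_reg c < x \<Longrightarrow> fst s' x = fst s x"
  by (induction rule: exec.induct) auto

lemma runs_max_reg: "runs w c s T s' \<Longrightarrow> max_reg c < x \<Longrightarrow> fst s' x = fst s x"
  unfolding runs_def using exec_max_reg by blast

section \<open>Expressions over unbounded numbers and their compilation\<close>

datatype expr = Lit nat | Var nat | Bin binop expr expr | Mem expr | Ite expr expr expr

fun nat_op :: "binop \<Rightarrow> nat \<Rightarrow> nat \<Rightarrow> nat" where
  "nat_op Plus x y = x + y"
| "nat_op Times x y = x * y"
| "nat_op Quot x y = x div y"
| "nat_op Rem x y = x mod y"
| "nat_op ShiftR x y = x div 2 ^ y"
| "nat_op Less x y = of_bool (x < y)"
| "nat_op Equal x y = of_bool (x = y)"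
| "nat_op _ x y = 0"

fun eval :: "expr \<Rightarrow> state \<Rightarrow> nat" where
  "eval (Lit n) s = n"
| "eval (Var x) s = fst s x"
| "eval (Bin f a b) s = nat_op f (eval a s) (eval b s)"
| "eval (Mem a) s = snd s (eval a s)"
| "eval (Ite c a b) s = (if eval c s \<noteq> 0 then eval a s else eval b s)"

fun wf_expr :: "nat \<Rightarrow> nat \<Rightarrow> expr \<Rightarrow> bool" where
  "wf_expr V D (Lit n) = (n \<le> V)"
| "wf_expr V D (Var x) = (x < D)"
| "wf_expr V D (Bin f a b) = (wf_expr V D a \<and> wf_expr V D b \<and> f \<in> {Plus, Times, Quot, Rem, ShiftR, Less, Equal})"
| "wf_expr V D (Mem a) = wf_expr V D a"
| "wf_expr V D (Ite c a b) = (wf_expr V D c \<and> wf_expr V D a \<and> wf_expr V D b)"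

text \<open>Sums are charged like products, as \<open>V ^ a + V ^ b \<le> V ^ (a + b)\<close> for
  \<open>V \<ge> 2\<close> and positive exponents. \<open>Mem\<close> keeps the degree of the
  address and \<open>Ite\<close> counts its condition, because these intermediate values have to fit
  into words too.\<close>

fun deg :: "expr \<Rightarrow> nat" where
  "deg (Lit n) = 1"
| "deg (Var x) = 1"
| "deg (Bin f a b) = deg a + deg b"
| "deg (Mem a) = deg a"
| "deg (Ite c a b) = deg c + deg a + deg b"

fun expr_cost :: "expr \<Rightarrow> nat" where
  "expr_cost (Lit n) = 1"
| "expr_cost (Var x) = 1"
| "expr_cost (Bin f a b) = expr_cost a + expr_cost b + 1"
| "expr_cost (Mem a) = expr_cost a + 1"
| "expr_cost (Ite c a b) = expr_cost c + expr_cost a + expr_cost b + 1"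

text \<open>The registers from \<open>d\<close> upwards act as an evaluation stack. There is no move
  instruction, so a register is copied by \<open>BitAnd\<close> with itself.\<close>

fun compile_expr :: "expr \<Rightarrow> reg \<Rightarrow> com" where
  "compile_expr (Lit n) d = Const d n"
| "compile_expr (Var x) d = Op BitAnd d x x"
| "compile_expr (Bin f a b) d = Seq (compile_expr a d) (Seq (compile_expr b (d + 1)) (Op f d d (d + 1)))"
| "compile_expr (Mem a) d = Seq (compile_expr a d) (Load d d)"
| "compile_expr (Ite c a b) d = Seq (compile_expr c d) (Cond d (compile_expr a d) (compile_expr b d))"

definition bounded :: "nat \<Rightarrow> nat \<Rightarrow> state \<Rightarrow> bool" where
  "bounded V D s \<longleftrightarrow> (\<forall>x<D. fst s x \<le> V) \<and> (\<forall>a. snd s a \<le> V)"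

lemma power_less_le: "a \<le> b \<Longrightarrow> V ^ b < X \<Longrightarrow> V \<ge> 2 \<Longrightarrow> V ^ a < (X::nat)"
  by (rule le_less_trans[OF power_increasing]) auto

lemma deg_pos: "deg e \<ge> 1"
  by (induction e) auto

lemma add_le_power:
  fixes V :: nat
  assumes "x \<le> V ^ a" "y \<le> V ^ b" "V \<ge> 2" "a \<ge> 1" "b \<ge> 1"
  shows "x + y \<le> V ^ (a + b)"
proof -
  have "V ^ a \<ge> 2" "V ^ b \<ge> 2" using assms self_le_power[of V a] self_le_power[of V b] by linarith+
  then have "V ^ a + V ^ b \<le> V ^ a * V ^ b" 
    by (metis add_mono mult_2 mult.commute mult_le_mono1 nat_le_linear order_trans add_le_mono le_refl mult_2_right)
  then show ?thesis using assms by (simp add: power_add)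
qed

lemma nat_op_le:
  fixes V :: nat
  assumes "x \<le> V ^ a" "y \<le> V ^ b" "V \<ge> 2" "a \<ge> 1" "b \<ge> 1"
  shows "nat_op f x y \<le> V ^ (a + b)"
proof -
  have 0: "1 \<le> V ^ (a + b)" using assms by simp
  have 1: "x \<le> V ^ (a + b)" using add_le_power[OF assms] by simp
  have 2: "x * y \<le> V ^ (a + b)" using assms by (simp add: power_add mult_le_mono)
  have 3: "x div y \<le> V ^ (a + b)" "x mod y \<le> V ^ (a + b)" "x div 2 ^ y \<le> V ^ (a + b)"
    using 1 by (meson div_le_dividend mod_less_eq_dividend order_trans)+
  show ?thesis using add_le_power[OF assms] 0 2 3 by (cases f) auto
qed

lemma word_op_nat_op:
  assumes "f \<in> {Plus, Times, Quot, Rem, ShiftR, Less, Equal}" "nat_op f x y < 2 ^ w"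
  shows "word_op w f x y = nat_op f x y"
  using assms by (auto simp: drop_bit_eq_div)

lemma eval_le:
  assumes "bounded V D s" "wf_expr V D e" "V \<ge> 2"
  shows "eval e s \<le> V ^ deg e"
  using assms(2)
proof (induction e)
  case (Bin f a b)
  then show ?case using nat_op_le[of _ V _ _] deg_pos assms(3) by auto
next
  case (Mem a)
  have "snd s (eval a s) \<le> V" using assms(1) by (simp add: bounded_def)
  also have "V \<le> V ^ deg a" using deg_pos[of a] assms(3) by (intro self_le_power) auto
  finally show ?case by simp
next
  case (Ite c a b)
  have "V ^ deg a \<le> V ^ deg (Ite c a b)" "V ^ deg b \<le> V ^ deg (Ite c a b)"
    using assms(3) by (auto intro!: power_increasing)
  then show ?case using Ite by (auto intro: order_trans)
qed (use assms in \<open>auto simp: bounded_def\<close>)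

text \<open>The state \<open>s\<close> stays fixed while \<open>R\<close> may differ from it from
  register \<open>D\<close> on: intermediate results live in registers that no well-formed
  expression can name.\<close>

lemma runs_compile_expr:
  assumes "bounded V D s" "V \<ge> 2" "wf_expr V D e" "V ^ deg e < 2 ^ w" "D \<le> d" "\<And>x. x < D \<Longrightarrow> R x = fst s x"
  shows "\<exists>R'. runs w (compile_expr e d) (R, snd s) (expr_cost e) (R', snd s) \<and> R' d = eval e s \<and> (\<forall>x<d. R' x = R x)"
  using assms(3-6)
proof (induction e arbitrary: d R)
  case (Lit n)
  then show ?case using runs_Const[of w d n R "snd s"] by (intro exI[of _ "R(d := n)"]) (auto simp: fun_upd_def)
next
  case (Var x)
  have "fst s x < 2 ^ w" using eval_le[OF assms(1) Var(1) assms(2)] Var(2) by simp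
  moreover have "R x = fst s x" using Var by simp
  ultimately show ?case using runs_Op[of w BitAnd d x x R "snd s"] by (intro exI[of _ "R(d := fst s x)"]) (auto simp: fun_upd_def)
next
  case (Bin f a b)
  have d: "V ^ deg a < 2 ^ w" "V ^ deg b < 2 ^ w"
    by (auto intro!: power_less_le[OF _ Bin.prems(2) assms(2)])
  obtain R1 where R1: "runs w (compile_expr a d) (R, snd s) (expr_cost a) (R1, snd s)" "R1 d = eval a s" "\<forall>x<d. R1 x = R x"
    using Bin.IH(1)[of d R] Bin.prems d by auto
  obtain R2 where R2: "runs w (compile_expr b (d + 1)) (R1, snd s) (expr_cost b) (R2, snd s)" "R2 (d + 1) = eval b s"
    "\<forall>x<d + 1. R2 x = R1 x"
    using Bin.IH(2)[of "d + 1" R1] Bin.prems d R1 by auto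
  have "eval (Bin f a b) s < 2 ^ w" using eval_le[OF assms(1) Bin.prems(1) assms(2)] Bin.prems(2) by linarith
  then have "word_op w f (R2 d) (R2 (d + 1)) = eval (Bin f a b) s"
    using word_op_nat_op[of f "eval a s" "eval b s" w] Bin.prems(1) R1 R2 by simp
  then have "runs w (Op f d d (d + 1)) (R2, snd s) 1 (R2(d := eval (Bin f a b) s), snd s)"
    using runs_Op[of w f d d "d + 1" R2 "snd s"] by simp
  from runs_Seq[OF R1(1) runs_Seq[OF R2(1) this]] show ?case using R1 R2
    by (intro exI[of _ "R2(d := eval (Bin f a b) s)"]) (auto simp: add.assoc fun_upd_def)
next
  case (Mem a)
  obtain R1 where R1: "runs w (compile_expr a d) (R, snd s) (expr_cost a) (R1, snd s)" "R1 d = eval a s" "\<forall>x<d. R1 x = R x"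
    using Mem.IH[of d R] Mem.prems by auto
  from runs_Seq[OF R1(1) runs_Load[of w d d R1 "snd s"]] show ?case using R1
    by (intro exI[of _ "R1(d := snd s (R1 d))"]) (auto simp: fun_upd_def)
next
  case (Ite c a b)
  have d: "V ^ deg a < 2 ^ w" "V ^ deg b < 2 ^ w" "V ^ deg c < 2 ^ w"
    by (auto intro!: power_less_le[OF _ Ite.prems(2) assms(2)])
  obtain R1 where R1: "runs w (compile_expr c d) (R, snd s) (expr_cost c) (R1, snd s)" "R1 d = eval c s" "\<forall>x<d. R1 x = R x"
    using Ite.IH(1)[of d R] Ite.prems d by auto
  show ?case
  proof (cases "eval c s = 0")
    case True
    obtain R2 where R2: "runs w (compile_expr b d) (R1, snd s) (expr_cost b) (R2, snd s)" "R2 d = eval b s" "\<forall>x<d. R2 x = R1 x"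
      using Ite.IH(3)[of d R1] Ite.prems d R1 by auto
    have "runs w (Cond d (compile_expr a d) (compile_expr b d)) (R1, snd s) (Suc (expr_cost b)) (R2, snd s)"
      using R1 R2 True by (intro runs_CondFalse) auto
    from runs_Seq[OF R1(1) this] show ?thesis using R1 R2 True
      by (intro exI[of _ R2]) (auto elim!: runs_mono)
  next
    case False
    obtain R2 where R2: "runs w (compile_expr a d) (R1, snd s) (expr_cost a) (R2, snd s)" "R2 d = eval a s" "\<forall>x<d. R2 x = R1 x"
      using Ite.IH(2)[of d R1] Ite.prems d R1 by auto
    have "runs w (Cond d (compile_expr a d) (compile_expr b d)) (R1, snd s) (Suc (expr_cost a)) (R2, snd s)"
      using R1 R2 False by (intro runs_CondTrue) auto
    from runs_Seq[OF R1(1) this] show ?thesis using R1 R2 False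
      by (intro exI[of _ R2]) (auto elim!: runs_mono)
  qed
qed

text \<open>
  Programs over unbounded numbers, whose meaning is a total function. They are compiled under the
  proviso \<open>safe V\<close> that all stored values are at most \<open>V\<close>; then no value of an expression \<open>e\<close> exceeds
  \<open>V ^ deg e\<close>, and words that hold this number behave like natural numbers.
\<close>

datatype hcom = Assign nat expr | Put expr expr | Then hcom hcom (infixr \<open>;;\<close> 60) | For nat nat hcom

definition incr :: "nat \<Rightarrow> state \<Rightarrow> state" where
  "incr x s = ((fst s)(x := fst s x + 1), snd s)"

fun sem :: "hcom \<Rightarrow> state \<Rightarrow> state" where
  "sem (Assign x e) s = ((fst s)(x := eval e s), snd s)"
| "sem (Put a e) s = (fst s, (snd s)(eval a s := eval e s))"
| "sem (p ;; q) s = sem q (sem p s)"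
| "sem (For x y p) s = ((\<lambda>s. incr x (sem p s)) ^^ fst s y) ((fst s)(x := 0), snd s)"

definition iter :: "nat \<Rightarrow> hcom \<Rightarrow> state \<Rightarrow> nat \<Rightarrow> state" where
  "iter x p s i = ((\<lambda>s. incr x (sem p s)) ^^ i) ((fst s)(x := 0), snd s)"

lemma iter_0: "iter x p s 0 = ((fst s)(x := 0), snd s)"
  by (simp add: iter_def)

lemma iter_Suc: "iter x p s (Suc i) = incr x (sem p (iter x p s i))"
  by (simp add: iter_def)

lemma sem_For: "sem (For x y p) s = iter x p s (fst s y)"
  by (simp add: iter_def)

declare sem.simps(4) [simp del]
declare sem_For [simp]

fun cost :: "hcom \<Rightarrow> state \<Rightarrow> nat" where
  "cost (Assign x e) s = expr_cost e + 1"
| "cost (Put a e) s = expr_cost a + expr_cost e + 1"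
| "cost (p ;; q) s = cost p s + cost q (sem p s)"
| "cost (For x y p) s = 3 + (\<Sum>i<fst s y. cost p (iter x p s i) + 4)"

text \<open>The address of \<open>Put\<close> may exceed \<open>V\<close>: it is not stored, and the
  bound on its degree makes it fit into a word.\<close>

fun safe :: "nat \<Rightarrow> hcom \<Rightarrow> state \<Rightarrow> bool" where
  "safe V (Assign x e) s = (eval e s \<le> V)"
| "safe V (Put a e) s = (eval e s \<le> V)"
| "safe V (p ;; q) s = (safe V p s \<and> safe V q (sem p s))"
| "safe V (For x y p) s = (\<forall>i<fst s y. safe V p (iter x p s i))"

fun writes :: "hcom \<Rightarrow> nat set" where
  "writes (Assign x e) = {x}"
| "writes (Put a e) = {}"
| "writes (p ;; q) = writes p \<union> writes q"
| "writes (For x y p) = insert x (writes p)"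

text \<open>A loop body must not write the counter or the bound, so that the compiled
  \<open>While\<close> makes exactly the number of rounds that \<open>sem\<close> fixes in
  advance.\<close>

fun wf_hcom :: "nat \<Rightarrow> nat \<Rightarrow> nat \<Rightarrow> hcom \<Rightarrow> bool" where
  "wf_hcom V D K (Assign x e) = (x < D \<and> wf_expr V D e \<and> deg e \<le> K)"
| "wf_hcom V D K (Put a e) = (wf_expr V D a \<and> deg a \<le> K \<and> wf_expr V D e \<and> deg e \<le> K)"
| "wf_hcom V D K (p ;; q) = (wf_hcom V D K p \<and> wf_hcom V D K q)"
| "wf_hcom V D K (For x y p) = (x < D \<and> y < D \<and> x \<noteq> y \<and> x \<notin> writes p \<and> y \<notin> writes p \<and> wf_hcom V D K p)"

text \<open>Register \<open>D\<close> holds the outcome of the loop test. The body may overwrite it,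
  as the test is repeated at the end of each round. That makes four extra steps per round, counting
  the test of \<open>While\<close>.\<close>

fun compile :: "nat \<Rightarrow> hcom \<Rightarrow> com" where
  "compile D (Assign x e) = Seq (compile_expr e D) (Op BitAnd x D D)"
| "compile D (Put a e) = Seq (compile_expr a D) (Seq (compile_expr e (D + 1)) (Store D (D + 1)))"
| "compile D (p ;; q) = Seq (compile D p) (compile D q)"
| "compile D (For x y p) = Seq (Const x 0) (Seq (Op Less D x y) (While D
     (Seq (compile D p) (Seq (Const D 1) (Seq (Op Plus x x D) (Op Less D x y))))))"

lemma sem_not_writes: "x \<notin> writes p \<Longrightarrow> fst (sem p s) x = fst s x"
proof (induction p arbitrary: s)
  case (For z y p)
  have "fst (iter z p s i) x = fst s x" for i
    using For by (induction i) (auto simp: incr_def iter_0 iter_Suc)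
  then show ?case by simp
qed auto

lemma iter_counter: "x \<notin> writes p \<Longrightarrow> fst (iter x p s i) x = i"
  by (induction i) (auto simp: incr_def sem_not_writes iter_0 iter_Suc)

lemma iter_not_writes: "y \<notin> writes p \<Longrightarrow> y \<noteq> x \<Longrightarrow> fst (iter x p s i) y = fst s y"
  by (induction i) (auto simp: incr_def sem_not_writes iter_0 iter_Suc)

lemma runs_compile:
  assumes "V \<ge> 2" "V ^ K < 2 ^ w" "K \<ge> 1"
    and "wf_hcom V D K p" "bounded V D s" "safe V p s" "\<And>x. x < D \<Longrightarrow> R x = fst s x"
  shows "\<exists>R'. runs w (compile D p) (R, snd s) (cost p s) (R', snd (sem p s)) \<and>
    (\<forall>x<D. R' x = fst (sem p s) x) \<and> bounded V D (sem p s)"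
  using assms(4-7)
proof (induction p arbitrary: s R)
  case (Assign x e)
  have Vd: "V ^ deg e < 2 ^ w" using Assign.prems(1)
    by (auto intro!: power_less_le[OF _ assms(2,1)])
  obtain R1 where R1: "runs w (compile_expr e D) (R, snd s) (expr_cost e) (R1, snd s)" "R1 D = eval e s" "\<forall>x<D. R1 x = R x"
    using runs_compile_expr[OF Assign.prems(2) assms(1) _ Vd order_refl, of R] Assign.prems by auto
  have "eval e s < 2 ^ w" using eval_le[OF Assign.prems(2) _ assms(1), of e] Assign.prems(1) Vd by auto
  then have "runs w (Op BitAnd x D D) (R1, snd s) 1 (R1(x := eval e s), snd s)"
    using runs_Op[of w BitAnd x D D R1 "snd s"] R1(2) by simp
  from runs_Seq[OF R1(1) this] show ?case using R1 Assign.prems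
    by (intro exI[of _ "R1(x := eval e s)"]) (auto simp: bounded_def fun_upd_def)
next
  case (Put a e)
  have Vd: "V ^ deg a < 2 ^ w" "V ^ deg e < 2 ^ w" using Put.prems(1)
    by (auto intro!: power_less_le[OF _ assms(2,1)])
  obtain R1 where R1: "runs w (compile_expr a D) (R, snd s) (expr_cost a) (R1, snd s)" "R1 D = eval a s" "\<forall>x<D. R1 x = R x"
    using runs_compile_expr[OF Put.prems(2) assms(1) _ Vd(1) order_refl, of R] Put.prems by auto
  obtain R2 where R2: "runs w (compile_expr e (D + 1)) (R1, snd s) (expr_cost e) (R2, snd s)" "R2 (D + 1) = eval e s"
    "\<forall>x<D + 1. R2 x = R1 x"
    using runs_compile_expr[OF Put.prems(2) assms(1) _ Vd(2), of "D + 1" R1] Put.prems R1 by auto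
  have "runs w (Store D (D + 1)) (R2, snd s) 1 (R2, (snd s)(eval a s := eval e s))"
    using runs_Store[of w D "D + 1" R2 "snd s"] R1 R2 by simp
  from runs_Seq[OF R1(1) runs_Seq[OF R2(1) this]] show ?case using R1 R2 Put.prems
    by (intro exI[of _ R2]) (auto simp: bounded_def add.assoc fun_upd_def)
next
  case (Then p q)
  obtain R1 where R1: "runs w (compile D p) (R, snd s) (cost p s) (R1, snd (sem p s))"
    "\<forall>x<D. R1 x = fst (sem p s) x" "bounded V D (sem p s)"
    using Then.IH(1)[of s R] Then.prems by auto
  obtain R2 where R2: "runs w (compile D q) (R1, snd (sem p s)) (cost q (sem p s)) (R2, snd (sem q (sem p s)))"
    "\<forall>x<D. R2 x = fst (sem q (sem p s)) x" "bounded V D (sem q (sem p s))"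
    using Then.IH(2)[of "sem p s" R1] Then.prems R1 by auto
  show ?case using runs_Seq[OF R1(1) R2(1)] R2 by auto
next
  case (For x y p)
  define n where "n = fst s y"
  let ?s = "iter x p s"
  have wf: "x < D" "y < D" "x \<noteq> y" "x \<notin> writes p" "y \<notin> writes p" "wf_hcom V D K p" using For.prems(1) by auto
  have nV: "n \<le> V" using For.prems(2) wf unfolding bounded_def n_def by auto
  have VK: "V < 2 ^ w" using self_le_power[of V K] assms(1-3) by linarith
  then have w2: "2 < (2::nat) ^ w" using assms(1) by linarith
  then have w0: "0 < w" by (cases w) auto
  have wl: "word_op w Less a b = of_bool (a < b)" for a b using w0 by auto
  have cnt: "fst (?s i) x = i" "fst (?s i) y = n" for i
    using iter_counter[of x p s i] iter_not_writes[of y p x s i] wf unfolding n_def by auto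
  have safe: "safe V p (?s i)" if "i < n" for i using For.prems(3) that unfolding n_def by simp
  let ?body = "Seq (compile D p) (Seq (Const D 1) (Seq (Op Plus x x D) (Op Less D x y)))"
  \<comment> \<open>Backward induction on the round number: each step puts one round in front of the
    remaining loop. The leading 1 is the final failing test.\<close>
  have loop: "\<exists>R'. runs w (While D ?body) (R, snd (?s i)) (1 + (\<Sum>j=i..<n. cost p (?s j) + 4)) (R', snd (?s n)) \<and>
      (\<forall>z<D. R' z = fst (?s n) z) \<and> bounded V D (?s n)"
    if "i \<le> n" "bounded V D (?s i)" "\<And>z. z < D \<Longrightarrow> R z = fst (?s i) z" "R D = of_bool (i < n)" for i R
    using that
  proof (induction i arbitrary: R rule: inc_induct)
    case base
    then show ?case using runs_WhileFalse[of "(R, snd (?s n))" D w ?body] by auto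
  next
    case (step i)
    have in_n: "i < n" by fact
    obtain R1 where R1: "runs w (compile D p) (R, snd (?s i)) (cost p (?s i)) (R1, snd (sem p (?s i)))"
      "\<forall>z<D. R1 z = fst (sem p (?s i)) z" "bounded V D (sem p (?s i))"
      using For.IH[OF wf(6) step.prems(1) safe[OF in_n], of R] step.prems(2) by blast
    have R1xy: "R1 x = i" "R1 y = n" using R1(2) wf cnt sem_not_writes by auto
    let ?M = "snd (sem p (?s i))"
    have s': "?s (Suc i) = incr x (sem p (?s i))" by (rule iter_Suc)
    have a: "runs w (Const D 1) (R1, ?M) 1 (R1(D := 1), ?M)"
      using runs_Const[of w D 1 R1 ?M] w0 by simp
    have b: "runs w (Op Plus x x D) (R1(D := 1), ?M) 1 (R1(D := 1, x := i + 1), ?M)"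
      using runs_Op[of w Plus x x D "R1(D := 1)" ?M] R1xy wf in_n nV VK by simp
    let ?R2 = "R1(D := 1, x := i + 1, D := of_bool (i + 1 < n))"
    have c: "runs w (Op Less D x y) (R1(D := 1, x := i + 1), ?M) 1 (?R2, ?M)"
      using runs_Op[of w Less D x y "R1(D := 1, x := i + 1)" ?M] R1xy wf by (simp add: wl del: word_op.simps of_bool_eq)
    have body: "runs w ?body (R, snd (?s i)) (cost p (?s i) + (1 + (1 + 1))) (?R2, snd (?s (Suc i)))"
      using runs_Seq[OF R1(1) runs_Seq[OF a runs_Seq[OF b c]]] unfolding s' by (simp add: incr_def)
    have s'x: "fst (sem p (?s i)) x = i" using sem_not_writes[OF wf(4)] cnt by simp
    have agree: "?R2 z = fst (?s (Suc i)) z" if "z < D" for z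
      using R1(2) that s'x unfolding s' incr_def by auto
    have bnd: "bounded V D (?s (Suc i))"
      using R1(3) s'x in_n nV unfolding s' incr_def bounded_def by auto
    have RD: "?R2 D = of_bool (Suc i < n)" by simp
    obtain R' where R': "runs w (While D ?body) (?R2, snd (?s (Suc i))) (1 + (\<Sum>j=Suc i..<n. cost p (?s j) + 4)) (R', snd (?s n))"
      "\<forall>z<D. R' z = fst (?s n) z" "bounded V D (?s n)"
      using step.IH[OF bnd agree RD] by blast
    have "fst (R, snd (?s i)) D \<noteq> 0" using step.prems(3) in_n by simp
    from runs_WhileTrue[OF this body R'(1)] have
      "runs w (While D ?body) (R, snd (?s i)) (1 + (\<Sum>j=i..<n. cost p (?s j) + 4)) (R', snd (?s n))"
      using in_n by (elim runs_mono) (simp add: sum.atLeast_Suc_lessThan)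
    then show ?case using R' by blast
  qed
  have a: "runs w (Const x 0) (R, snd s) 1 (R(x := 0), snd s)" using runs_Const[of w x 0 R "snd s"] by simp
  let ?R = "R(x := 0, D := of_bool (0 < n))"
  have b: "runs w (Op Less D x y) (R(x := 0), snd s) 1 (?R, snd s)"
    using runs_Op[of w Less D x y "R(x := 0)" "snd s"] wf For.prems(4) by (simp add: wl n_def del: word_op.simps)
  have s0: "?s 0 = ((fst s)(x := 0), snd s)" by (rule iter_0)
  have bnd: "bounded V D (?s 0)" using For.prems(2) unfolding s0 bounded_def by auto
  have agree: "?R z = fst (?s 0) z" if "z < D" for z using that For.prems(4) unfolding s0 by auto
  have RD: "?R D = of_bool (0 < n)" by simp
  obtain R' where R': "runs w (While D ?body) (?R, snd (?s 0)) (1 + (\<Sum>j=0..<n. cost p (?s j) + 4)) (R', snd (?s n))"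
      "\<forall>z<D. R' z = fst (?s n) z" "bounded V D (?s n)"
    using loop[OF le0 bnd agree RD] by blast
  have "runs w (compile D (For x y p)) (R, snd s) (1 + (1 + (1 + (\<Sum>j=0..<n. cost p (?s j) + 4)))) (R', snd (?s n))"
    using runs_Seq[OF a runs_Seq[OF b]] R'(1) unfolding s0 by simp
  then have "runs w (compile D (For x y p)) (R, snd s) (cost (For x y p) s) (R', snd (?s n))"
    by (elim runs_mono) (simp add: n_def lessThan_atLeast0)
  then show ?case using R'(2,3) unfolding sem_For n_def by blast
qed

lemma iter_assign:
  assumes "z \<noteq> x" "fst s z = g 0"
    and "\<And>j. j < n \<Longrightarrow> eval e ((fst s)(x := j, z := g j), snd s) = g (Suc j)" and "i \<le> n"
  shows "iter x (Assign z e) s i = ((fst s)(x := i, z := g i), snd s)"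
  using assms(4)
proof (induction i)
  case 0
  then show ?case using assms(1,2) by (auto simp: iter_0)
next
  case (Suc i)
  have 1: "eval e ((fst s)(x := i, z := g i), snd s) = g (Suc i)" using Suc.prems by (intro assms(3)) simp
  show ?case unfolding iter_Suc Suc.IH[OF Suc_leD[OF Suc.prems]] sem.simps 1
    using assms(1) by (auto simp: incr_def fun_upd_twist)
qed

text \<open>Every inner loop of the program repeats a single assignment, so a closed form
  \<open>g\<close> for its accumulator gives meaning, cost and safety at once.\<close>

lemma for_assign:
  assumes "z \<noteq> x" "fst s z = g 0" "fst s y = n"
    and "\<And>j. j < n \<Longrightarrow> eval e ((fst s)(x := j, z := g j), snd s) = g (Suc j)"
  shows "sem (For x y (Assign z e)) s = ((fst s)(x := n, z := g n), snd s)"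
    and "cost (For x y (Assign z e)) s = 3 + n * (expr_cost e + 5)"
    and "(\<And>j. j < n \<Longrightarrow> g (Suc j) \<le> V) \<Longrightarrow> safe V (For x y (Assign z e)) s"
  using assms(3,4) iter_assign[where g = g and n = n and e = e, OF assms(1,2)] by auto

section \<open>Simulation of shorter words\<close>

text \<open>Register 0 holds the address where the simulated memory starts, register 1 the modulus \<open>2 ^ w\<close>;
  register 2 is scratch, and the simulated registers start at \<open>K\<close>.\<close>

fun sim :: "nat \<Rightarrow> com \<Rightarrow> com" where
  "sim K (Const r a) = Seq (Const (r + K) a) (Op Rem (r + K) (r + K) 1)"
| "sim K (Op f r x y) = Seq (Op f (r + K) (x + K) (y + K)) (Op Rem (r + K) (r + K) 1)"
| "sim K (Load r x) = Seq (Op Plus 2 (x + K) 0) (Load (r + K) 2)"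
| "sim K (Store x y) = Seq (Op Plus 2 (x + K) 0) (Store 2 (y + K))"
| "sim K (Seq p q) = Seq (sim K p) (sim K q)"
| "sim K (Cond r p q) = Cond (r + K) (sim K p) (sim K q)"
| "sim K (While r p) = While (r + K) (sim K p)"

text \<open>Memories are compared only at addresses below \<open>2 ^ w\<close>, the ones that short
  words can reach; the bounds on the values preserve this.\<close>

definition simulates :: "nat \<Rightarrow> nat \<Rightarrow> nat \<Rightarrow> state \<Rightarrow> state \<Rightarrow> bool" where
  "simulates K w off s s' \<longleftrightarrow> (\<forall>r. fst s' (r + K) = fst s r \<and> fst s r < 2 ^ w) \<and>
     fst s' 0 = off \<and> fst s' 1 = 2 ^ w \<and> (\<forall>a<2 ^ w. snd s' (off + a) = snd s a \<and> snd s a < 2 ^ w)"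

lemma mod_mod_power2: "w \<le> W \<Longrightarrow> (x::nat) mod 2 ^ W mod 2 ^ w = x mod 2 ^ w"
  by (simp add: le_imp_power_dvd mod_mod_cancel)

lemma word_op_less: "word_op w f x y < 2 ^ w"
  by (cases f) (auto simp: nat_less_iff)

text \<open>Each operation reduces a number that does not depend on the word length, and
  \<open>2 ^ w\<close> divides \<open>2 ^ W\<close>. Subtraction is separate because it passes
  through the integers.\<close>

lemma word_op_mod: "w \<le> W \<Longrightarrow> word_op W f x y mod 2 ^ w = word_op w f x y"
proof (cases "f = Minus")
  case True
  assume "w \<le> W"
  have "nat ((int x - int y) mod 2 ^ W) mod 2 ^ w = nat ((int x - int y) mod 2 ^ W mod 2 ^ w)"
    by (simp add: nat_mod_distrib nat_power_eq)
  also have "\<dots> = nat ((int x - int y) mod 2 ^ w)"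
    using \<open>w \<le> W\<close> by (simp add: le_imp_power_dvd mod_mod_cancel)
  finally show ?thesis using True by simp
next
  case False
  assume "w \<le> W"
  then show ?thesis using False by (cases f) (simp_all add: mod_mod_power2)
qed

lemma sim_reg_update:
  assumes "simulates K w off s (R', M')" "v < 2 ^ w" "K \<ge> 3" "\<And>x. x \<noteq> 2 \<Longrightarrow> R'' x = (R'(r + K := v)) x"
  shows "simulates K w off ((fst s)(r := v), snd s) (R'', M')"
  using assms unfolding simulates_def by auto

text \<open>Each step becomes at most two, whence the factor 2. With \<open>w < W\<close> the
  modulus \<open>2 ^ w\<close> itself fits into a long word, and the bound on \<open>off\<close>
  keeps shifted addresses from wrapping.\<close>

lemma runs_sim:
  assumes "exec w p s t u" "simulates K w off s s'" "w < W" "off + 2 ^ w < 2 ^ W" "K \<ge> 3"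
  shows "\<exists>u'. runs W (sim K p) s' (2 * t) u' \<and> simulates K w off u u'"
  using assms(1,2)
proof (induction arbitrary: s' rule: exec.induct)
  case (Const r a R M)
  obtain R' M' where s': "s' = (R', M')" by (cases s')
  have 1: "R' 1 = 2 ^ w" using Const s' by (simp add: simulates_def)
  have m: "a mod 2 ^ W mod 2 ^ w = a mod 2 ^ w" using mod_mod_power2 assms(3) by simp
  let ?R = "R'(r + K := a mod 2 ^ W, r + K := a mod 2 ^ w)"
  have "runs W (Op Rem (r + K) (r + K) 1) (R'(r + K := a mod 2 ^ W), M') 1 (?R, M')"
    using runs_Op[of W Rem "r + K" "r + K" 1 "R'(r + K := a mod 2 ^ W)" M'] 1 m assms(3,5)
    by (simp add: less_trans[OF mod_less_divisor power_strict_increasing])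
  from runs_Seq[OF runs_Const this] have "runs W (sim K (Const r a)) s' 2 (?R, M')" by (simp add: s' numeral_2_eq_2)
  moreover have "simulates K w off (R(r := a mod 2 ^ w), M) (?R, M')"
    using sim_reg_update[of K w off "(R, M)" R' M' "a mod 2 ^ w" ?R r] Const s' assms(5) by simp
  ultimately show ?case by auto
next
  case (Op f r x y R M)
  obtain R' M' where s': "s' = (R', M')" by (cases s')
  have 1: "R' 1 = 2 ^ w" "R' (x + K) = R x" "R' (y + K) = R y" using Op s' by (auto simp: simulates_def)
  let ?v = "word_op w f (R x) (R y)"
  have m: "word_op W f (R x) (R y) mod 2 ^ w = ?v" using word_op_mod assms(3) by simp
  let ?R1 = "R'(r + K := word_op W f (R x) (R y))"
  let ?R = "?R1(r + K := ?v)"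
  have "?v < 2 ^ W" using word_op_less[of w f] assms(3) by (meson less_trans one_less_numeral_iff power_strict_increasing semiring_norm(76))
  then have "runs W (Op Rem (r + K) (r + K) 1) (?R1, M') 1 (?R, M')"
    using runs_Op[of W Rem "r + K" "r + K" 1 ?R1 M'] 1 m assms(5) by simp
  moreover have "runs W (Op f (r + K) (x + K) (y + K)) s' 1 (?R1, M')"
    using runs_Op[of W f "r + K" "x + K" "y + K" R' M'] 1 by (simp add: s')
  ultimately have "runs W (sim K (Op f r x y)) s' 2 (?R, M')"
    using runs_Seq[of W "Op f (r + K) (x + K) (y + K)" s' 1] by (fastforce simp: numeral_2_eq_2)
  moreover have "simulates K w off (R(r := ?v), M) (?R, M')"
    using sim_reg_update[of K w off "(R, M)" R' M' ?v ?R r] Op s' assms(5) word_op_less by simp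
  ultimately show ?case by auto
next
  case (Load r x R M)
  obtain R' M' where s': "s' = (R', M')" by (cases s')
  have 1: "R' 0 = off" "R' (x + K) = R x" "R x < 2 ^ w" using Load s' by (auto simp: simulates_def)
  then have M: "M' (off + R x) = M (R x)" "M (R x) < 2 ^ w" using Load s' by (auto simp: simulates_def)
  let ?R1 = "R'(2 := off + R x)"
  have "runs W (Op Plus 2 (x + K) 0) s' 1 (?R1, M')"
    using runs_Op[of W Plus 2 "x + K" 0 R' M'] 1 assms(4) by (simp add: s' add.commute)
  from runs_Seq[OF this runs_Load[of W "r + K" 2 ?R1 M']]
  have "runs W (sim K (Load r x)) s' 2 (?R1(r + K := M (R x)), M')" using M by (simp add: numeral_2_eq_2)
  moreover have "simulates K w off (R(r := M (R x)), M) (?R1(r + K := M (R x)), M')"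
    using sim_reg_update[of K w off "(R, M)" R' M' "M (R x)" "?R1(r + K := M (R x))" r] Load s' assms(5) M by simp
  ultimately show ?case by auto
next
  case (Store x y R M)
  obtain R' M' where s': "s' = (R', M')" by (cases s')
  have 1: "R' 0 = off" "R' (x + K) = R x" "R x < 2 ^ w" "R' (y + K) = R y" using Store s' by (auto simp: simulates_def)
  let ?R1 = "R'(2 := off + R x)"
  have "runs W (Op Plus 2 (x + K) 0) s' 1 (?R1, M')"
    using runs_Op[of W Plus 2 "x + K" 0 R' M'] 1 assms(4) by (simp add: s' add.commute)
  from runs_Seq[OF this runs_Store[of W 2 "y + K" ?R1 M']]
  have "runs W (sim K (Store x y)) s' 2 (?R1, M'(off + R x := R y))" using 1 assms(5) by (simp add: numeral_2_eq_2)
  moreover have "simulates K w off (R, M(R x := R y)) (?R1, M'(off + R x := R y))"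
    using Store s' assms(5) unfolding simulates_def by auto
  ultimately show ?case by auto
next
  case (Seq p s t u q t' v)
  obtain u' where u': "runs W (sim K p) s' (2 * t) u'" "simulates K w off u u'" using Seq by blast
  then obtain v' where v': "runs W (sim K q) u' (2 * t') v'" "simulates K w off v v'" using Seq by blast
  then show ?case using runs_Seq[OF u'(1) v'(1)] unfolding sim.simps distrib_left by blast
next
  case (CondTrue s r p t u q)
  then obtain u' where u': "runs W (sim K p) s' (2 * t) u'" "simulates K w off u u'" by blast
  have "fst s' (r + K) \<noteq> 0" using CondTrue unfolding simulates_def by simp
  from runs_CondTrue[OF this u'(1), of "sim K q"] have "runs W (sim K (Cond r p q)) s' (2 * Suc t) u'"
    by (auto elim!: runs_mono)
  then show ?case using u'(2) by blast
next
  case (CondFalse s r q t u p)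
  then obtain u' where u': "runs W (sim K q) s' (2 * t) u'" "simulates K w off u u'" by blast
  have "fst s' (r + K) = 0" using CondFalse unfolding simulates_def by simp
  from runs_CondFalse[OF this u'(1), of "sim K p"] have "runs W (sim K (Cond r p q)) s' (2 * Suc t) u'"
    by (auto elim!: runs_mono)
  then show ?case using u'(2) by blast
next
  case (WhileFalse s r p)
  have "fst s' (r + K) = 0" using WhileFalse unfolding simulates_def by simp
  from runs_WhileFalse[OF this, of W "sim K p"] have "runs W (sim K (While r p)) s' (2 * 1) s'"
    by (auto elim!: runs_mono)
  then show ?case using WhileFalse.prems by blast
next
  case (WhileTrue s r p t u t' v)
  obtain u' where u': "runs W (sim K p) s' (2 * t) u'" "simulates K w off u u'" using WhileTrue by blast
  then obtain v' where v': "runs W (sim K (While r p)) u' (2 * t') v'" "simulates K w off v v'" using WhileTrue by blast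
  have "fst s' (r + K) \<noteq> 0" using WhileTrue unfolding simulates_def by simp
  from runs_WhileTrue[OF this u'(1), of "2 * t'" v'] v'(1)
  have "runs W (sim K (While r p)) s' (2 * Suc (t + t')) v'" by (auto elim!: runs_mono)
  then show ?case using v'(2) by blast
qed

section \<open>Writing down the graph\<close>

definition clause_pos :: "cnf \<Rightarrow> nat \<Rightarrow> nat" where
  "clause_pos F c = 2 + (\<Sum>i<c. length (snd F ! i) + 1)"

lemma length_concat_encode_clause:
  "length (concat (map encode_clause cls)) = (\<Sum>i<length cls. length (cls ! i) + 1)"
  by (simp add: length_concat encode_clause_def comp_def sum_list_sum_nth atLeast0LessThan)

lemma length_encode_cnf: "length (encode_cnf F) = clause_pos F (length (snd F))"
  unfolding encode_cnf_def clause_pos_def by (simp add: length_concat_encode_clause)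

lemma encode_cnf_split:
  assumes "c < length (snd F)"
  shows "\<exists>pre post. encode_cnf F = pre @ encode_clause (snd F ! c) @ post \<and> length pre = clause_pos F c"
proof -
  let ?cls = "snd F"
  let ?pre = "fst F # length ?cls # concat (map encode_clause (take c ?cls))"
  let ?post = "concat (map encode_clause (drop (Suc c) ?cls))"
  have "encode_cnf F = fst F # length ?cls #
      concat (map encode_clause (take c ?cls @ ?cls ! c # drop (Suc c) ?cls))"
    unfolding encode_cnf_def using id_take_nth_drop[OF assms] by simp
  then have "encode_cnf F = ?pre @ encode_clause (?cls ! c) @ ?post" by simp
  moreover have "length ?pre = clause_pos F c"
    using assms length_concat_encode_clause[of "take c ?cls"] unfolding clause_pos_def by simp
  ultimately show ?thesis by blast
qed

lemma encode_cnf_length: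
  assumes "c < length (snd F)"
  shows "encode_cnf F ! clause_pos F c = length (snd F ! c)"
proof -
  obtain pre post where "encode_cnf F = pre @ encode_clause (snd F ! c) @ post" "length pre = clause_pos F c"
    using encode_cnf_split[OF assms] by blast
  then show ?thesis by (metis append_Cons encode_clause_def nth_append_length)
qed

lemma encode_cnf_literal:
  assumes "c < length (snd F)" "t < length (snd F ! c)"
  shows "encode_cnf F ! (clause_pos F c + 1 + t) = (case snd F ! c ! t of (x, v) \<Rightarrow> 2 * x + of_bool v)"
proof -
  obtain pre post where *: "encode_cnf F = pre @ encode_clause (snd F ! c) @ post" "length pre = clause_pos F c"
    using encode_cnf_split[OF assms(1)] by blast
  show ?thesis unfolding *(1) *(2)[symmetric] using assms(2)
    by (simp add: nth_append encode_clause_def)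
qed

lemma clause_pos_mono: "c \<le> c' \<Longrightarrow> clause_pos F c \<le> clause_pos F c'"
  unfolding clause_pos_def by (intro add_left_mono sum_mono2) auto

lemma clause_pos_Suc: "clause_pos F (Suc c) = clause_pos F c + length (snd F ! c) + 1"
  unfolding clause_pos_def by simp

lemma clause_pos_ge: "2 \<le> clause_pos F c"
  unfolding clause_pos_def by simp

lemma encode_edges_nth:
  assumes "e < length es"
  shows "concat (map (\<lambda>(u, v). [u, v]) es) ! (2 * e) = fst (es ! e)"
    and "concat (map (\<lambda>(u, v). [u, v]) es) ! (2 * e + 1) = snd (es ! e)"
  using assms
proof (induction es arbitrary: e)
  case (Cons x es)
  { case 1 then show ?case using Cons(1)[of "e - 1"] by (cases e; cases x) auto }
  { case 2 then show ?case using Cons(2)[of "e - 1"] by (cases e; cases x) auto }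
qed auto

lemma length_encode_edges: "length (concat (map (\<lambda>(u, v). [u, v]) es)) = 2 * length es"
  by (induction es) auto

abbreviation plus_expr (infixl \<open>\<oplus>\<close> 65) where "a \<oplus> b \<equiv> Bin Plus a b"
abbreviation times_expr (infixl \<open>\<otimes>\<close> 70) where "a \<otimes> b \<equiv> Bin Times a b"
abbreviation quot_expr (infixl \<open>\<oslash>\<close> 70) where "a \<oslash> b \<equiv> Bin Quot a b"
abbreviation rem_expr (infixl \<open>\<odot>\<close> 70) where "a \<odot> b \<equiv> Bin Rem a b"

text \<open>
  Registers: 0 start of the graph, 1 modulus, 3 number of clauses, 4 block size \<open>B\<close>, 5 \<open>2 ^ B\<close>, 6 \<open>nA\<close>, 7 \<open>nU\<close>,
  8 \<open>nv\<close>, 9 \<open>ne\<close>, 10 inner loop counter, 12 edge \<open>e\<close>, 13 row \<open>a\<close>, 14 column \<open>u\<close>, 15 position on the path, 16 group and 17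
  bits of \<open>a\<close>, 18 \<open>u div k\<close>, 19 clause number, 20 its address, 21 its length, 22 and 23 whether the clauses are
  satisfied, 24 whether \<open>a\<close> and \<open>u\<close> are incident.
\<close>

definition skip_clause :: hcom where
  "skip_clause = Assign 20 (Var 20 \<oplus> Mem (Var 20) \<oplus> Lit 1)"

text \<open>A literal code has its variable as quotient by 2 and its sign as remainder; the product
  of two truth values is their conjunction.\<close>

definition test_literal :: "nat \<Rightarrow> hcom" where
  "test_literal f = (let x = Mem (Var 20 \<oplus> Lit 1 \<oplus> Var 10) in
     Assign f (Ite (Bin Equal (x \<oslash> Lit 2 \<oslash> Var 4) (Var 16) \<otimes>
       Bin Equal (Bin ShiftR (Var 17) (x \<oslash> Lit 2 \<odot> Var 4) \<odot> Lit 2) (x \<odot> Lit 2)) (Lit 1) (Var f)))"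

text \<open>Clauses have varying lengths, so a clause is found by skipping its predecessors. This
  scan is repeated for every edge, but costs only a factor polynomial in \<open>N\<close>.\<close>

definition test_clause :: "expr \<Rightarrow> nat \<Rightarrow> hcom" where
  "test_clause c f = Assign 19 c ;; Assign 20 (Lit 2) ;; For 10 19 skip_clause ;;
     Assign 21 (Mem (Var 20)) ;; Assign f (Lit 0) ;; For 10 21 (test_literal f)"

definition hub_expr :: expr where "hub_expr = Var 6 \<oplus> Lit 2 \<otimes> Var 7"

definition inner_expr :: "nat \<Rightarrow> expr \<Rightarrow> expr \<Rightarrow> expr" where
  "inner_expr l a s = hub_expr \<oplus> (a \<otimes> Var 7 \<oplus> Var 14) \<otimes> Lit (2 * l - 1) \<oplus> s"

text \<open>Reducing modulo register 1 imitates \<open>initial_state\<close> of the simulated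
  machine, which truncates its input to \<open>w\<close> bits. The offsets 2 and 3 skip the header
  of the graph. A disjunction computed as a sum may be 2, so register 24 is only tested against
  0.\<close>

definition edge_code :: "nat \<Rightarrow> nat \<Rightarrow> hcom" where
  "edge_code k l =
     Assign 13 (Var 12 \<oslash> (Lit (2 * l) \<otimes> Var 7)) ;;
     Assign 14 (Var 12 \<oslash> Lit (2 * l) \<odot> Var 7) ;;
     Assign 15 (Var 12 \<odot> Lit (2 * l)) ;;
     Assign 16 (Var 13 \<oslash> Var 5) ;;
     Assign 17 (Var 13 \<odot> Var 5) ;;
     Assign 18 (Var 14 \<oslash> Lit k) ;;
     test_clause (Var 18 \<oslash> Var 3) 22 ;;
     test_clause (Var 18 \<odot> Var 3) 23 ;;
     Assign 24 (Ite (Bin Equal (Var 18) (Var 3 \<otimes> Var 3))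
       (Bin Equal (Var 16) (Var 14 \<odot> Lit k))
       (Ite (Bin Equal (Var 16) (Var 14 \<odot> Lit k)) (Var 22 \<otimes> Var 23) (Var 22 \<oplus> Var 23))) ;;
     Put (Var 0 \<oplus> Lit 2 \<oplus> Lit 2 \<otimes> Var 12)
       (Ite (Var 15) (inner_expr l (Var 13) (Var 15))
         (Ite (Bin Less (Var 13) (Var 6)) (Var 13) (Var 6 \<oplus> Var 14)) \<odot> Var 1) ;;
     Put (Var 0 \<oplus> Lit 3 \<oplus> Lit 2 \<otimes> Var 12)
       (Ite (Bin Equal (Var 15 \<oplus> Lit 1) (Lit (2 * l)))
         (Ite (Bin Less (Var 13) (Var 6))
           (Ite (Var 24) (inner_expr l (Var 6) (Lit l)) hub_expr)
           (Var 6 \<oplus> Var 7 \<oplus> Var 14))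
         (inner_expr l (Var 13) (Var 15 \<oplus> Lit 1)) \<odot> Var 1)"

text \<open>No instruction computes logarithms, so \<open>2 ^ w\<close> is accumulated: each
  \<open>j\<close> with \<open>nv div 2 ^ j \<noteq> 0\<close> contributes a factor
  \<open>2 ^ c\<close>. The \<open>nv\<close> rounds are enough to pass all binary digits of
  \<open>nv\<close> and cheap compared with writing the graph.\<close>

definition setup_code :: "nat \<Rightarrow> nat \<Rightarrow> nat \<Rightarrow> hcom" where
  "setup_code k l c =
     Assign 3 (Mem (Lit 1)) ;;
     Assign 4 (Mem (Lit 0) \<oslash> Lit k \<oplus> Lit 1) ;;
     Assign 5 (Lit 1) ;;
     For 10 4 (Assign 5 (Lit 2 \<otimes> Var 5)) ;;
     Assign 6 (Lit k \<otimes> Var 5) ;;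
     Assign 7 (Lit k \<otimes> (Var 3 \<otimes> Var 3 \<oplus> Lit 1)) ;;
     Assign 8 (hub_expr \<oplus> Lit 1 \<oplus> (Var 6 \<oplus> Lit 1) \<otimes> Var 7 \<otimes> Lit (2 * l - 1)) ;;
     Assign 9 (Lit (2 * l) \<otimes> Var 7 \<otimes> (Var 6 \<oplus> Lit 1)) ;;
     Assign 20 (Lit 2) ;;
     For 10 3 skip_clause ;;
     Assign 0 (Var 20 \<oplus> Lit 1) ;;
     Assign 1 (Lit 1) ;;
     For 10 8 (Assign 1 (Ite (Bin ShiftR (Var 8) (Var 10)) (Lit (2 ^ c) \<otimes> Var 1) (Var 1))) ;;
     Put (Var 0) (Var 8 \<odot> Var 1) ;;
     Put (Var 0 \<oplus> Lit 1) (Var 9 \<odot> Var 1)"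

definition build_code :: "nat \<Rightarrow> nat \<Rightarrow> nat \<Rightarrow> hcom" where
  "build_code k l c = setup_code k l c ;; For 12 9 (edge_code k l)"

text \<open>The graph starts one cell after the end of the formula: the cell in between is \<open>0\<close>, so that the
  clause number \<open>M\<close>, which occurs as \<open>v div M\<close> for \<open>v = M * M\<close>, reads as an empty clause.\<close>

definition input_mem :: "cnf \<Rightarrow> (nat \<Rightarrow> nat) \<Rightarrow> bool" where
  "input_mem F M \<longleftrightarrow> (\<forall>i<length (encode_cnf F). M i = encode_cnf F ! i) \<and> M (length (encode_cnf F)) = 0"

lemma input_mem_length:
  "input_mem F M \<Longrightarrow> c < length (snd F) \<Longrightarrow> M (clause_pos F c) = length (snd F ! c)"
  using encode_cnf_length[of c F] clause_pos_mono[of "Suc c" "length (snd F)" F]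
  by (auto simp: input_mem_def length_encode_cnf clause_pos_Suc)

lemma input_mem_length_at:
  assumes "input_mem F M" "c \<le> length (snd F)" shows "M (clause_pos F c) = length (clause_at F c)"
proof (cases "c < length (snd F)")
  case True then show ?thesis using input_mem_length[OF assms(1)] by (simp add: clause_at_def)
next
  case False
  then have "c = length (snd F)" using assms(2) by simp
  then show ?thesis using assms(1) by (simp add: input_mem_def length_encode_cnf clause_at_def)
qed

lemma input_mem_literal:
  "input_mem F M \<Longrightarrow> t < length (clause_at F c) \<Longrightarrow>
    M (clause_pos F c + 1 + t) = (case clause_at F c ! t of (x, v) \<Rightarrow> 2 * x + of_bool v)"
  using encode_cnf_literal[of c F t] clause_pos_mono[of "Suc c" "length (snd F)" F]
  by (auto simp: input_mem_def length_encode_cnf clause_pos_Suc clause_at_def split: if_splits)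

lemma skip_clauses:
  assumes "input_mem F (snd s)" "fst s 20 = 2" "fst s y = c" "c \<le> length (snd F)" "y \<noteq> 20"
    and "length (encode_cnf F) \<le> V"
  shows "sem (For 10 y skip_clause) s = ((fst s)(10 := c, 20 := clause_pos F c), snd s)"
    and "cost (For 10 y skip_clause) s = 3 + c * 11"
    and "safe V (For 10 y skip_clause) s"
proof -
  let ?e = "Var 20 \<oplus> Mem (Var 20) \<oplus> Lit 1"
  have step: "eval ?e ((fst s)(10 := j, 20 := clause_pos F j), snd s) = clause_pos F (Suc j)" if "j < c" for j
    using input_mem_length[OF assms(1), of j] that assms(4) by (simp add: clause_pos_Suc)
  have 0: "fst s 20 = clause_pos F 0" using assms(2) by (simp add: clause_pos_def)
  have ne: "(20::nat) \<noteq> 10" by simp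
  note fa = for_assign[where g = "clause_pos F" and n = c and y = y, OF ne 0 assms(3) step]
  show "sem (For 10 y skip_clause) s = ((fst s)(10 := c, 20 := clause_pos F c), snd s)"
    unfolding skip_clause_def by (rule fa(1))
  show "cost (For 10 y skip_clause) s = 3 + c * 11"
    unfolding skip_clause_def by (rule trans[OF fa(2)]) simp_all
  show "safe V (For 10 y skip_clause) s" unfolding skip_clause_def
  proof (rule fa(3))
    fix j assume "j < c"
    then have "clause_pos F (Suc j) \<le> clause_pos F (length (snd F))"
      using assms(4) by (intro clause_pos_mono) simp
    then show "clause_pos F (Suc j) \<le> V" using assms(6) by (simp add: length_encode_cnf)
  qed
qed

lemma div_2_literal: "(2 * x + of_bool v) div 2 = (x::nat)" "(2 * x + of_bool v) mod 2 = (of_bool v :: nat)"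
  by auto

lemma test_literals:
  assumes "input_mem F (snd s)" "fst s 20 = clause_pos F c" "fst s f = 0" "fst s 21 = length (clause_at F c)"
    and "fst s 4 = B" "fst s 16 = i" "fst s 17 = b" "f > 21" "V \<ge> 1"
  shows "sem (For 10 21 (test_literal f)) s =
      ((fst s)(10 := length (clause_at F c), f := of_bool (clause_sat B i b (clause_at F c))), snd s)"
    and "cost (For 10 21 (test_literal f)) s \<le> 3 + length (clause_at F c) * 60"
    and "safe V (For 10 21 (test_literal f)) s"
proof -
  let ?cl = "clause_at F c" and ?n = "length (clause_at F c)"
  \<comment> \<open>Loop invariant: whether one of the first \<open>j\<close> literals
    holds.\<close>
  define g where "g j = (of_bool (clause_sat B i b (take j ?cl)) :: nat)" for j
  obtain e where e: "test_literal f = Assign f e" by (simp add: test_literal_def Let_def)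
  have ec: "expr_cost e \<le> 55" using e by (auto simp: test_literal_def Let_def)
  have step: "eval e ((fst s)(10 := j, f := g j), snd s) = g (Suc j)" if j: "j < ?n" for j
  proof -
    obtain x v where xv: "?cl ! j = (x, v)" by (cases "?cl ! j")
    have M: "snd s (clause_pos F c + 1 + j) = 2 * x + of_bool v"
      using input_mem_literal[OF assms(1) j] xv by simp
    have "g (Suc j) = (if x div B = i \<and> odd (b div 2 ^ (x mod B)) = v then 1 else g j)"
      using j xv unfolding g_def clause_sat_def by (auto simp: take_Suc_conv_app_nth)
    moreover have "(b div 2 ^ (x mod B)) mod 2 = of_bool v \<longleftrightarrow> odd (b div 2 ^ (x mod B)) = v"
      by (cases v) (auto simp: odd_iff_mod_2_eq_one even_iff_mod_2_eq_zero)
    moreover have "eval e ((fst s)(10 := j, f := g j), snd s) =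
      (if x div B = i \<and> (b div 2 ^ (x mod B)) mod 2 = of_bool v then 1 else g j)"
      using e assms(2,5-8) M by (auto simp: test_literal_def Let_def div_2_literal simp del: of_bool_eq)
    ultimately show ?thesis by simp
  qed
  have 0: "fst s f = g 0" using assms(3) by (simp add: g_def clause_sat_def)
  have ne: "f \<noteq> 10" using assms(8) by simp
  note fa = for_assign[where g = g and n = ?n and y = 21, OF ne 0 assms(4) step]
  show "sem (For 10 21 (test_literal f)) s =
      ((fst s)(10 := ?n, f := of_bool (clause_sat B i b ?cl)), snd s)"
    unfolding e by (rule trans[OF fa(1)]) (simp_all add: g_def)
  show "cost (For 10 21 (test_literal f)) s \<le> 3 + ?n * 60"
    unfolding e by (rule order_trans[OF eq_refl[OF fa(2)]]) (use ec in simp_all)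
  show "safe V (For 10 21 (test_literal f)) s" unfolding e
    using assms(9) by (intro fa(3)) (simp_all add: g_def)
qed

lemma clause_at_bounds:
  assumes "c \<le> length (snd F)"
  shows "clause_pos F c \<le> length (encode_cnf F)" "length (clause_at F c) \<le> length (encode_cnf F)"
proof -
  show "clause_pos F c \<le> length (encode_cnf F)"
    unfolding length_encode_cnf using assms by (intro clause_pos_mono)
  show "length (clause_at F c) \<le> length (encode_cnf F)"
    using clause_pos_mono[of "Suc c" "length (snd F)" F]
    by (auto simp: clause_at_def length_encode_cnf clause_pos_Suc)
qed

lemma test_clause:
  assumes "input_mem F (snd s)" "eval e s = c" "c \<le> length (snd F)"
    and "fst s 4 = B" "fst s 16 = i" "fst s 17 = b" "f > 21" "V \<ge> 2" "length (encode_cnf F) \<le> V"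
    and "length (snd F) \<le> length (encode_cnf F)"
  shows "\<exists>R. sem (test_clause e f) s = (R, snd s) \<and> R f = of_bool (clause_sat B i b (clause_at F c)) \<and>
      (\<forall>x. x \<noteq> 10 \<longrightarrow> x \<noteq> 19 \<longrightarrow> x \<noteq> 20 \<longrightarrow> x \<noteq> 21 \<longrightarrow> x \<noteq> f \<longrightarrow> R x = fst s x)"
    and "cost (test_clause e f) s \<le> expr_cost e + 90 * length (encode_cnf F) + 90"
    and "safe V (test_clause e f) s"
proof -
  let ?s1 = "((fst s)(19 := c, 20 := 2), snd s)"
  let ?s2 = "((fst s)(19 := c, 20 := 2, 10 := c, 20 := clause_pos F c), snd s)"
  let ?n = "length (clause_at F c)"
  let ?s3 = "((fst s)(19 := c, 20 := 2, 10 := c, 20 := clause_pos F c, 21 := ?n, f := 0), snd s)"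
  let ?s4 = "((fst s)(19 := c, 20 := 2, 10 := c, 20 := clause_pos F c, 21 := ?n, f := 0,
    10 := ?n, f := of_bool (clause_sat B i b (clause_at F c))), snd s)"
  have 0: "sem (Assign 20 (Lit 2)) (sem (Assign 19 e) s) = ?s1" using assms(2) by simp
  have 1: "sem (For 10 19 skip_clause) ?s1 = ?s2"
    "cost (For 10 19 skip_clause) ?s1 = 3 + c * 11" "safe V (For 10 19 skip_clause) ?s1"
    using skip_clauses[of F ?s1 19 c V] assms by auto
  have 2: "sem (Assign f (Lit 0)) (sem (Assign 21 (Mem (Var 20))) ?s2) = ?s3"
    using input_mem_length_at[OF assms(1,3)] by simp
  have 3: "sem (For 10 21 (test_literal f)) ?s3 = ?s4"
    "cost (For 10 21 (test_literal f)) ?s3 \<le> 3 + ?n * 60" "safe V (For 10 21 (test_literal f)) ?s3"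
    using test_literals[of F ?s3 c f B i b V] assms by auto
  have "sem (test_clause e f) s = ?s4" unfolding test_clause_def sem.simps(3) 0 1(1) 2 3(1) ..
  then show "\<exists>R. sem (test_clause e f) s = (R, snd s) \<and> R f = of_bool (clause_sat B i b (clause_at F c)) \<and>
      (\<forall>x. x \<noteq> 10 \<longrightarrow> x \<noteq> 19 \<longrightarrow> x \<noteq> 20 \<longrightarrow> x \<noteq> 21 \<longrightarrow> x \<noteq> f \<longrightarrow> R x = fst s x)" by simp
  have "cost (test_clause e f) s = expr_cost e + 1 + 2 + (3 + c * 11) + 3 + 2 + cost (For 10 21 (test_literal f)) ?s3"
    unfolding test_clause_def cost.simps(3) sem.simps(3) 0 1(1,2) 2 by (simp only: cost.simps expr_cost.simps)
  then obtain X where "cost (test_clause e f) s = expr_cost e + 1 + 2 + (3 + c * 11) + 3 + 2 + X" "X \<le> 3 + ?n * 60"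
    using 3(2) by blast
  then show "cost (test_clause e f) s \<le> expr_cost e + 90 * length (encode_cnf F) + 90"
    using clause_at_bounds(2)[OF assms(3)] order_trans[OF assms(3,10)] by linarith
  have "safe V (test_clause e f) s \<longleftrightarrow> c \<le> V \<and> 2 \<le> V \<and> ?n \<le> V"
    unfolding test_clause_def safe.simps(3) 0 1(1) 2 using 1(3) 3(3) assms(2) input_mem_length_at[OF assms(1,3)] by simp
  then show "safe V (test_clause e f) s" using assms clause_at_bounds[OF assms(3)] by linarith
qed

section \<open>Correctness and cost of the program\<close>

locale sat_reduction =
  fixes k l c q V :: nat and F :: cnf
  assumes k: "k \<ge> 2" and l: "l \<ge> 1" and F: "is_qcnf q F"
begin

abbreviation "len \<equiv> length (encode_cnf F)"
abbreviation "nM \<equiv> length (snd F)"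
abbreviation "B \<equiv> block k F"
abbreviation "nA \<equiv> num_left k F"
abbreviation "nU \<equiv> num_right k F"

sublocale incidence_graph l nA nU "incident k F"
  using incidence_graph_incident[OF k l] .

definition w :: nat where "w = c * floorlog 2 nv"

definition env :: "state \<Rightarrow> bool" where
  "env s \<longleftrightarrow> fst s 0 = len + 1 \<and> fst s 1 = 2 ^ w \<and> fst s 3 = nM \<and> fst s 4 = B \<and>
     fst s 5 = 2 ^ B \<and> fst s 6 = nA \<and> fst s 7 = nU"

text \<open>The bound on \<open>len\<close> is strict because register 0 stores the address
  \<open>len + 1\<close> of the graph.\<close>

definition bounds :: bool where
  "bounds \<longleftrightarrow> nv \<le> V \<and> ne \<le> V \<and> len < V \<and> 2 ^ w \<le> V \<and> 2 \<le> V"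

lemma nM_le_len: "nM \<le> len"
proof -
  have "(\<Sum>i<nM. 1) \<le> (\<Sum>i<nM. length (snd F ! i) + 1)" by (intro sum_mono) simp
  then show ?thesis unfolding length_encode_cnf clause_pos_def by simp
qed

text \<open>The index \<open>nM\<close> does occur, for the vertices with
  \<open>u div k = nM * nM\<close>; hence the bounds are not strict.\<close>

lemma test_index:
  assumes "u < nU"
  shows "u div k div nM \<le> nM" "u div k mod nM \<le> nM"
proof -
  have "u div k < nM * nM + 1"
    using assms unfolding num_right_def by (intro less_mult_imp_div_less) (simp add: mult.commute)
  then have v: "u div k \<le> nM * nM" by simp
  show "u div k div nM \<le> nM"
    using div_le_mono[OF v, of nM] by (cases "nM = 0") auto
  show "u div k mod nM \<le> nM"
    using v by (cases "nM = 0") (auto intro: less_imp_le)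
qed

lemma edge_code:
  assumes env: "env s" and e: "fst s 12 = e" "e < ne" and mem: "input_mem F (snd s)" and bounds: bounds
  shows "\<exists>R. sem (edge_code k l) s =
      (R, (snd s)(len + 3 + 2 * e := fst (edge e) mod 2 ^ w, len + 4 + 2 * e := snd (edge e) mod 2 ^ w))"
    and "cost (edge_code k l) s \<le> 180 * len + 400"
    and "safe V (edge_code k l) s"
proof -
  define a where "a = e div (2 * l * nU)"
  define u where "u = (e div (2 * l)) mod nU"
  define j where "j = e mod (2 * l)"
  define i where "i = a div 2 ^ B"
  define b where "b = a mod 2 ^ B"
  define v where "v = u div k"
  have a: "a \<le> nA" "u < nU" "j < 2 * l"
    using edge_index_bounds[OF e(2)] unfolding a_def u_def j_def by auto
  have ed: "edge e = (vtx a u j, vtx a u (j + 1))" unfolding edge_def a_def u_def j_def Let_def ..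
  let ?p = "Assign 13 (Var 12 \<oslash> (Lit (2 * l) \<otimes> Var 7)) ;;
     Assign 14 (Var 12 \<oslash> Lit (2 * l) \<odot> Var 7) ;;
     Assign 15 (Var 12 \<odot> Lit (2 * l)) ;;
     Assign 16 (Var 13 \<oslash> Var 5) ;;
     Assign 17 (Var 13 \<odot> Var 5) ;;
     Assign 18 (Var 14 \<oslash> Lit k)"
  let ?R0 = "(fst s)(13 := a, 14 := u, 15 := j, 16 := i, 17 := b, 18 := v)"
  have V: "e \<le> V" "2 \<le> V" "len \<le> V" "nv \<le> V" "2 ^ w \<le> V" using bounds e unfolding bounds_def by auto
  have s0: "sem (Assign 18 (Var 14 \<oslash> Lit k)) (sem (Assign 17 (Var 13 \<odot> Var 5)) (sem (Assign 16 (Var 13 \<oslash> Var 5))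
     (sem (Assign 15 (Var 12 \<odot> Lit (2 * l))) (sem (Assign 14 (Var 12 \<oslash> Lit (2 * l) \<odot> Var 7))
     (sem (Assign 13 (Var 12 \<oslash> (Lit (2 * l) \<otimes> Var 7))) s))))) = (?R0, snd s)"
    using env e unfolding env_def by (simp add: a_def u_def j_def i_def b_def v_def)
  let ?t1 = "test_clause (Var 18 \<oslash> Var 3) 22" and ?t2 = "test_clause (Var 18 \<odot> Var 3) 23"
  let ?f1 = "clause_sat B i b (clause_at F (v div nM))" and ?f2 = "clause_sat B i b (clause_at F (v mod nM))"
  have R0: "?R0 4 = B" "?R0 16 = i" "?R0 17 = b" "eval (Var 18 \<oslash> Var 3) (?R0, snd s) = v div nM"
    using env unfolding env_def by auto
  note T1 = test_clause[of F "(?R0, snd s)" "Var 18 \<oslash> Var 3" "v div nM" B i b 22 V, unfolded fst_conv snd_conv,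
      OF mem R0(4) test_index(1)[OF a(2), folded v_def] R0(1-3) _ V(2,3) nM_le_len]
  obtain R1 where R1: "sem ?t1 (?R0, snd s) = (R1, snd s)" "R1 22 = of_bool ?f1"
    "\<forall>x. x \<noteq> 10 \<longrightarrow> x \<noteq> 19 \<longrightarrow> x \<noteq> 20 \<longrightarrow> x \<noteq> 21 \<longrightarrow> x \<noteq> 22 \<longrightarrow> R1 x = ?R0 x"
    using T1(1) by auto
  have R1v: "R1 4 = B" "R1 16 = i" "R1 17 = b" "eval (Var 18 \<odot> Var 3) (R1, snd s) = v mod nM"
    using env R1(3) unfolding env_def by auto
  note T2 = test_clause[of F "(R1, snd s)" "Var 18 \<odot> Var 3" "v mod nM" B i b 23 V, unfolded fst_conv snd_conv,
      OF mem R1v(4) test_index(2)[OF a(2), folded v_def] R1v(1-3) _ V(2,3) nM_le_len]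
  obtain R2 where R2: "sem ?t2 (R1, snd s) = (R2, snd s)" "R2 23 = of_bool ?f2"
    "\<forall>x. x \<noteq> 10 \<longrightarrow> x \<noteq> 19 \<longrightarrow> x \<noteq> 20 \<longrightarrow> x \<noteq> 21 \<longrightarrow> x \<noteq> 23 \<longrightarrow> R2 x = R1 x"
    using T2(1) by auto
  have R2v: "R2 0 = len + 1" "R2 1 = 2 ^ w" "R2 3 = nM" "R2 6 = nA" "R2 7 = nU" "R2 12 = e"
    "R2 13 = a" "R2 14 = u" "R2 15 = j" "R2 16 = i" "R2 18 = v" "R2 22 = of_bool ?f1"
    using env e R1(2,3) R2(3) unfolding env_def by auto
  let ?ge = "Ite (Bin Equal (Var 18) (Var 3 \<otimes> Var 3))
       (Bin Equal (Var 16) (Var 14 \<odot> Lit k))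
       (Ite (Bin Equal (Var 16) (Var 14 \<odot> Lit k)) (Var 22 \<otimes> Var 23) (Var 22 \<oplus> Var 23))"
  define g where "g = eval ?ge (R2, snd s)"
  have g: "g \<noteq> 0 \<longleftrightarrow> incident k F a u" "g \<le> 2"
    unfolding g_def using R2v R2(2) by (auto simp: incident_def Let_def i_def b_def v_def)
  let ?R3 = "R2(24 := g)"
  have s3: "sem (Assign 24 ?ge) (R2, snd s) = (?R3, snd s)" unfolding g_def by simp
  let ?e1 = "Ite (Var 15) (inner_expr l (Var 13) (Var 15))
         (Ite (Bin Less (Var 13) (Var 6)) (Var 13) (Var 6 \<oplus> Var 14)) \<odot> Var 1"
  let ?e2 = "Ite (Bin Equal (Var 15 \<oplus> Lit 1) (Lit (2 * l)))
         (Ite (Bin Less (Var 13) (Var 6))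
           (Ite (Var 24) (inner_expr l (Var 6) (Lit l)) hub_expr)
           (Var 6 \<oplus> Var 7 \<oplus> Var 14))
         (inner_expr l (Var 13) (Var 15 \<oplus> Lit 1)) \<odot> Var 1"
  have e1: "eval ?e1 (?R3, M) = vtx a u j mod 2 ^ w" for M
    using R2v a by (auto simp: inner_expr_def hub_expr_def vtx_def inner_def hub_def)
  have e2: "eval ?e2 (?R3, M) = vtx a u (j + 1) mod 2 ^ w" for M
    using R2v a g(1) l by (auto simp: inner_expr_def hub_expr_def vtx_def inner_def hub_def)
  let ?M1 = "(snd s)(len + 3 + 2 * e := vtx a u j mod 2 ^ w)"
  let ?M2 = "?M1(len + 4 + 2 * e := vtx a u (j + 1) mod 2 ^ w)"
  let ?a1 = "Var 0 \<oplus> Lit 2 \<oplus> Lit 2 \<otimes> Var 12" and ?a2 = "Var 0 \<oplus> Lit 3 \<oplus> Lit 2 \<otimes> Var 12"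
  have A: "eval ?a1 (?R3, M) = len + 3 + 2 * e" "eval ?a2 (?R3, M) = len + 4 + 2 * e" for M
    using R2v by auto
  have s4: "sem (Put ?a1 ?e1) (?R3, snd s) = (?R3, ?M1)"
    unfolding sem.simps(2) fst_conv snd_conv A e1 ..
  have s5: "sem (Put ?a2 ?e2) (?R3, ?M1) = (?R3, ?M2)"
    unfolding sem.simps(2) fst_conv snd_conv A e2 ..
  have "sem (edge_code k l) s = (?R3, ?M2)"
    unfolding edge_code_def sem.simps(3) s0 R1(1) R2(1) s3 s4 s5 ..
  then show "\<exists>R. sem (edge_code k l) s =
      (R, (snd s)(len + 3 + 2 * e := fst (edge e) mod 2 ^ w, len + 4 + 2 * e := snd (edge e) mod 2 ^ w))"
    unfolding ed by simp
  obtain c1 c2 where c12: "c1 = cost ?t1 (?R0, snd s)" "c2 = cost ?t2 (R1, snd s)" by blast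
  have cc: "c1 \<le> 3 + 90 * len + 90" "c2 \<le> 3 + 90 * len + 90" using T1(2) T2(2) unfolding c12 by auto
  have "cost (edge_code k l) s \<le> 200 + c1 + c2"
    unfolding edge_code_def cost.simps(3) s0 R1(1) R2(1) s3 s4 s5 c12
    by (simp add: inner_expr_def hub_expr_def)
  then show "cost (edge_code k l) s \<le> 180 * len + 400" using cc by linarith
  have sv: "a \<le> V" "u \<le> V" "j \<le> V" "i \<le> V" "b \<le> V" "v \<le> V"
    using V(1) unfolding a_def u_def j_def i_def b_def v_def
    by (meson div_le_dividend mod_less_eq_dividend order_trans)+
  have "(0::nat) < 2 ^ w" by simp
  then have "x mod 2 ^ w \<le> V" for x :: nat using V(5) by (meson less_imp_le mod_less_divisor order_trans)
  then have sf: "safe V (Put ?a1 ?e1) (?R3, snd s)" "safe V (Put ?a2 ?e2) (?R3, ?M1)" "safe V (Assign 24 ?ge) (R2, snd s)"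
    unfolding safe.simps(1,2) e1 e2 g_def[symmetric] using g(2) V(2) by auto
  have sp: "safe V ?p s" using env e sv unfolding env_def by (simp add: a_def u_def j_def i_def b_def v_def)
  show "safe V (edge_code k l) s"
    using sp sf T1(3) T2(3) unfolding edge_code_def safe.simps(3) s0 R1(1) R2(1) s3 s4 s5 by simp
qed

lemma floorlog_shift: "nv div 2 ^ j \<noteq> 0 \<longleftrightarrow> j < floorlog 2 nv"
proof -
  have "floorlog 2 nv \<le> j \<longleftrightarrow> nv < 2 ^ j"
    using floorlog_le_iff[of 2 nv j] by simp
  then have "j < floorlog 2 nv \<longleftrightarrow> 2 ^ j \<le> nv" by linarith
  moreover have "nv div 2 ^ j \<noteq> 0 \<longleftrightarrow> 2 ^ j \<le> nv" unfolding div_eq_0_iff by (auto simp: not_less)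
  ultimately show ?thesis by blast
qed

lemma floorlog_le_nv: "floorlog 2 nv \<le> nv"
  using floorlog_le_iff[of 2 nv nv] less_exp[of nv] by simp

lemma two_power_B_le: "2 ^ B \<le> nA" "nA \<le> nv" "nU \<le> nv" "nv \<le> ne + 1"
proof -
  have "1 * 2 ^ B \<le> nA" unfolding num_left_def using k by (intro mult_le_mono1) simp
  then show "2 ^ B \<le> nA" by simp
  show "nA \<le> nv" "nU \<le> nv" by (simp_all add: nv_def hub_def)
  have "fst gr \<le> num_edges gr + 1" using is_graph_gr unfolding is_graph_def by blast
  then show "nv \<le> ne + 1" by (simp add: gr_def num_edges_def)
qed

lemma setup_code:
  assumes mem: "input_mem F (snd s)" and bounds: bounds
  shows "\<exists>R. sem (setup_code k l c) s =
      (R, (snd s)(len + 1 := nv mod 2 ^ w, len + 2 := ne mod 2 ^ w)) \<and> R 9 = ne \<and>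
      (\<forall>M. env (R, M))"
    and "cost (setup_code k l c) s \<le> 100 + 11 * B + 11 * nM + 16 * nv"
    and "safe V (setup_code k l c) s"
proof -
  have V: "2 \<le> V" "len < V" "nv \<le> V" "2 ^ w \<le> V" "ne \<le> V" using bounds unfolding bounds_def by auto
  have len2: "2 \<le> len" using clause_pos_ge[of F nM] by (simp add: length_encode_cnf)
  have M01: "snd s 0 = fst F" "snd s (Suc 0) = nM"
    using mem len2 unfolding input_mem_def by (auto simp: encode_cnf_def)
  let ?R1 = "(fst s)(3 := nM, 4 := B, 5 := 1)"
  let ?p1 = "sem (Assign 5 (Lit 1)) (sem (Assign 4 (Mem (Lit 0) \<oslash> Lit k \<oplus> Lit 1)) (sem (Assign 3 (Mem (Lit 1))) s))"
  have s1: "?p1 = (?R1, snd s)" using M01 by (simp add: block_def)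
  let ?l2 = "For 10 4 (Assign 5 (Lit 2 \<otimes> Var 5))"
  let ?R2 = "?R1(10 := B, 5 := 2 ^ B)"
  have "(5::nat) \<noteq> 10" "fst (?R1, snd s) 5 = 2 ^ 0" "fst (?R1, snd s) 4 = B" by auto
  note L2 = for_assign[where g = "\<lambda>j. 2 ^ j" and n = B and y = 4 and e = "Lit 2 \<otimes> Var 5", OF this]
  have s2: "sem ?l2 (?R1, snd s) = (?R2, snd s)" "cost ?l2 (?R1, snd s) = 3 + B * 8"
    using L2(1,2) by auto
  have f2: "safe V ?l2 (?R1, snd s)"
  proof (rule L2(3))
    fix j assume "j < B"
    then have "(2::nat) ^ Suc j \<le> 2 ^ B" by (intro power_increasing) auto
    then show "2 ^ Suc j \<le> V" using two_power_B_le V by linarith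
  qed simp
  let ?p3 = "sem (Assign 20 (Lit 2)) (sem (Assign 9 (Lit (2 * l) \<otimes> Var 7 \<otimes> (Var 6 \<oplus> Lit 1)))
     (sem (Assign 8 (hub_expr \<oplus> Lit 1 \<oplus> (Var 6 \<oplus> Lit 1) \<otimes> Var 7 \<otimes> Lit (2 * l - 1)))
     (sem (Assign 7 (Lit k \<otimes> (Var 3 \<otimes> Var 3 \<oplus> Lit 1))) (sem (Assign 6 (Lit k \<otimes> Var 5)) (?R2, snd s)))))"
  let ?R3 = "?R2(6 := nA, 7 := nU, 8 := nv, 9 := ne, 20 := 2)"
  have e6: "eval (Lit k \<otimes> Var 5) (?R2, snd s) = nA" by (simp add: num_left_def)
  have e7: "eval (Lit k \<otimes> (Var 3 \<otimes> Var 3 \<oplus> Lit 1)) (?R2(6 := nA), snd s) = nU" by (simp add: num_right_def)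
  have e8: "eval (hub_expr \<oplus> Lit 1 \<oplus> (Var 6 \<oplus> Lit 1) \<otimes> Var 7 \<otimes> Lit (2 * l - 1)) (?R2(6 := nA, 7 := nU), snd s) = nv"
    by (simp add: nv_def hub_def hub_expr_def)
  have e9: "eval (Lit (2 * l) \<otimes> Var 7 \<otimes> (Var 6 \<oplus> Lit 1)) (?R2(6 := nA, 7 := nU, 8 := nv), snd s) = ne"
    by (simp add: ne_def)
  have s3: "?p3 = (?R3, snd s)"
    unfolding sem.simps(1) fst_conv snd_conv e6 e7 e8 e9 by simp
  let ?R4 = "?R3(10 := nM, 20 := clause_pos F nM)"
  have s4: "sem (For 10 3 skip_clause) (?R3, snd s) = (?R4, snd s)" "cost (For 10 3 skip_clause) (?R3, snd s) = 3 + nM * 11"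
    "safe V (For 10 3 skip_clause) (?R3, snd s)"
    using skip_clauses[of F "(?R3, snd s)" 3 nM V] mem V by auto
  let ?R5 = "?R4(0 := len + 1, 1 := 1)"
  have s5: "sem (Assign 1 (Lit 1)) (sem (Assign 0 (Var 20 \<oplus> Lit 1)) (?R4, snd s)) = (?R5, snd s)"
    by (simp add: length_encode_cnf)
  let ?e = "Ite (Bin ShiftR (Var 8) (Var 10)) (Lit (2 ^ c) \<otimes> Var 1) (Var 1)"
  let ?l6 = "For 10 8 (Assign 1 ?e)"
  \<comment> \<open>The minimum freezes the product after \<open>floorlog 2 nv\<close> rounds, from
    which on the test fails.\<close>
  define g where "g j = (2::nat) ^ (c * min j (floorlog 2 nv))" for j
  have g: "g nv = 2 ^ w" using floorlog_le_nv by (simp add: g_def w_def min_def)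
  let ?R6 = "?R5(10 := nv, 1 := 2 ^ w)"
  have "(1::nat) \<noteq> 10" "fst (?R5, snd s) 1 = g 0" "fst (?R5, snd s) 8 = nv" by (auto simp: g_def)
  note L6 = for_assign[where g = g and n = nv and y = 8 and e = ?e, OF this]
  have step: "eval ?e ((fst (?R5, snd s))(10 := j, 1 := g j), snd (?R5, snd s)) = g (Suc j)" for j
    using floorlog_shift[of j] by (auto simp: g_def min_def power_add[symmetric] not_less)
  have s6: "sem ?l6 (?R5, snd s) = (?R6, snd s)" "cost ?l6 (?R5, snd s) = 3 + nv * 13"
    using L6(1,2)[OF step] g by auto
  have f6: "safe V ?l6 (?R5, snd s)"
  proof (rule L6(3)[OF step])
    fix j
    have "g (Suc j) \<le> 2 ^ w" unfolding g_def w_def by (intro power_increasing) auto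
    then show "g (Suc j) \<le> V" using V by linarith
  qed
  let ?M1 = "(snd s)(len + 1 := nv mod 2 ^ w)"
  let ?M2 = "?M1(len + 2 := ne mod 2 ^ w)"
  have s7: "sem (Put (Var 0) (Var 8 \<odot> Var 1)) (?R6, snd s) = (?R6, ?M1)" by simp
  have s8: "sem (Put (Var 0 \<oplus> Lit 1) (Var 9 \<odot> Var 1)) (?R6, ?M1) = (?R6, ?M2)" by simp
  have "sem (setup_code k l c) s = (?R6, ?M2)"
    unfolding setup_code_def sem.simps(3) s1 s2(1) s3 s4(1) s5 s6(1) s7 s8 ..
  moreover have "env (?R6, M)" for M unfolding env_def by simp
  ultimately show "\<exists>R. sem (setup_code k l c) s =
      (R, (snd s)(len + 1 := nv mod 2 ^ w, len + 2 := ne mod 2 ^ w)) \<and> R 9 = ne \<and> (\<forall>M. env (R, M))"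
    by (intro exI[of _ ?R6]) simp
  show "cost (setup_code k l c) s \<le> 100 + 11 * B + 11 * nM + 16 * nv"
    unfolding setup_code_def cost.simps(3) sem.simps(3) s1 s2 s3 s4(1,2) s5 s6 s7 s8
    by (simp add: hub_expr_def)
  have md: "x mod 2 ^ w \<le> V" for x :: nat
  proof -
    have "x mod 2 ^ w < 2 ^ w" by simp
    then show ?thesis using V(4) by linarith
  qed
  have B: "B \<le> V" using less_exp[of B] two_power_B_le V by linarith
  have sv: "nM \<le> V" "nA \<le> V" "nU \<le> V" using nM_le_len two_power_B_le V by linarith+
  have "safe V (Assign 3 (Mem (Lit 1))) s \<and> safe V (Assign 4 (Mem (Lit 0) \<oslash> Lit k \<oplus> Lit 1)) (sem (Assign 3 (Mem (Lit 1))) s)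
    \<and> safe V (Assign 5 (Lit 1)) (sem (Assign 4 (Mem (Lit 0) \<oslash> Lit k \<oplus> Lit 1)) (sem (Assign 3 (Mem (Lit 1))) s))"
    using M01 sv B V by (simp add: block_def)
  moreover have "safe V (Assign 6 (Lit k \<otimes> Var 5) ;; Assign 7 (Lit k \<otimes> (Var 3 \<otimes> Var 3 \<oplus> Lit 1)) ;;
     Assign 8 (hub_expr \<oplus> Lit 1 \<oplus> (Var 6 \<oplus> Lit 1) \<otimes> Var 7 \<otimes> Lit (2 * l - 1)) ;;
     Assign 9 (Lit (2 * l) \<otimes> Var 7 \<otimes> (Var 6 \<oplus> Lit 1)) ;; Assign 20 (Lit 2)) (?R2, snd s)"
    unfolding safe.simps sem.simps(1) fst_conv snd_conv e6 e7 e8 e9 using sv V by simp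
  moreover have "safe V (Assign 0 (Var 20 \<oplus> Lit 1) ;; Assign 1 (Lit 1)) (?R4, snd s)"
    using V by (simp add: length_encode_cnf)
  moreover have "safe V (Put (Var 0) (Var 8 \<odot> Var 1)) (?R6, snd s)" "safe V (Put (Var 0 \<oplus> Lit 1) (Var 9 \<odot> Var 1)) (?R6, ?M1)"
    using md by auto
  ultimately show "safe V (setup_code k l c) s"
    unfolding setup_code_def safe.simps(3) s1 s2(1) s3 s4(1) s5 s6(1) s7 s8 using f2 s4(3) f6 by simp
qed

definition graph_code :: "nat list" where
  "graph_code = encode_graph gr"

lemma graph_code_nth:
  "graph_code ! 0 = nv" "graph_code ! Suc 0 = ne" "length graph_code = 2 * ne + 2"
  "e < ne \<Longrightarrow> graph_code ! (2 * e + 2) = fst (edge e)"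
  "e < ne \<Longrightarrow> graph_code ! (2 * e + 3) = snd (edge e)"
proof -
  let ?es = "map edge [0..<ne]"
  have gc: "graph_code = nv # ne # concat (map (\<lambda>(u, v). [u, v]) ?es)"
    unfolding graph_code_def encode_graph_def gr_def num_edges_def by simp
  then show "graph_code ! 0 = nv" "graph_code ! Suc 0 = ne" by simp_all
  show "length graph_code = 2 * ne + 2" unfolding gc using length_encode_edges[of ?es] by simp
  have 3: "2 * e + 3 = Suc (Suc (2 * e + 1))" by simp
  show "graph_code ! (2 * e + 2) = fst (edge e)" if "e < ne"
    unfolding gc using encode_edges_nth(1)[of e ?es] that by simp
  show "graph_code ! (2 * e + 3) = snd (edge e)" if "e < ne"
    unfolding gc 3 using encode_edges_nth(2)[of e ?es] that by (simp del: add_2_eq_Suc')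
qed

lemma input_mem_cong: "input_mem F M \<Longrightarrow> (\<And>x. x \<le> len \<Longrightarrow> M' x = M x) \<Longrightarrow> input_mem F M'"
  unfolding input_mem_def by auto

lemma build_code:
  assumes mem: "input_mem F (snd s)" "\<And>x. x > len \<Longrightarrow> snd s x = 0" and bounds: bounds
  shows "snd (sem (build_code k l c) s) (len + 1 + x) = snd (initial_state w graph_code) x"
    and "env (sem (build_code k l c) s)"
    and "cost (build_code k l c) s \<le> 1000 * (len + 1) * (ne + 1)"
    and "safe V (build_code k l c) s"
proof -
  let ?s = "sem (setup_code k l c) s" and ?p = "edge_code k l"
  obtain R where R: "?s = (R, (snd s)(len + 1 := nv mod 2 ^ w, len + 2 := ne mod 2 ^ w))"
    "R 9 = ne" "\<And>M. env (R, M)" using setup_code(1)[OF mem(1) bounds] by blast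
  have wr: "12 \<notin> writes ?p" "0 \<notin> writes ?p" "1 \<notin> writes ?p" "3 \<notin> writes ?p" "4 \<notin> writes ?p" "5 \<notin> writes ?p"
    "6 \<notin> writes ?p" "7 \<notin> writes ?p"
    by (auto simp: edge_code_def test_clause_def skip_clause_def test_literal_def Let_def)
  \<comment> \<open>Memory after \<open>i\<close> rounds: the two header cells and the first
    \<open>i\<close> edges have been written.\<close>
  define mm where "mm i x = (if len + 1 \<le> x \<and> x < len + 3 + 2 * i then graph_code ! (x - (len + 1)) mod 2 ^ w else snd s x)" for i x
  have env_i: "env (iter 12 ?p ?s i)" for i
    using R(3)[of undefined] wr unfolding env_def by (simp add: iter_not_writes R(1))
  have cnt: "fst (iter 12 ?p ?s i) 12 = i" for i using iter_counter[OF wr(1)] .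
  have inp: "input_mem F (mm i)" for i
    using mem(1) by (rule input_mem_cong) (simp add: mm_def)
  have mem_i: "snd (iter 12 ?p ?s i) = mm i" if "i \<le> ne" for i
    using that
  proof (induction i)
    case 0
    show ?case
    proof
      fix x
      consider "x = len + 1" | "x = len + 2" | "x \<noteq> len + 1" "x \<noteq> len + 2" by blast
      then show "snd (iter 12 ?p ?s 0) x = mm 0 x"
        by cases (auto simp: iter_0 R(1) mm_def graph_code_nth)
    qed
  next
    case (Suc i)
    then have IH: "snd (iter 12 ?p ?s i) = mm i" and i: "i < ne" by auto
    obtain R' where R': "sem ?p (iter 12 ?p ?s i) =
      (R', (mm i)(len + 3 + 2 * i := fst (edge i) mod 2 ^ w, len + 4 + 2 * i := snd (edge i) mod 2 ^ w))"
      using edge_code(1)[OF env_i cnt i _ bounds, of ] inp[of i] unfolding IH by auto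
    show ?case
    proof
      fix x
      consider "x = len + 3 + 2 * i" | "x = len + 4 + 2 * i" | "x \<noteq> len + 3 + 2 * i" "x \<noteq> len + 4 + 2 * i" by blast
      then show "snd (iter 12 ?p ?s (Suc i)) x = mm (Suc i) x"
      proof cases
        case 1
        then have "x - (len + 1) = 2 * i + 2" by simp
        then show ?thesis using 1 graph_code_nth(4)[OF i] by (simp add: iter_Suc incr_def R' mm_def)
      next
        case 2
        then have "x - (len + 1) = 2 * i + 3" by simp
        moreover have "graph_code ! (3 + 2 * i) = snd (edge i)"
          using graph_code_nth(5)[OF i] by (simp add: add.commute)
        ultimately show ?thesis using 2 by (simp add: iter_Suc incr_def R' mm_def)
      next
        case 3
        then show ?thesis by (auto simp: iter_Suc incr_def R' mm_def)
      qed
    qed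
  qed
  have sem: "sem (build_code k l c) s = iter 12 ?p ?s ne"
    unfolding build_code_def by (simp add: R(1,2))
  show "env (sem (build_code k l c) s)" unfolding sem by (rule env_i)
  show "snd (sem (build_code k l c) s) (len + 1 + x) = snd (initial_state w graph_code) x"
    unfolding sem mem_i[OF order_refl] mm_def initial_state_def using mem(2) by (auto simp: graph_code_nth(3))
  have body: "cost ?p (iter 12 ?p ?s i) \<le> 180 * len + 400" "safe V ?p (iter 12 ?p ?s i)" if i: "i < ne" for i
    using edge_code(2,3)[OF env_i cnt i _ bounds] inp[of i] mem_i[of i] i by auto
  show "safe V (build_code k l c) s"
    using setup_code(3)[OF mem(1) bounds] body(2) unfolding build_code_def by (simp add: R(1,2))
  have "(\<Sum>i<ne. cost ?p (iter 12 ?p ?s i) + 4) \<le> (\<Sum>i<ne. 180 * len + 404)"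
    using body(1) by (intro sum_mono) fastforce
  then have "cost (For 12 9 ?p) ?s \<le> 3 + ne * (180 * len + 404)"
    by (simp add: R(1,2))
  moreover have "B \<le> ne + 1" using two_power_B_le less_exp[of B] by linarith
  then have "11 * B \<le> 11 * (ne + 1)" "16 * nv \<le> 16 * (ne + 1)" "11 * nM \<le> 11 * len"
    using two_power_B_le(4) nM_le_len by auto
  then have "cost (setup_code k l c) s \<le> 100 + 11 * (ne + 1) + 11 * len + 16 * (ne + 1)"
    using setup_code(2)[OF mem(1) bounds] by linarith
  ultimately have "cost (build_code k l c) s \<le> 100 + 11 * (ne + 1) + 11 * len + 16 * (ne + 1) + (3 + ne * (180 * len + 404))"
    unfolding build_code_def cost.simps(3) by linarith
  also have "\<dots> \<le> 1000 * (len + 1) * (ne + 1)" by (simp add: algebra_simps)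
  finally show "cost (build_code k l c) s \<le> 1000 * (len + 1) * (ne + 1)" .
qed

end

text \<open>25 covers the registers 0 to 24, and 200 is a generous bound on all degrees. The lower
  bounds on \<open>V\<close> come from the literals of the program.\<close>

lemma wf_build_code:
  assumes "k \<le> V" "2 * l \<le> V" "2 ^ c \<le> V" "3 \<le> V"
  shows "wf_hcom V 25 200 (build_code k l c)"
  using assms unfolding build_code_def setup_code_def edge_code_def test_clause_def skip_clause_def
    test_literal_def inner_expr_def hub_expr_def Let_def
  by simp

text \<open>Makes the initial memory respect the cap \<open>V\<close>. Codes of literals are below
  \<open>2 * N\<close>, and \<open>N \<le> k * B \<le> nA\<close> while \<open>nv\<close> exceeds
  \<open>2 * nA\<close>.\<close>

lemma (in sat_reduction) encode_cnf_le:
  assumes bounds and "x \<in> set (encode_cnf F)"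
  shows "x \<le> V"
proof -
  have N: "fst F \<le> nA" 
  proof -
    have "fst F \<le> k * B" unfolding block_def using dividend_less_times_div[of k "fst F"] k by simp
    also have "\<dots> \<le> k * 2 ^ B" using less_exp[of B] by (intro mult_le_mono2) simp
    finally show ?thesis by (simp add: num_left_def)
  qed
  have "(nA + 1) * 2 * 1 \<le> (nA + 1) * nU * (2 * l - 1)" using nU l by (intro mult_le_mono) auto
  then have "2 * nA + 2 \<le> (nA + 1) * nU * (2 * l - 1)" by (simp only: add_mult_distrib mult_1 mult_1_right)
  then have nv: "2 * nA + 1 \<le> nv" unfolding nv_def by linarith
  have V: "nv \<le> V" "len < V" using assms(1) unfolding bounds_def by auto
  consider "x = fst F" | "x = nM" | cl where "cl \<in> set (snd F)" "x \<in> set (encode_clause cl)"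
    using assms(2) unfolding encode_cnf_def by auto
  then show ?thesis
  proof cases
    case 1 then show ?thesis using N nv V by linarith
  next
    case 2 then show ?thesis using nM_le_len V by linarith
  next
    case 3
    then obtain i where i: "i < nM" "cl = snd F ! i" by (metis in_set_conv_nth)
    consider "x = length cl" | y b where "(y, b) \<in> set cl" "x = 2 * y + of_bool b"
      using 3 unfolding encode_clause_def by auto
    then show ?thesis
    proof cases
      case 1
      then show ?thesis using clause_at_bounds(2)[of i F] i V by (simp add: clause_at_def)
    next
      case (2 y b)
      then have "y < fst F" using F 3 unfolding is_qcnf_def by auto
      then have "x \<le> 2 * fst F" using 2 by (cases b) auto
      then show ?thesis using N nv V by linarith
    qed
  qed
qed

lemma (in sat_reduction) run_reduction:
  assumes bnds: bounds and lits: "k \<le> V" "2 * l \<le> V" "2 ^ c \<le> V" "3 \<le> V" and W: "V ^ 200 < 2 ^ W"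
    and K: "max_reg (compile 25 (build_code k l c)) < K" "3 \<le> K"
    and p: "exec w p (initial_state w graph_code) t (R, M)"
  shows "\<exists>R' M'. runs W (Seq (compile 25 (build_code k l c)) (sim K p)) (initial_state W (encode_cnf F))
      (1000 * (len + 1) * (ne + 1) + 2 * t) (R', M') \<and> (\<forall>r. R' (r + K) = R r \<and> R r < 2 ^ W)"
proof -
  let ?b = "build_code k l c" and ?s = "initial_state W (encode_cnf F)"
  have b: "2 ^ w \<le> V" "len < V" "2 \<le> V" using assms(1) unfolding bounds_def by auto
  have "V * V \<le> V ^ 200" using power_increasing[of 2 200 V] b by (simp add: power2_eq_square)
  moreover have "V + V \<le> V * V" using mult_le_mono1[OF b(3), of V] by (simp only: mult_2)
  \<comment> \<open>Room for the formula and the gap, at most \<open>V\<close> cells, followed by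
    the \<open>2 ^ w \<le> V\<close> cells of the simulated memory.\<close>
  ultimately have VV: "V + V < 2 ^ W" using W by linarith
  have small: "x \<le> V" "x < 2 ^ W" if "x \<in> set (encode_cnf F)" for x
    using encode_cnf_le[OF assms(1) that] VV by linarith+
  have mem: "snd ?s i = (if i < len then encode_cnf F ! i else 0)" for i
    unfolding initial_state_def using small(2) by simp
  have inp: "input_mem F (snd ?s)" unfolding input_mem_def mem by simp
  have zero: "snd ?s x = 0" if "x > len" for x unfolding mem using that by simp
  note build = build_code[OF inp zero assms(1)]
  have bnd: "bounded V 25 ?s"
    unfolding bounded_def mem using small(1) by (auto simp: initial_state_def)
  obtain R1 where R1: "runs W (compile 25 ?b) (fst ?s, snd ?s) (cost ?b ?s) (R1, snd (sem ?b ?s))"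
    "\<forall>x<25. R1 x = fst (sem ?b ?s) x"
    using runs_compile[OF b(3) W _ wf_build_code[OF lits] bnd build(4), of "fst ?s"] by auto
  have env: "R1 0 = len + 1" "R1 1 = 2 ^ w" using build(2) R1(2) unfolding env_def by auto
  have R1K: "R1 (r + K) = 0" for r
    using runs_max_reg[OF R1(1), of "r + K"] K(1) by (simp add: initial_state_def)
  have sim: "simulates K w (len + 1) (initial_state w graph_code) (R1, snd (sem ?b ?s))"
    unfolding simulates_def using R1K env build(1) by (simp add: initial_state_def)
  have "(2::nat) ^ w < 2 ^ W" using b VV by linarith
  then have wW: "w < W" by simp
  have "len + 1 + 2 ^ w < 2 ^ W" using b VV by linarith
  from runs_sim[OF p sim wW this K(2)] obtain u' where
    u': "runs W (sim K p) (R1, snd (sem ?b ?s)) (2 * t) u'" "simulates K w (len + 1) (R, M) u'" by auto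
  have "runs W (Seq (compile 25 ?b) (sim K p)) ?s (cost ?b ?s + 2 * t) u'"
    using runs_Seq[OF R1(1) u'(1)] by simp
  then have "runs W (Seq (compile 25 ?b) (sim K p)) ?s (1000 * (len + 1) * (ne + 1) + 2 * t) u'"
    using build(3) by (elim runs_mono) simp
  moreover have "\<forall>r. fst u' (r + K) = R r \<and> R r < 2 ^ W"
    using u'(2) less_trans[OF _ \<open>2 ^ w < 2 ^ W\<close>] unfolding simulates_def fst_conv by blast
  ultimately show ?thesis by (metis prod.collapse)
qed

section \<open>Running time\<close>

text \<open>Clauses are distinct lists of length at most \<open>q\<close> over \<open>2 * N\<close>
  literals, so it suffices to count such lists.\<close>

lemma num_clauses_le:
  assumes "is_qcnf q F"
  shows "length (snd F) \<le> (q + 1) * (2 * (fst F + 1)) ^ q"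
proof -
  let ?A = "{..<fst F} \<times> (UNIV :: bool set)"
  have sub: "set (snd F) \<subseteq> {xs. set xs \<subseteq> ?A \<and> length xs \<le> q}"
    using assms unfolding is_qcnf_def by force
  have "length (snd F) = card (set (snd F))"
    using assms unfolding is_qcnf_def by (simp add: distinct_card)
  also have "\<dots> \<le> card {xs. set xs \<subseteq> ?A \<and> length xs \<le> q}"
    by (intro card_mono sub finite_lists_length_le) simp
  also have "\<dots> = (\<Sum>i\<le>q. card ?A ^ i)" by (intro card_lists_length_le) simp
  also have "\<dots> \<le> (\<Sum>i\<le>q. (2 * (fst F + 1)) ^ q)"
  proof (rule sum_mono)
    fix i assume "i \<in> {..q}"
    have "card ?A ^ i \<le> (2 * (fst F + 1)) ^ i"
      by (intro power_mono) (auto simp: card_cartesian_product)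
    also have "\<dots> \<le> (2 * (fst F + 1)) ^ q" using \<open>i \<in> {..q}\<close> by (intro power_increasing) auto
    finally show "card ?A ^ i \<le> (2 * (fst F + 1)) ^ q" .
  qed
  finally show ?thesis by simp
qed

lemma encode_cnf_length_le:
  assumes "is_qcnf q F"
  shows "length (encode_cnf F) + 1 \<le> (3 + (q + 1) * (q + 1) * 2 ^ q) * (fst F + 1) ^ q"
proof -
  let ?M = "length (snd F)" and ?N = "fst F + 1"
  have "(\<Sum>i<?M. length (snd F ! i) + 1) \<le> (\<Sum>i<?M. q + 1)"
    using assms unfolding is_qcnf_def by (intro sum_mono) auto
  then have "length (encode_cnf F) + 1 \<le> 3 + ?M * (q + 1)"
    unfolding length_encode_cnf clause_pos_def by simp
  also have "?M * (q + 1) \<le> ((q + 1) * (2 * ?N) ^ q) * (q + 1)"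
    using num_clauses_le[OF assms] by (rule mult_le_mono1)
  also have "\<dots> = (q + 1) * (q + 1) * 2 ^ q * ?N ^ q" by (simp only: power_mult_distrib mult_ac)
  also have "3 + \<dots> \<le> 3 * ?N ^ q + (q + 1) * (q + 1) * 2 ^ q * ?N ^ q" by simp
  also have "\<dots> = (3 + (q + 1) * (q + 1) * 2 ^ q) * ?N ^ q" by (rule add_mult_distrib[symmetric])
  finally show ?thesis by simp
qed

lemma (in sat_reduction) ne_le: "ne \<le> 2 * l * k * (k + 1) * (len + 1) ^ 2 * 2 ^ B"
proof -
  have "nM * nM + 1 \<le> (len + 1) * (len + 1)"
    using mult_le_mono[OF nM_le_len nM_le_len] by simp
  then have U: "nU \<le> k * (len + 1) ^ 2" unfolding num_right_def power2_eq_square by (rule mult_le_mono2)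
  have A: "nA + 1 \<le> (k + 1) * 2 ^ B" unfolding num_left_def by simp
  have "ne \<le> 2 * l * (k * (len + 1) ^ 2) * ((k + 1) * 2 ^ B)"
    unfolding ne_def using U A by (intro mult_le_mono order_refl)
  then show ?thesis by (simp only: mult_ac)
qed

lemma nat_le_power: "K \<le> (2 ^ Suc N) ^ K" for K N :: nat
proof -
  have "K \<le> 2 ^ K" using less_exp[of K] by simp
  also have "(2::nat) ^ K \<le> (2 ^ Suc N) ^ K" by (intro power_mono) auto
  finally show ?thesis .
qed

text \<open>All quantities are bounded by fixed powers of \<open>X = 2 ^ (N + 1)\<close>, since even
  a constant \<open>K\<close> is at most \<open>X ^ K\<close>. One power of \<open>X\<close> serves
  as \<open>V\<close> uniformly in \<open>F\<close>, so that words of \<open>O(N)\<close> bits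
  suffice.\<close>

lemma ex_word_bound:
  assumes "k \<ge> 2" "l \<ge> 1"
  shows "\<exists>\<kappa>. \<forall>F. is_qcnf q F \<longrightarrow> sat_reduction.bounds k l c (2 ^ (\<kappa> * (fst F + 1))) F \<and>
    k \<le> 2 ^ (\<kappa> * (fst F + 1)) \<and> 2 * l \<le> 2 ^ (\<kappa> * (fst F + 1)) \<and>
    2 ^ c \<le> (2::nat) ^ (\<kappa> * (fst F + 1)) \<and> 3 \<le> (2::nat) ^ (\<kappa> * (fst F + 1))"
proof -
  define K0 where "K0 = 3 + (q + 1) * (q + 1) * 2 ^ q"
  define K1 where "K1 = 2 * l * k * (k + 1)"
  define a where "a = K1 + 2 * (K0 + q) + 1"
  define \<kappa> where "\<kappa> = (a + 2) * (c + 1) + K0 + q + k + 2 * l + c + 3"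
  show ?thesis
  proof (intro exI[of _ \<kappa>] allI impI)
    fix F assume F: "is_qcnf q F"
    define N where "N = fst F"
    define X :: nat where "X = 2 ^ Suc N"
    have V: "2 ^ (\<kappa> * (fst F + 1)) = X ^ \<kappa>" unfolding X_def N_def by (simp only: power_mult[symmetric] mult.commute Suc_eq_plus1)
    interpret sat_reduction k l c q "X ^ \<kappa>" F using assms F by unfold_locales
    have X: "2 \<le> X" unfolding X_def by simp
    have KX: "K \<le> X ^ K" for K unfolding X_def by (rule nat_le_power)
    have mono: "X ^ i \<le> X ^ \<kappa>" if "i \<le> \<kappa>" for i using X that by (intro power_increasing) auto
    have NX: "N + 1 \<le> X" unfolding X_def using less_exp[of "Suc N"] by simp
    have "len + 1 \<le> K0 * (N + 1) ^ q" using encode_cnf_length_le[OF F] unfolding K0_def N_def .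
    also have "\<dots> \<le> X ^ K0 * X ^ q" using KX NX by (intro mult_le_mono power_mono) auto
    finally have len: "len + 1 \<le> X ^ (K0 + q)" by (simp add: power_add)
    have "B \<le> N + 1" unfolding block_def N_def by simp
    then have BX: "2 ^ B \<le> X" unfolding X_def by (intro power_increasing) auto
    have "ne \<le> K1 * (len + 1) ^ 2 * 2 ^ B" using ne_le unfolding K1_def .
    also have "\<dots> \<le> X ^ K1 * (X ^ (K0 + q)) ^ 2 * X ^ 1"
      using KX len BX by (intro mult_le_mono power_mono) auto
    also have "\<dots> = X ^ a" unfolding a_def by (simp add: power_add power_mult power2_eq_square mult_ac)
    finally have ne: "ne \<le> X ^ a" .
    have "nv \<le> X ^ a + 1" using two_power_B_le(4) ne by linarith
    also have "\<dots> \<le> X ^ (a + 1)" using X by (intro add_le_power) (auto simp: a_def)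
    finally have nv: "nv \<le> X ^ (a + 1)" .
    have "floorlog 2 nv \<noteq> 0" by (simp add: floorlog_eq_zero_iff nv_def)
    then have "2 ^ (floorlog 2 nv - 1) \<le> nv" by (intro floorlog_geD) auto
    then have "2 * 2 ^ (floorlog 2 nv - 1) \<le> 2 * nv" by simp
    then have "2 ^ floorlog 2 nv \<le> 2 * nv" using \<open>floorlog 2 nv \<noteq> 0\<close> by (cases "floorlog 2 nv") auto
    also have "\<dots> \<le> X * X ^ (a + 1)" using nv X by (intro mult_le_mono)
    finally have "2 ^ floorlog 2 nv \<le> X ^ (a + 2)" by simp
    then have "(2 ^ floorlog 2 nv) ^ c \<le> (X ^ (a + 2)) ^ c" by (intro power_mono) auto
    then have w: "2 ^ w \<le> X ^ ((a + 2) * c)" unfolding w_def by (simp only: power_mult[symmetric] mult.commute)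
    have i: "a \<le> \<kappa>" "a + 1 \<le> \<kappa>" "(a + 2) * c \<le> \<kappa>" "K0 + q \<le> \<kappa>" "k \<le> \<kappa>" "2 * l \<le> \<kappa>" "c \<le> \<kappa>" "3 \<le> \<kappa>" "1 \<le> \<kappa>"
      unfolding \<kappa>_def by auto
    have "2 ^ c \<le> X ^ c" using X by (intro power_mono) auto
    then have "2 ^ c \<le> X ^ \<kappa>" using mono[OF i(7)] by linarith
    moreover have "k \<le> X ^ \<kappa>" "2 * l \<le> X ^ \<kappa>" "3 \<le> X ^ \<kappa>"
      using KX[of k] KX[of "2 * l"] KX[of 3] mono[OF i(5)] mono[OF i(6)] mono[OF i(8)] by linarith+
    moreover have "ne \<le> X ^ \<kappa>" "nv \<le> X ^ \<kappa>" "2 ^ w \<le> X ^ \<kappa>" "len < X ^ \<kappa>" "2 \<le> X ^ \<kappa>"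
      using ne nv w len \<open>3 \<le> X ^ \<kappa>\<close> mono[OF i(1)] mono[OF i(2)] mono[OF i(3)] mono[OF i(4)] by linarith+
    then have bounds unfolding bounds_def by blast
    ultimately show "sat_reduction.bounds k l c (2 ^ (\<kappa> * (fst F + 1))) F \<and>
      k \<le> 2 ^ (\<kappa> * (fst F + 1)) \<and> 2 * l \<le> 2 ^ (\<kappa> * (fst F + 1)) \<and>
      2 ^ c \<le> (2::nat) ^ (\<kappa> * (fst F + 1)) \<and> 3 \<le> (2::nat) ^ (\<kappa> * (fst F + 1))"
      unfolding V by blast
  qed
qed

text \<open>With \<open>r\<close> the \<open>Q\<close>-th root of \<open>b\<close>, Bernoulli's
  inequality makes \<open>r ^ N\<close> grow at least linearly; its \<open>Q\<close>-th power gives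
  the claim.\<close>

lemma poly_le_exp:
  fixes b :: real
  assumes "b > 1"
  shows "\<exists>K>0. \<forall>N. real (N + 1) ^ Q \<le> K * b ^ N"
proof (cases "Q = 0")
  case True
  then show ?thesis using assms by (intro exI[of _ 1]) (auto simp: one_le_power)
next
  case False
  define r where "r = root Q b"
  have r: "r > 1" "r ^ Q = b" using assms False unfolding r_def by auto
  let ?K = "1 + 1 / (r - 1)"
  have "real (N + 1) ^ Q \<le> ?K ^ Q * b ^ N" for N
  proof -
    have "1 + real N * (r - 1) \<le> (1 + (r - 1)) ^ N" using r by (intro Bernoulli_inequality) simp
    then have 1: "1 + real N * (r - 1) \<le> r ^ N" by simp
    have "?K * (1 + real N * (r - 1)) = real N + 1 + (real N * (r - 1) + 1 / (r - 1))"
      using r by (simp add: distrib_left distrib_right)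
    moreover have "0 \<le> real N * (r - 1) + 1 / (r - 1)" using r by simp
    ultimately have "real (N + 1) \<le> ?K * (1 + real N * (r - 1))" by simp
    also have "\<dots> \<le> ?K * r ^ N" using 1 r by (intro mult_left_mono) auto
    finally have "real (N + 1) ^ Q \<le> (?K * r ^ N) ^ Q" by (intro power_mono) auto
    also have "\<dots> = ?K ^ Q * (r ^ Q) ^ N" by (simp add: power_mult_distrib power_mult[symmetric] mult.commute)
    finally show ?thesis using r by simp
  qed
  moreover have "?K ^ Q > 0" using r by (intro zero_less_power add_pos_nonneg) auto
  ultimately show ?thesis by blast
qed

text \<open>Since \<open>2 ^ B\<close> is about \<open>2 ^ (N / k)\<close>, the exponent
  \<open>k - \<delta>\<close> yields \<open>2 ^ (N * (1 - \<delta> / k))\<close> up to a constant.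
  As \<open>k - \<delta> \<ge> 1\<close>, writing the graph exceeds the bound for solving it by at
  most a multiple of \<open>len + 1\<close>. This gives one factor \<open>len + 1\<close>; the other
  \<open>2 * k\<close> come from the square in the bound for \<open>ne\<close>.\<close>

lemma (in sat_reduction) time_bound:
  fixes t C \<delta> :: real
  assumes \<delta>: "0 < \<delta>" "\<delta> \<le> 1" and C: "C \<ge> 0" and K1: "K1 = real (2 * l * k * (k + 1))"
  shows "1000 * (real len + 1) * (real ne + 1) + 2 * (C * real ne powr (real k - \<delta>)) + real \<tau> \<le>
    (2000 + 2 * C + real \<tau>) * (K1 ^ k * 2 ^ k) * (real len + 1) ^ (2 * k + 1) * 2 powr (real (fst F) * (1 - \<delta> / real k))"
proof -
  define Y where "Y = real ne powr (real k - \<delta>)"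
  define Z where "Z = real len + 1"
  have "ne \<noteq> 0" using l nU unfolding ne_def by auto
  then have ne1: "real ne \<ge> 1" by simp
  have k1: "real k - \<delta> \<ge> 1" using k \<delta> by linarith
  have "real ne powr 1 \<le> Y" unfolding Y_def using ne1 k1 by (intro powr_mono) auto
  then have neY: "real ne \<le> Y" using ne1 by simp
  have Z1: "Z \<ge> 1" unfolding Z_def by simp
  have K11: "K1 \<ge> 1"
  proof -
    have "1 * 1 * 1 * 1 \<le> 2 * l * k * (k + 1)" using k l by (intro mult_le_mono) auto
    then show ?thesis unfolding K1 using of_nat_mono by fastforce
  qed
  have "1000 * Z * (real ne + 1) \<le> 1000 * Z * (2 * Y)" using Z1 ne1 neY by (intro mult_left_mono) auto
  moreover have "2 * (C * Y) \<le> 2 * C * (Z * Y)"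
    using Z1 C neY ne1 mult_right_mono[of 1 Z "C * Y"] by (simp add: mult_ac)
  moreover have "real \<tau> \<le> real \<tau> * (Z * Y)"
    using mult_mono[of 1 Z 1 Y] Z1 neY ne1 mult_left_mono[of 1 "Z * Y" "real \<tau>"] by simp
  ultimately have T: "1000 * Z * (real ne + 1) + 2 * (C * Y) + real \<tau> \<le> (2000 + 2 * C + real \<tau>) * (Z * Y)"
    by (simp add: algebra_simps)
  have "real ne \<le> real (2 * l * k * (k + 1) * (len + 1) ^ 2 * 2 ^ B)" using ne_le by (rule of_nat_mono)
  also have "\<dots> = K1 * Z ^ 2 * 2 ^ B" unfolding K1 Z_def by simp
  finally have "real ne \<le> K1 * Z ^ 2 * 2 ^ B" .
  then have "Y \<le> (K1 * Z ^ 2 * 2 ^ B) powr (real k - \<delta>)" unfolding Y_def using k1 ne1 by (intro powr_mono2) auto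
  also have "\<dots> = (K1 * Z ^ 2) powr (real k - \<delta>) * (2 ^ B) powr (real k - \<delta>)"
    by (rule powr_mult)
  also have "\<dots> \<le> (K1 * Z ^ 2) ^ k * (2 ^ k * 2 powr (real (fst F) * (1 - \<delta> / real k)))"
  proof (rule mult_mono)
    have "1 \<le> K1 * Z ^ 2" using mult_mono[OF K11 one_le_power[OF Z1, of 2]] K11 by simp
    then have "(K1 * Z ^ 2) powr (real k - \<delta>) \<le> (K1 * Z ^ 2) powr real k" using \<delta> by (intro powr_mono) auto
    also have "\<dots> = (K1 * Z ^ 2) ^ k" using K11 Z1 by (intro powr_realpow mult_pos_pos zero_less_power) auto
    finally show "(K1 * Z ^ 2) powr (real k - \<delta>) \<le> (K1 * Z ^ 2) ^ k" .
    have Bk: "real B \<le> real (fst F) / real k + 1" unfolding block_def using of_nat_div_le_of_nat[of "fst F" k, where ?'a = real] by simp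
    have "((2::real) ^ B) powr (real k - \<delta>) = 2 powr (real B * (real k - \<delta>))"
      by (simp add: powr_realpow[symmetric] powr_powr)
    also have "\<dots> \<le> 2 powr ((real (fst F) / real k + 1) * (real k - \<delta>))"
      using Bk k1 by (intro powr_mono mult_right_mono) auto
    also have "(real (fst F) / real k + 1) * (real k - \<delta>) = real (fst F) * (1 - \<delta> / real k) + (real k - \<delta>)"
      using k by (simp add: field_simps)
    also have "2 powr \<dots> \<le> 2 powr (real (fst F) * (1 - \<delta> / real k) + real k)" using \<delta> by (intro powr_mono) auto
    also have "\<dots> = 2 ^ k * 2 powr (real (fst F) * (1 - \<delta> / real k))"
      by (simp add: powr_add powr_realpow)
    finally show "(2 ^ B) powr (real k - \<delta>) \<le> 2 ^ k * 2 powr (real (fst F) * (1 - \<delta> / real k))" .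
  qed (use K11 Z1 in auto)
  finally have Y: "Y \<le> (K1 * Z ^ 2) ^ k * (2 ^ k * 2 powr (real (fst F) * (1 - \<delta> / real k)))" .
  have "Z * Y \<le> Z * ((K1 * Z ^ 2) ^ k * (2 ^ k * 2 powr (real (fst F) * (1 - \<delta> / real k))))"
    using Y Z1 by (intro mult_left_mono) auto
  also have "\<dots> = (K1 ^ k * 2 ^ k) * Z ^ (2 * k + 1) * 2 powr (real (fst F) * (1 - \<delta> / real k))"
    by (simp add: power_mult_distrib power_mult power_add)
  finally have "(2000 + 2 * C + real \<tau>) * (Z * Y) \<le> (2000 + 2 * C + real \<tau>) *
     ((K1 ^ k * 2 ^ k) * Z ^ (2 * k + 1) * 2 powr (real (fst F) * (1 - \<delta> / real k)))"
    using C by (intro mult_left_mono) auto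
  with T show ?thesis unfolding Y_def Z_def by (simp add: mult.assoc)
qed

text \<open>Half of the saving \<open>\<delta> / k\<close> in the exponent pays for the polynomial
  factor; the other half keeps the base below 2.\<close>

lemma ex_time_bound:
  fixes C \<delta> :: real
  assumes "k \<ge> 2" "l \<ge> 1" "0 < \<delta>" "\<delta> \<le> 1" "C \<ge> 0"
  shows "\<exists>C'>0. \<forall>F. is_qcnf q F \<longrightarrow>
    (let len = length (encode_cnf F); ne = incidence_graph.ne l (num_left k F) (num_right k F) in
    1000 * (real len + 1) * (real ne + 1) + 2 * (C * real ne powr (real k - \<delta>)) + real \<tau> \<le>
      C' * (2 powr (1 - \<delta> / (2 * real k))) ^ fst F)"
proof -
  define K0 where "K0 = real (3 + (q + 1) * (q + 1) * 2 ^ q)"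
  define K1 where "K1 = real (2 * l * k * (k + 1))"
  define Q where "Q = q * (2 * k + 1)"
  have K01: "K0 > 0" "K1 > 0" using assms unfolding K0_def K1_def of_nat_0_less_iff by auto
  have "2 powr (\<delta> / (2 * real k)) > 1" using assms by simp
  then obtain K2 where K2: "K2 > 0" "\<And>N. real (N + 1) ^ Q \<le> K2 * (2 powr (\<delta> / (2 * real k))) ^ N"
    using poly_le_exp by blast
  define D where "D = (2000 + 2 * C + real \<tau>) * (K1 ^ k * 2 ^ k)"
  have D: "D > 0" unfolding D_def using K01 assms by (intro mult_pos_pos) auto
  let ?C' = "D * (K0 ^ (2 * k + 1) * K2)"
  have "1000 * (real (length (encode_cnf F)) + 1) * (real (incidence_graph.ne l (num_left k F) (num_right k F)) + 1) +
      2 * (C * real (incidence_graph.ne l (num_left k F) (num_right k F)) powr (real k - \<delta>)) + real \<tau> \<le>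
      ?C' * (2 powr (1 - \<delta> / (2 * real k))) ^ fst F" if F: "is_qcnf q F" for F
  proof -
    interpret sat_reduction k l 0 q 0 F using assms F by unfold_locales
    let ?N = "fst F"
    let ?E = "2 powr (real ?N * (1 - \<delta> / real k))"
    have "1000 * (real len + 1) * (real ne + 1) + 2 * (C * real ne powr (real k - \<delta>)) + real \<tau> \<le>
      D * (real len + 1) ^ (2 * k + 1) * ?E"
      using time_bound[OF assms(3-5) K1_def, of \<tau>] unfolding D_def .
    also have "\<dots> \<le> D * (K0 ^ (2 * k + 1) * (K2 * (2 powr (\<delta> / (2 * real k))) ^ ?N)) * ?E"
    proof (intro mult_right_mono mult_left_mono)
      have "real (len + 1) \<le> real ((3 + (q + 1) * (q + 1) * 2 ^ q) * (?N + 1) ^ q)"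
        using encode_cnf_length_le[OF F] by (rule of_nat_mono)
      then have "real len + 1 \<le> K0 * real (?N + 1) ^ q" unfolding K0_def by simp
      then have "(real len + 1) ^ (2 * k + 1) \<le> (K0 * real (?N + 1) ^ q) ^ (2 * k + 1)"
        by (intro power_mono) auto
      also have "\<dots> = K0 ^ (2 * k + 1) * real (?N + 1) ^ Q"
        unfolding Q_def by (simp only: power_mult_distrib power_mult)
      also have "\<dots> \<le> K0 ^ (2 * k + 1) * (K2 * (2 powr (\<delta> / (2 * real k))) ^ ?N)"
        using K2(2) K01 by (intro mult_left_mono) auto
      finally show "(real len + 1) ^ (2 * k + 1) \<le> K0 ^ (2 * k + 1) * (K2 * (2 powr (\<delta> / (2 * real k))) ^ ?N)" .
    qed (use D in auto)
    also have "\<dots> = ?C' * ((2 powr (\<delta> / (2 * real k))) ^ ?N * ?E)" by (simp only: mult_ac)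
    also have "(2 powr (\<delta> / (2 * real k))) ^ ?N * ?E = (2 powr (1 - \<delta> / (2 * real k))) ^ ?N"
    proof -
      have "(2 powr (\<delta> / (2 * real k))) ^ ?N * ?E = 2 powr (real ?N * (\<delta> / (2 * real k)) + real ?N * (1 - \<delta> / real k))"
        by (simp add: powr_add powr_realpow[symmetric] powr_powr mult.commute)
      also have "real ?N * (\<delta> / (2 * real k)) + real ?N * (1 - \<delta> / real k) = real ?N * (1 - \<delta> / (2 * real k))"
        using assms(1) by (simp add: field_simps)
      finally show ?thesis by (simp add: powr_realpow[symmetric] powr_powr mult.commute)
    qed
    finally show ?thesis .
  qed
  moreover have "?C' > 0" using D K01 K2 by (intro mult_pos_pos) auto
  ultimately show ?thesis unfolding Let_def by blast
qed

section \<open>Conditional lower bounds\<close>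

lemma (in sat_reduction) satisfiable_iff_radius:
  "satisfiable F \<Longrightarrow> radius_of (k + 1) gr \<le> enat (3 * l)"
  "\<not> satisfiable F \<Longrightarrow> enat (5 * l) \<le> radius_of (k + 1) gr"
proof -
  show "radius_of (k + 1) gr \<le> enat (3 * l)" if "satisfiable F"
    using satisfiable_imp_cover[OF k F that] radius_upper by blast
  show "enat (5 * l) \<le> radius_of (k + 1) gr" if "\<not> satisfiable F"
  proof (rule ccontr)
    assume "\<not> enat (5 * l) \<le> radius_of (k + 1) gr"
    then have "radius_of (k + 1) gr < enat (5 * l)" by simp
    then obtain T :: "(nat + nat) set" where "finite T" "card T \<le> k + 1"
      "\<And>u. u < nU \<Longrightarrow> Inr u \<in> T \<or> (\<exists>a<nA. Inl a \<in> T \<and> incident k F a u)"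
      using radius_lower by metis
    then have "satisfiable F" by (rule cover_imp_satisfiable[OF k])
    then show False using that by simp
  qed
qed

text \<open>The predicate \<open>acc\<close> reads the verdict off the final registers, and \<open>post\<close> evaluates it with long words;
  this covers both the gap problem and approximations, whose words may be too short for \<open>5 * l\<close>.\<close>

lemma gap_solver_refutes_SETH:
  fixes C \<delta> :: real
  assumes k: "k \<ge> 2" and l: "l \<ge> 1" and \<delta>: "\<delta> > 0" and C: "C > 0"
    and solver: "\<And>G. is_graph G \<Longrightarrow> k + 1 \<le> fst G \<Longrightarrow>
      radius_of (k + 1) G \<le> enat (3 * l) \<or> radius_of (k + 1) G \<ge> enat (5 * l) \<Longrightarrow>
      \<exists>t R M. exec (c * floorlog 2 (fst G)) p (initial_state (c * floorlog 2 (fst G)) (encode_graph G)) t (R, M) \<and>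
        (radius_of (k + 1) G \<le> enat (3 * l) \<longrightarrow> acc R) \<and> (radius_of (k + 1) G \<ge> enat (5 * l) \<longrightarrow> \<not> acc R) \<and>
        real t \<le> C * real (num_edges G) powr (real k - \<delta>)"
    and post: "\<And>K W R M. K \<ge> 3 \<Longrightarrow> 5 * l < 2 ^ W \<Longrightarrow> (\<And>r. R (r + K) < 2 ^ W) \<Longrightarrow>
      \<exists>R' M'. runs W (post K) (R, M) \<tau> (R', M') \<and> R' 0 = of_bool (acc (\<lambda>r. R (r + K)))"
  shows "\<not> SETH"
proof
  assume SETH
  \<comment> \<open>A solver that is fast for \<open>\<delta>\<close> is also fast for anything
    smaller; the cap 1 keeps the exponent \<open>k - \<delta>'\<close> at least 1.\<close>
  define \<delta>' where "\<delta>' = min \<delta> 1"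
  have d: "0 < \<delta>'" "\<delta>' \<le> 1" "\<delta>' \<le> \<delta>" using \<delta> by (auto simp: \<delta>'_def)
  define \<rho> where "\<rho> = 2 powr (1 - \<delta>' / (2 * real k))"
  have "\<rho> < 2 powr 1" unfolding \<rho>_def using d k by (intro powr_less_mono) auto
  then have "2 - \<rho> > 0" by simp
  then obtain q where q: "\<not> solvable_in_time (q_sat q) (\<lambda>F. (2 - (2 - \<rho>)) ^ fst F)"
    using \<open>SETH\<close> unfolding SETH_def by blast
  obtain \<kappa> where \<kappa>: "\<And>F. is_qcnf q F \<Longrightarrow> sat_reduction.bounds k l c (2 ^ (\<kappa> * (fst F + 1))) F \<and>
    k \<le> 2 ^ (\<kappa> * (fst F + 1)) \<and> 2 * l \<le> 2 ^ (\<kappa> * (fst F + 1)) \<and>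
    2 ^ c \<le> (2::nat) ^ (\<kappa> * (fst F + 1)) \<and> 3 \<le> (2::nat) ^ (\<kappa> * (fst F + 1))"
    using ex_word_bound[OF k l, of q c] by blast
  obtain C' where C': "C' > 0" "\<And>F. is_qcnf q F \<Longrightarrow>
    (let len = length (encode_cnf F); ne = incidence_graph.ne l (num_left k F) (num_right k F) in
    1000 * (real len + 1) * (real ne + 1) + 2 * (C * real ne powr (real k - \<delta>')) + real \<tau> \<le> C' * \<rho> ^ fst F)"
    using ex_time_bound[OF k l d(1,2), of C q \<tau>] C unfolding \<rho>_def by auto
  define b where "b = compile 25 (build_code k l c)"
  define K where "K = max_reg b + 3"
  define P where "P = Seq (Seq b (sim K p)) (post K)"
  \<comment> \<open>\<open>V ^ 200 = 2 ^ (200 * \<kappa> * (N + 1))\<close> has to stay strictly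
    below the word size, hence the summand 1.\<close>
  define c' where "c' = 200 * \<kappa> + 1"
  have "\<exists>t R M. exec (c' * (fst F + 1)) P (initial_state (c' * (fst F + 1)) (encode_cnf F)) t (R, M) \<and>
      R 0 = (if satisfiable F then 1 else 0) \<and> real t \<le> C' * \<rho> ^ fst F" if F: "is_qcnf q F" for F
  proof -
    define V :: nat where "V = 2 ^ (\<kappa> * (fst F + 1))"
    define W where "W = c' * (fst F + 1)"
    interpret sat_reduction k l c q V F using k l F by unfold_locales
    have V: bounds "k \<le> V" "2 * l \<le> V" "2 ^ c \<le> V" "3 \<le> V" using \<kappa>[OF F] unfolding V_def by auto
    have "V ^ 200 = 2 ^ (200 * (\<kappa> * (fst F + 1)))" unfolding V_def by (simp only: power_mult[symmetric] mult.commute)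
    also have "\<dots> < 2 ^ W" unfolding W_def c'_def by (intro power_strict_increasing) auto
    finally have VW: "V ^ 200 < 2 ^ W" .
    have "2 * l * 3 \<le> V * V" using V by (intro mult_le_mono)
    also have "\<dots> \<le> V ^ 200" using power_increasing[of 2 200 V] V(5) by (simp add: power2_eq_square)
    finally have lW: "5 * l < 2 ^ W" using VW l by linarith
    have fg: "fst gr = nv" "num_edges gr = ne" by (simp_all add: gr_def num_edges_def)
    have "k * 1 \<le> nA" unfolding num_left_def by (intro mult_le_mono2) simp
    then have kn: "k + 1 \<le> fst gr" unfolding fg nv_def hub_def by simp
    have promise: "radius_of (k + 1) gr \<le> enat (3 * l) \<or> radius_of (k + 1) gr \<ge> enat (5 * l)"
      using satisfiable_iff_radius by blast
    obtain t R M where ex: "exec w p (initial_state w graph_code) t (R, M)"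
      and acc: "radius_of (k + 1) gr \<le> enat (3 * l) \<longrightarrow> acc R" "radius_of (k + 1) gr \<ge> enat (5 * l) \<longrightarrow> \<not> acc R"
      and t: "real t \<le> C * real ne powr (real k - \<delta>)"
      using solver[OF is_graph_gr kn promise] unfolding fg graph_code_def w_def by blast
    have acc_iff: "acc R \<longleftrightarrow> satisfiable F" using acc satisfiable_iff_radius by blast
    have "max_reg (compile 25 (build_code k l c)) < K" "3 \<le> K" unfolding K_def b_def by auto
    from run_reduction[OF V VW this ex] obtain R1 M1 where
      R1: "runs W (Seq b (sim K p)) (initial_state W (encode_cnf F)) (1000 * (len + 1) * (ne + 1) + 2 * t) (R1, M1)"
      "\<And>r. R1 (r + K) = R r" "\<And>r. R r < 2 ^ W"
      unfolding b_def by blast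
    obtain R2 M2 where R2: "runs W (post K) (R1, M1) \<tau> (R2, M2)" "R2 0 = of_bool (acc (\<lambda>r. R1 (r + K)))"
      using post[of K W R1 M1] lW R1(2,3) \<open>3 \<le> K\<close> by auto
    have "runs W P (initial_state W (encode_cnf F)) (1000 * (len + 1) * (ne + 1) + 2 * t + \<tau>) (R2, M2)"
      unfolding P_def using runs_Seq[OF R1(1) R2(1)] .
    then obtain t' where t': "t' \<le> 1000 * (len + 1) * (ne + 1) + 2 * t + \<tau>"
      "exec W P (initial_state W (encode_cnf F)) t' (R2, M2)" unfolding runs_def by blast
    have "ne \<noteq> 0" using l nU unfolding ne_def by auto
    then have "real ne powr (real k - \<delta>) \<le> real ne powr (real k - \<delta>')" using d by (intro powr_mono) auto
    then have "real t \<le> C * real ne powr (real k - \<delta>')" using t C by (meson mult_left_mono less_imp_le order_trans)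
    moreover have "real t' \<le> real (1000 * (len + 1) * (ne + 1) + 2 * t + \<tau>)" using t'(1) by (rule of_nat_mono)
    ultimately have "real t' \<le> 1000 * (real len + 1) * (real ne + 1) + 2 * (C * real ne powr (real k - \<delta>')) + real \<tau>"
      by (simp add: algebra_simps)
    also have "\<dots> \<le> C' * \<rho> ^ fst F" using C'(2)[OF F] unfolding Let_def .
    finally have "real t' \<le> C' * \<rho> ^ fst F" .
    moreover have "R2 0 = (if satisfiable F then 1 else 0)" using R2(2) R1(2) acc_iff by simp
    ultimately show ?thesis using t'(2) unfolding W_def by blast
  qed
  note prog = this
  have "solvable_in_time (q_sat q) (\<lambda>F. (2 - (2 - \<rho>)) ^ fst F)"
    unfolding solvable_in_time_def
  proof (rule exI[of _ P], rule exI[of _ c'], rule exI[of _ C'], intro conjI ballI)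
    fix F assume "F \<in> instances (q_sat q)"
    then have "is_qcnf q F" by (simp add: q_sat_def)
    from prog[OF this] show "\<exists>t R M. exec (c' * logsize (q_sat q) F) P
        (initial_state (c' * logsize (q_sat q) F) (encode (q_sat q) F)) t (R, M) \<and>
        answer (q_sat q) F R \<and> real t \<le> C' * (2 - (2 - \<rho>)) ^ fst F"
      by (simp add: q_sat_def)
  qed (rule C'(1))
  then show False using q by simp
qed

lemma radius_gap_hard:
  assumes "k \<ge> 2" "l \<ge> 1" SETH "\<delta> > 0"
  shows "\<not> solvable_in_time (radius_gap_problem (k + 1) (3 * l) (5 * l)) (\<lambda>G. real (num_edges G) powr (real k - \<delta>))"
proof
  let ?Q = "radius_gap_problem (k + 1) (3 * l) (5 * l)"
  assume "solvable_in_time ?Q (\<lambda>G. real (num_edges G) powr (real k - \<delta>))"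
  then obtain p c C where C: "C > 0" and "\<forall>G\<in>instances ?Q. \<exists>t R M.
      exec (c * logsize ?Q G) p (initial_state (c * logsize ?Q G) (encode ?Q G)) t (R, M) \<and>
      answer ?Q G R \<and> real t \<le> C * real (num_edges G) powr (real k - \<delta>)"
    unfolding solvable_in_time_def by blast
  then have sol: "\<And>G. is_graph G \<Longrightarrow> k + 1 \<le> fst G \<Longrightarrow>
      radius_of (k + 1) G \<le> enat (3 * l) \<or> radius_of (k + 1) G \<ge> enat (5 * l) \<Longrightarrow>
      \<exists>t R M. exec (c * floorlog 2 (fst G)) p (initial_state (c * floorlog 2 (fst G)) (encode_graph G)) t (R, M) \<and>
        (radius_of (k + 1) G \<le> enat (3 * l) \<longrightarrow> R 0 = 1) \<and> (radius_of (k + 1) G \<ge> enat (5 * l) \<longrightarrow> R 0 = 0) \<and>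
        real t \<le> C * real (num_edges G) powr (real k - \<delta>)"
    by (simp add: radius_gap_problem_def del: split_paired_All split_paired_Ex)
  let ?post = "\<lambda>K. Seq (Const 2 1) (Op Equal 0 K 2)"
  have "\<not> SETH"
  proof (rule gap_solver_refutes_SETH[where acc = "\<lambda>R. R 0 = 1" and post = ?post and \<tau> = 2, OF assms(1,2,4) C])
    fix G assume "is_graph G" "k + 1 \<le> fst G" "radius_of (k + 1) G \<le> enat (3 * l) \<or> radius_of (k + 1) G \<ge> enat (5 * l)"
    from sol[OF this] show "\<exists>t R M. exec (c * floorlog 2 (fst G)) p (initial_state (c * floorlog 2 (fst G)) (encode_graph G)) t (R, M) \<and>
        (radius_of (k + 1) G \<le> enat (3 * l) \<longrightarrow> R 0 = 1) \<and> (radius_of (k + 1) G \<ge> enat (5 * l) \<longrightarrow> R 0 \<noteq> 1) \<and>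
        real t \<le> C * real (num_edges G) powr (real k - \<delta>)" by (metis zero_neq_one)
  next
    fix K W :: nat and R M :: "nat \<Rightarrow> nat"
    assume "K \<ge> 3" "5 * l < 2 ^ W"
    then have W: "0 < W" using assms(2) by (cases W) auto
    have 1: "runs W (Const 2 1) (R, M) 1 (R(2 := 1), M)" using runs_Const[of W 2 1 R M] W by simp
    have 2: "runs W (Op Equal 0 K 2) (R(2 := 1), M) 1 (R(2 := 1, 0 := of_bool (R K = 1)), M)"
      using runs_Op[of W Equal 0 K 2 "R(2 := 1)" M] W \<open>K \<ge> 3\<close> by (cases "R K = 1") auto
    show "\<exists>R' M'. runs W (?post K) (R, M) 2 (R', M') \<and> R' 0 = of_bool (R (0 + K) = 1)"
      using runs_Seq[OF 1 2] by (intro exI[of _ "R(2 := 1, 0 := of_bool (R K = 1))"] exI[of _ M]) (simp add: numeral_2_eq_2)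
  qed
  then show False using assms by simp
qed

text \<open>Up to radius \<open>3 * l\<close> the output is at most
  \<open>5 * l - 3 * l * \<epsilon> + \<beta> < 5 * l\<close>. The test uses the integer quotient
  because the product \<open>5 * l * R 1\<close> might overflow; rounding down does no harm as the
  threshold is an integer.\<close>

lemma approximation_decides_gap:
  fixes \<epsilon> \<beta> :: real
  assumes "0 < \<epsilon>" "\<epsilon> < 1" "\<beta> < 3 * real l * \<epsilon>" and ap: "is_approximation (5 / 3 - \<epsilon>) \<beta> r (output_value R)"
  shows "r \<le> enat (3 * l) \<Longrightarrow> R 1 \<noteq> 0 \<and> R 0 div R 1 < 5 * l"
    and "enat (5 * l) \<le> r \<Longrightarrow> \<not> (R 1 \<noteq> 0 \<and> R 0 div R 1 < 5 * l)"
proof -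
  have div: "R 0 div R 1 < 5 * l \<longleftrightarrow> real (R 0) / real (R 1) < 5 * real l" if "R 1 \<noteq> 0"
  proof -
    have "R 0 div R 1 < 5 * l \<longleftrightarrow> R 0 < 5 * l * R 1" using that by (simp add: div_less_iff_less_mult)
    also have "\<dots> \<longleftrightarrow> real (R 0) < real (5 * l * R 1)" by (simp only: of_nat_less_iff)
    also have "\<dots> \<longleftrightarrow> real (R 0) / real (R 1) < 5 * real l" using that by (simp add: pos_divide_less_eq)
    finally show ?thesis .
  qed
  show "R 1 \<noteq> 0 \<and> R 0 div R 1 < 5 * l" if le: "r \<le> enat (3 * l)"
  proof -
    obtain n where n: "r = enat n" "n \<le> 3 * l" using le by (cases r) auto
    have "output_value R \<le> ereal ((5 / 3 - \<epsilon>) * real n + \<beta>)" using ap n unfolding is_approximation_def by simp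
    moreover have "(5 / 3 - \<epsilon>) * real n + \<beta> < 5 * real l"
    proof -
      have "real n \<le> real (3 * l)" using n(2) by (rule of_nat_mono)
      then have "(5 / 3 - \<epsilon>) * real n \<le> (5 / 3 - \<epsilon>) * real (3 * l)" using assms(1,2) by (intro mult_left_mono) auto
      then show ?thesis using assms(3) by (simp add: algebra_simps)
    qed
    ultimately have "output_value R < ereal (5 * real l)" by (meson ereal_less_eq(3) less_ereal.simps(1) le_less_trans)
    then show ?thesis using div unfolding output_value_def by (auto split: if_splits)
  qed
  show "\<not> (R 1 \<noteq> 0 \<and> R 0 div R 1 < 5 * l)" if "enat (5 * l) \<le> r"
  proof
    assume *: "R 1 \<noteq> 0 \<and> R 0 div R 1 < 5 * l"
    then have "output_value R < ereal (5 * real l)" using div unfolding output_value_def by simp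
    moreover have "ereal_of_enat (enat (5 * l)) \<le> ereal_of_enat r" using that by (simp only: ereal_of_enat_le_iff)
    then have "ereal (5 * real l) \<le> output_value R" using ap unfolding is_approximation_def by (simp add: order_trans)
    ultimately show False by simp
  qed
qed

lemma radius_approx_hard:
  assumes "k \<ge> 2" SETH "0 < \<epsilon>" "\<epsilon> < 1" "\<delta> > 0"
  shows "\<not> solvable_in_time (radius_approx_problem (k + 1) (5 / 3 - \<epsilon>) \<beta>) (\<lambda>G. real (num_edges G) powr (real k - \<delta>))"
proof
  let ?Q = "radius_approx_problem (k + 1) (5 / 3 - \<epsilon>) \<beta>"
  assume "solvable_in_time ?Q (\<lambda>G. real (num_edges G) powr (real k - \<delta>))"
  then obtain p c C where C: "C > 0" and "\<forall>G\<in>instances ?Q. \<exists>t R M.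
      exec (c * logsize ?Q G) p (initial_state (c * logsize ?Q G) (encode ?Q G)) t (R, M) \<and>
      answer ?Q G R \<and> real t \<le> C * real (num_edges G) powr (real k - \<delta>)"
    unfolding solvable_in_time_def by blast
  then have sol: "\<And>G. is_graph G \<Longrightarrow> k + 1 \<le> fst G \<Longrightarrow>
      \<exists>t R M. exec (c * floorlog 2 (fst G)) p (initial_state (c * floorlog 2 (fst G)) (encode_graph G)) t (R, M) \<and>
        is_approximation (5 / 3 - \<epsilon>) \<beta> (radius_of (k + 1) G) (output_value R) \<and>
        real t \<le> C * real (num_edges G) powr (real k - \<delta>)"
    by (simp add: radius_approx_problem_def del: split_paired_All split_paired_Ex)
  \<comment> \<open>The corollary leaves \<open>l\<close> free, so it is taken beyond
    \<open>\<beta> / (3 * \<epsilon>)\<close> to absorb the additive error.\<close>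
  obtain l0 :: nat where l0: "\<beta> / (3 * \<epsilon>) < real l0" using reals_Archimedean2 by blast
  define l where "l = Suc l0"
  have "\<beta> / (3 * \<epsilon>) < real l" using l0 unfolding l_def by simp
  then have \<beta>: "\<beta> < 3 * real l * \<epsilon>" using assms(3) by (simp add: field_simps)
  have l: "l \<ge> 1" unfolding l_def by simp
  let ?acc = "\<lambda>R :: nat \<Rightarrow> nat. R 1 \<noteq> 0 \<and> R 0 div R 1 < 5 * l"
  let ?q = "\<lambda>K. Seq (Const 2 (5 * l)) (Seq (Op Quot 0 K (1 + K)) (Op Less 0 0 2))"
  \<comment> \<open>Denominator 0 encodes \<open>\<infinity>\<close> and is rejected before the
    division, which would return 0.\<close>
  let ?post = "\<lambda>K. Cond (1 + K) (?q K) (Const 0 0)"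
  have "\<not> SETH"
  proof (rule gap_solver_refutes_SETH[where acc = ?acc and post = ?post and \<tau> = 4, OF assms(1) l assms(5) C])
    fix G assume G: "is_graph G" "k + 1 \<le> fst G"
    show "\<exists>t R M. exec (c * floorlog 2 (fst G)) p (initial_state (c * floorlog 2 (fst G)) (encode_graph G)) t (R, M) \<and>
        (radius_of (k + 1) G \<le> enat (3 * l) \<longrightarrow> ?acc R) \<and> (radius_of (k + 1) G \<ge> enat (5 * l) \<longrightarrow> \<not> ?acc R) \<and>
        real t \<le> C * real (num_edges G) powr (real k - \<delta>)"
      using sol[OF G] approximation_decides_gap[OF assms(3,4) \<beta>] by meson
  next
    fix K W :: nat and R M :: "nat \<Rightarrow> nat"
    assume K: "K \<ge> 3" and W: "5 * l < 2 ^ W" and R: "\<And>r. R (r + K) < 2 ^ W"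
    have W0: "0 < W" using W l by (cases W) auto
    show "\<exists>R' M'. runs W (?post K) (R, M) 4 (R', M') \<and> R' 0 = of_bool (R (1 + K) \<noteq> 0 \<and> R (0 + K) div R (1 + K) < 5 * l)"
    proof (cases "R (1 + K) = 0")
      case True
      have "runs W (Const 0 0) (R, M) 1 (R(0 := 0), M)" using runs_Const[of W 0 0 R M] by simp
      then have "runs W (?post K) (R, M) (Suc 1) (R(0 := 0), M)" using True by (intro runs_CondFalse) auto
      then have "runs W (?post K) (R, M) 4 (R(0 := 0), M)" by (rule runs_mono) simp
      then show ?thesis using True by (intro exI[of _ "R(0 := 0)"] exI[of _ M]) auto
    next
      case False
      let ?d = "R K div R (1 + K)"
      let ?R1 = "R(2 := 5 * l)"
      let ?R2 = "?R1(0 := ?d)"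
      let ?R3 = "?R2(0 := of_bool (?d < 5 * l))"
      have 1: "runs W (Const 2 (5 * l)) (R, M) 1 (?R1, M)" using runs_Const[of W 2 "5 * l" R M] W by simp
      have "?d < 2 ^ W" using R[of 0] by (intro le_less_trans[OF div_le_dividend]) simp
      then have 2: "runs W (Op Quot 0 K (1 + K)) (?R1, M) 1 (?R2, M)"
        using runs_Op[of W Quot 0 K "1 + K" ?R1 M] K by simp
      have 3: "runs W (Op Less 0 0 2) (?R2, M) 1 (?R3, M)"
        using runs_Op[of W Less 0 0 2 ?R2 M] W0 by (cases "?d < 5 * l") auto
      have "runs W (?post K) (R, M) (Suc (1 + (1 + 1))) (?R3, M)"
        using runs_Seq[OF 1 runs_Seq[OF 2 3]] False by (intro runs_CondTrue) auto
      then have "runs W (?post K) (R, M) 4 (?R3, M)" by (rule runs_mono) simp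
      then show ?thesis using False by (intro exI[of _ ?R3] exI[of _ M]) auto
    qed
  qed
  then show False using assms by simp
qed

section \<open>Reading the input\<close>

inductive_cases exec_ConstE: "exec w (Const r a) s t s'"
inductive_cases exec_OpE: "exec w (Op f r x y) s t s'"
inductive_cases exec_LoadE: "exec w (Load r x) s t s'"
inductive_cases exec_StoreE: "exec w (Store x y) s t s'"
inductive_cases exec_SeqE: "exec w (Seq p q) s t s'"
inductive_cases exec_CondE: "exec w (Cond r p q) s t s'"
inductive_cases exec_WhileE: "exec w (While r p) s t s'"

text \<open>Identifies the run transferred to the modified star with the run that the solver
  promises there.\<close>

lemma exec_deterministic:
  "exec w p s t s' \<Longrightarrow> exec w p s t2 s2 \<Longrightarrow> t2 = t \<and> s2 = s'"
proof (induction arbitrary: t2 s2 rule: exec.induct)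
  case (Const r a R M)
  then show ?case by (elim exec_ConstE) simp
next
  case (Op f r x y R M)
  then show ?case by (elim exec_OpE) simp
next
  case (Load r x R M)
  then show ?case by (elim exec_LoadE) simp
next
  case (Store x y R M)
  then show ?case by (elim exec_StoreE) simp
next
  case (Seq p s t s' q t' s'')
  from Seq.prems obtain u v s3 where *: "exec w p s u s3" "exec w q s3 v s2" "t2 = u + v"
    by (elim exec_SeqE)
  have "u = t \<and> s3 = s'" by (rule Seq.IH(1)[OF *(1)])
  then have "v = t' \<and> s2 = s''" using *(2) by (intro Seq.IH(2)) simp
  then show ?case using \<open>u = t \<and> s3 = s'\<close> *(3) by simp
next
  case (CondTrue s r p t s' q)
  from CondTrue.prems obtain u where *: "exec w p s u s2" "t2 = Suc u"
    by (rule exec_CondE) (simp_all add: CondTrue.hyps(1))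
  show ?case using CondTrue.IH[OF *(1)] *(2) by simp
next
  case (CondFalse s r q t s' p)
  from CondFalse.prems obtain u where *: "exec w q s u s2" "t2 = Suc u"
    by (rule exec_CondE) (simp_all add: CondFalse.hyps(1))
  show ?case using CondFalse.IH[OF *(1)] *(2) by simp
next
  case (WhileFalse s r p)
  from WhileFalse.prems show ?case by (rule exec_WhileE) (simp_all add: WhileFalse.hyps)
next
  case (WhileTrue s r p t s' t' s'')
  from WhileTrue.prems obtain u v s3
    where *: "exec w p s u s3" "exec w (While r p) s3 v s2" "t2 = Suc (u + v)"
    by (rule exec_WhileE) (simp_all add: WhileTrue.hyps(1))
  have "u = t \<and> s3 = s'" by (rule WhileTrue.IH(1)[OF *(1)])
  then have "v = t' \<and> s2 = s''" using *(2) by (intro WhileTrue.IH(2)) simp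
  then show ?case using \<open>u = t \<and> s3 = s'\<close> *(3) by simp
qed

text \<open>Both runs perform the same writes, so agreement at a cell is never lost. Where the
  memories differ nothing is claimed, as a write may or may not make the cell equal.\<close>

definition agree_preserved :: "(nat \<Rightarrow> nat) \<Rightarrow> (nat \<Rightarrow> nat) \<Rightarrow> (nat \<Rightarrow> nat) \<Rightarrow> (nat \<Rightarrow> nat) \<Rightarrow> bool" where
  "agree_preserved M N M' N' \<longleftrightarrow> (\<forall>a. N a = M a \<longrightarrow> N' a = M' a)"

text \<open>\<open>A\<close> collects the addresses of the loads, at most one per step. Memory
  influences a run only through loads, and agreement on \<open>A\<close> at the start persists until
  they happen.\<close>

lemma exec_reads:
  assumes "exec w p s t s'"
  shows "\<exists>A. finite A \<and> card A \<le> t \<and> (\<forall>N. (\<forall>a\<in>A. N a = snd s a) \<longrightarrow>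
    (\<exists>N'. exec w p (fst s, N) t (fst s', N') \<and> agree_preserved (snd s) N (snd s') N'))"
  using assms
proof (induction rule: exec.induct)
  case (Const r a R M)
  have "exec w (Const r a) (R, N) 1 (R(r := a mod 2 ^ w), N) \<and> agree_preserved M N M N" for N
    using exec.Const[of w r a R N] by (simp add: agree_preserved_def)
  then show ?case unfolding fst_conv snd_conv by (intro exI[of _ "{}"] conjI) (simp, simp, blast)
next
  case (Op f r x y R M)
  have "exec w (Op f r x y) (R, N) 1 (R(r := word_op w f (R x) (R y)), N) \<and> agree_preserved M N M N" for N
    using exec.Op[of w f r x y R N] by (simp add: agree_preserved_def)
  then show ?case unfolding fst_conv snd_conv by (intro exI[of _ "{}"] conjI) (simp, simp, blast)
next
  case (Load r x R M)
  show ?case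
  proof (intro exI[of _ "{R x}"] conjI allI impI)
    fix N assume "\<forall>a\<in>{R x}. N a = snd (R, M) a"
    then have "exec w (Load r x) (R, N) 1 (R(r := M (R x)), N)" using exec.Load[of w r x R N] by simp
    moreover have "agree_preserved M N M N" by (simp add: agree_preserved_def)
    ultimately show "\<exists>N'. exec w (Load r x) (fst (R, M), N) 1 (fst (R(r := M (R x)), M), N') \<and>
      agree_preserved (snd (R, M)) N (snd (R(r := M (R x)), M)) N'"
      unfolding fst_conv snd_conv by blast
  qed auto
next
  case (Store x y R M)
  have "exec w (Store x y) (R, N) 1 (R, N(R x := R y)) \<and> agree_preserved M N (M(R x := R y)) (N(R x := R y))" for N
    using exec.Store[of w x y R N] by (simp add: agree_preserved_def)
  then show ?case unfolding fst_conv snd_conv by (intro exI[of _ "{}"] conjI) (simp, simp, blast)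
next
  case (Seq p s t s' q t' s'')
  obtain A where A: "finite A" "card A \<le> t" "\<And>N. (\<forall>a\<in>A. N a = snd s a) \<Longrightarrow>
    (\<exists>N'. exec w p (fst s, N) t (fst s', N') \<and> agree_preserved (snd s) N (snd s') N')" using Seq.IH(1) by blast
  obtain B where B: "finite B" "card B \<le> t'" "\<And>N. (\<forall>a\<in>B. N a = snd s' a) \<Longrightarrow>
    (\<exists>N'. exec w q (fst s', N) t' (fst s'', N') \<and> agree_preserved (snd s') N (snd s'') N')" using Seq.IH(2) by blast
  show ?case
  proof (intro exI[of _ "A \<union> B"] conjI allI impI)
    show "card (A \<union> B) \<le> t + t'" using card_Un_le[of A B] A(2) B(2) by linarith
    fix N assume N: "\<forall>a\<in>A \<union> B. N a = snd s a"
    obtain N1 where N1: "exec w p (fst s, N) t (fst s', N1)" "agree_preserved (snd s) N (snd s') N1"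
      using A(3)[of N] N by blast
    have "\<forall>a\<in>B. N1 a = snd s' a" using N N1(2) unfolding agree_preserved_def by blast
    then obtain N2 where N2: "exec w q (fst s', N1) t' (fst s'', N2)" "agree_preserved (snd s') N1 (snd s'') N2"
      using B(3)[of N1] by blast
    show "\<exists>N'. exec w (Seq p q) (fst s, N) (t + t') (fst s'', N') \<and> agree_preserved (snd s) N (snd s'') N'"
      using exec.Seq[OF N1(1) N2(1)] N1(2) N2(2) unfolding agree_preserved_def by blast
  qed (use A B in auto)
next
  case (CondTrue s r p t s' q)
  then obtain A where A: "finite A" "card A \<le> t" "\<And>N. (\<forall>a\<in>A. N a = snd s a) \<Longrightarrow>
    (\<exists>N'. exec w p (fst s, N) t (fst s', N') \<and> agree_preserved (snd s) N (snd s') N')" by blast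
  have "exec w (Cond r p q) (fst s, N) (Suc t) (fst s', N')" if "exec w p (fst s, N) t (fst s', N')" for N N'
    using that CondTrue.hyps by (intro exec.CondTrue) auto
  then show ?case using A by (intro exI[of _ A]) (meson le_SucI)
next
  case (CondFalse s r q t s' p)
  then obtain A where A: "finite A" "card A \<le> t" "\<And>N. (\<forall>a\<in>A. N a = snd s a) \<Longrightarrow>
    (\<exists>N'. exec w q (fst s, N) t (fst s', N') \<and> agree_preserved (snd s) N (snd s') N')" by blast
  have "exec w (Cond r p q) (fst s, N) (Suc t) (fst s', N')" if "exec w q (fst s, N) t (fst s', N')" for N N'
    using that CondFalse.hyps by (intro exec.CondFalse) auto
  then show ?case using A by (intro exI[of _ A]) (meson le_SucI)
next
  case (WhileFalse s r p)
  have "exec w (While r p) (fst s, N) 1 (fst s, N)" for N using WhileFalse by (intro exec.WhileFalse) auto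
  then show ?case by (intro exI[of _ "{}"]) (auto simp: agree_preserved_def)
next
  case (WhileTrue s r p t s' t' s'')
  obtain A where A: "finite A" "card A \<le> t" "\<And>N. (\<forall>a\<in>A. N a = snd s a) \<Longrightarrow>
    (\<exists>N'. exec w p (fst s, N) t (fst s', N') \<and> agree_preserved (snd s) N (snd s') N')" using WhileTrue.IH(1) by blast
  obtain B where B: "finite B" "card B \<le> t'" "\<And>N. (\<forall>a\<in>B. N a = snd s' a) \<Longrightarrow>
    (\<exists>N'. exec w (While r p) (fst s', N) t' (fst s'', N') \<and> agree_preserved (snd s') N (snd s'') N')" using WhileTrue.IH(2) by blast
  show ?case
  proof (intro exI[of _ "A \<union> B"] conjI allI impI)
    show "card (A \<union> B) \<le> Suc (t + t')" using card_Un_le[of A B] A(2) B(2) by linarith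
    fix N assume N: "\<forall>a\<in>A \<union> B. N a = snd s a"
    obtain N1 where N1: "exec w p (fst s, N) t (fst s', N1)" "agree_preserved (snd s) N (snd s') N1"
      using A(3)[of N] N by blast
    have "\<forall>a\<in>B. N1 a = snd s' a" using N N1(2) unfolding agree_preserved_def by blast
    then obtain N2 where N2: "exec w (While r p) (fst s', N1) t' (fst s'', N2)" "agree_preserved (snd s') N1 (snd s'') N2"
      using B(3)[of N1] by blast
    have "fst (fst s, N) r \<noteq> 0" using WhileTrue.hyps by simp
    from exec.WhileTrue[OF this N1(1) N2(1)]
    show "\<exists>N'. exec w (While r p) (fst s, N) (Suc (t + t')) (fst s'', N') \<and> agree_preserved (snd s) N (snd s'') N'"
      using N1(2) N2(2) unfolding agree_preserved_def by blast
  qed (use A B in auto)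
qed

text \<open>The vertices \<open>a\<close> and \<open>b\<close> lose their edges if they are between \<open>4\<close> and \<open>m\<close>; \<open>star m 0 (m + 1)\<close> is the
  intact star.\<close>

definition star_edge :: "nat \<Rightarrow> nat \<Rightarrow> nat \<Rightarrow> nat \<times> nat" where
  "star_edge a b i = (if i = a then (1, 2) else if i = b then (1, 3) else (0, i))"

definition star :: "nat \<Rightarrow> nat \<Rightarrow> nat \<Rightarrow> graph" where
  "star m a b = (m + 1, map (star_edge a b) [1..<m + 1])"

lemma edges_star: "edges (star m a b) = (\<lambda>i. {fst (star_edge a b i), snd (star_edge a b i)}) ` {1..m}"
proof -
  have "{1..<m + 1} = {1..m}" by auto
  then show ?thesis unfolding edges_def star_def snd_conv set_map set_upt image_image case_prod_beta by simp
qed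

lemma is_graph_star:
  assumes "m \<ge> 3" "a \<noteq> b" "a = 0 \<or> a > 3" "b > 3"
  shows "is_graph (star m a b)"
proof -
  have "inj_on (\<lambda>i. {fst (star_edge a b i), snd (star_edge a b i)}) {1..<m + 1}"
    using assms by (intro inj_onI) (auto simp: star_edge_def doubleton_eq_iff split: if_splits)
  then have "distinct (map (\<lambda>(u, v). {u, v}) (snd (star m a b)))"
    unfolding star_def by (simp add: distinct_map comp_def case_prod_beta o_def del: upt_Suc)
  moreover have "\<forall>(u, v)\<in>set (snd (star m a b)). u < fst (star m a b) \<and> v < fst (star m a b) \<and> u \<noteq> v"
    using assms unfolding star_def by (auto simp: star_edge_def simp del: upt_Suc)
  ultimately show ?thesis unfolding is_graph_def by (simp add: star_def num_edges_def)
qed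

lemma near_isolated:
  assumes "\<And>v. {x, v} \<notin> E" "near E d x y"
  shows "y = x"
proof -
  obtain i where i: "(x, y) \<in> adjacency E ^^ i" using assms(2) unfolding near_def by blast
  show ?thesis
  proof (cases i)
    case (Suc j)
    then obtain v where "(x, v) \<in> adjacency E" using i by (metis relpow_Suc_D2)
    then show ?thesis using assms(1) by (auto simp: adjacency_def)
  qed (use i in auto)
qed

lemma radius_star: "m \<ge> 3 \<Longrightarrow> radius_of 2 (star m 0 (m + 1)) \<le> enat 1"
proof -
  assume m: "m \<ge> 3"
  show ?thesis
  proof (rule k_radius_le[of "{0, 1}"])
    fix v assume v: "v \<in> vertices (star m 0 (m + 1))"
    show "\<exists>c\<in>{0, 1}. near (edges (star m 0 (m + 1))) 1 v c"
    proof (cases "v = 0")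
      case False
      then have "{v, 0} \<in> edges (star m 0 (m + 1))"
        using v unfolding edges_star vertices_def by (intro image_eqI[of _ _ v]) (auto simp: star_edge_def star_def)
      then show ?thesis by (intro bexI[of _ 0] near_edge) simp_all
    next
      case True
      then show ?thesis by (intro bexI[of _ 0]) (simp_all add: near_refl)
    qed
  next
    show "{0, 1} \<subseteq> vertices (star m 0 (m + 1))" using m by (simp add: vertices_def star_def)
  qed simp
qed

text \<open>An isolated vertex is covered only by itself. The two of them use up both centres, and 0
  is left unreachable.\<close>

lemma radius_broken_star:
  assumes "a \<in> {4..m}" "b \<in> {4..m}" "a \<noteq> b"
  shows "radius_of 2 (star m a b) = \<infinity>"
proof (rule ccontr)
  let ?E = "edges (star m a b)" and ?V = "vertices (star m a b)"
  assume "radius_of 2 (star m a b) \<noteq> \<infinity>"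
  then obtain d where "radius_of 2 (star m a b) \<le> enat d" by (metis not_enat_eq order_refl)
  then obtain C where C: "C \<subseteq> ?V" "card C = 2" "\<forall>v\<in>?V. \<exists>c\<in>C. near ?E d v c"
    using centres_of_k_radius_le by metis
  have iso: "{x, v} \<notin> ?E" if "x \<in> {a, b}" for x v
    using that assms unfolding edges_star by (auto simp: star_edge_def doubleton_eq_iff split: if_splits)
  have V: "a \<in> ?V" "b \<in> ?V" "0 \<in> ?V" using assms by (auto simp: vertices_def star_def)
  have centre: "x \<in> C" if x: "x \<in> {a, b}" for x
  proof -
    have "x \<in> ?V" using x V by auto
    then obtain c where c: "c \<in> C" "near ?E d x c" using C(3) by blast
    have "c = x" by (rule near_isolated[OF iso[OF x] c(2)])
    then show ?thesis using c(1) by simp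
  qed
  have "a \<in> C" "b \<in> C" by (simp_all add: centre)
  moreover have "finite C" using C(2) by (metis card.infinite zero_neq_numeral)
  ultimately have "C = {a, b}" using C(2) assms(3) by (intro card_seteq[symmetric]) auto
  then obtain c where c: "c \<in> {a, b}" "near ?E d 0 c" using C(3) V(3) by blast
  have "0 = c" by (rule near_isolated[OF iso[OF c(1)] near_sym[OF c(2)]])
  then show False using c(1) assms by auto
qed

text \<open>Behind the two header cells, edge \<open>i\<close> occupies the cells
  \<open>2 * i\<close> and \<open>2 * i + 1\<close>, as edges are counted from 1.\<close>

lemma encode_star_nth:
  assumes "\<And>i. i \<in> {1..m} \<Longrightarrow> x = 2 * i \<or> x = 2 * i + 1 \<Longrightarrow> star_edge a b i = star_edge a' b' i"
  shows "x < length (encode_graph (star m a b)) \<Longrightarrow> encode_graph (star m a b) ! x = encode_graph (star m a' b') ! x"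
    and "length (encode_graph (star m a b)) = length (encode_graph (star m a' b'))"
proof -
  let ?f = "\<lambda>a b. concat (map (\<lambda>(u, v). [u, v]) (map (star_edge a b) [1..<m + 1]))"
  have enc: "encode_graph (star m a b) = (m + 1) # m # ?f a b" for a b
    unfolding encode_graph_def star_def num_edges_def by simp
  have len: "length (?f a b) = 2 * m" for a b using length_encode_edges[of "map (star_edge a b) [1..<m + 1]"] by simp
  show "length (encode_graph (star m a b)) = length (encode_graph (star m a' b'))"
    unfolding enc using len by simp
  assume x: "x < length (encode_graph (star m a b))"
  show "encode_graph (star m a b) ! x = encode_graph (star m a' b') ! x"
  proof (cases "x < 2")
    case True
    then show ?thesis unfolding enc by (cases x) auto
  next
    case False
    define e where "e = (x - 2) div 2"
    have xe: "x = 2 + 2 * e \<or> x = 2 + (2 * e + 1)" using False unfolding e_def by linarith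
    have e: "e < m" using x xe unfolding enc using len[of a b] by auto
    have eq: "star_edge a b (1 + e) = star_edge a' b' (1 + e)" using assms[of "1 + e"] xe e by auto
    have nth: "?f a b ! (2 * e) = fst (star_edge a b (1 + e))" "?f a b ! (2 * e + 1) = snd (star_edge a b (1 + e))" for a b
      using encode_edges_nth[of e "map (star_edge a b) [1..<m + 1]"] e by (auto simp del: upt_Suc)
    from xe show ?thesis
    proof
      assume "x = 2 + 2 * e"
      then show ?thesis unfolding enc using nth(1)[of a b] nth(1)[of a' b'] eq by (simp del: upt_Suc)
    next
      assume "x = 2 + (2 * e + 1)"
      then have "x = Suc (Suc (2 * e + 1))" by simp
      then show ?thesis unfolding enc using nth(2)[of a b] nth(2)[of a' b'] eq by (simp del: upt_Suc)
    qed
  qed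
qed

text \<open>It suffices that \<open>m powr \<delta> \<ge> 2 * C\<close>. From
  \<open>m \<ge> 20\<close> and at most \<open>m / 2\<close> steps it will follow that
  \<open>t + 5 \<le> m\<close>, which leaves two spokes unread.\<close>

lemma ex_sublinear:
  fixes C \<delta> :: real
  assumes "C > 0" "\<delta> > 0"
  shows "\<exists>m\<ge>20. C * real m powr (1 - \<delta>) \<le> real m / 2"
proof -
  obtain m0 :: nat where m0: "(2 * C) powr (1 / \<delta>) < real m0" using reals_Archimedean2 by blast
  define m where "m = m0 + 20"
  have m: "(2 * C) powr (1 / \<delta>) \<le> real m" "real m > 0" using m0 unfolding m_def by auto
  have "2 * C = ((2 * C) powr (1 / \<delta>)) powr \<delta>" using assms by (simp add: powr_powr)
  also have "\<dots> \<le> real m powr \<delta>" using m assms by (intro powr_mono2) auto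
  finally have "2 * C * real m powr (1 - \<delta>) \<le> real m powr \<delta> * real m powr (1 - \<delta>)" by (intro mult_right_mono) auto
  also have "\<dots> = real m" using m by (simp add: powr_add[symmetric])
  finally show ?thesis unfolding m_def by (intro exI[of _ m]) (auto simp: m_def)
qed

text \<open>An approximation is infinite exactly if the 2-radius is. On the star it leaves two edges unread, and
  redirecting these isolates two vertices.\<close>

lemma two_radius_approx_hard:
  assumes "\<delta> > 0"
  shows "\<not> solvable_in_time (radius_approx_problem 2 \<alpha> \<beta>) (\<lambda>G. real (num_edges G) powr (1 - \<delta>))"
proof
  let ?Q = "radius_approx_problem 2 \<alpha> \<beta>"
  assume "solvable_in_time ?Q (\<lambda>G. real (num_edges G) powr (1 - \<delta>))"
  then obtain p c C where C: "C > 0" and "\<forall>G\<in>instances ?Q. \<exists>t R M.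
      exec (c * logsize ?Q G) p (initial_state (c * logsize ?Q G) (encode ?Q G)) t (R, M) \<and>
      answer ?Q G R \<and> real t \<le> C * real (num_edges G) powr (1 - \<delta>)"
    unfolding solvable_in_time_def by blast
  then have sol: "\<And>G. is_graph G \<Longrightarrow> 2 \<le> fst G \<Longrightarrow>
      \<exists>t R M. exec (c * floorlog 2 (fst G)) p (initial_state (c * floorlog 2 (fst G)) (encode_graph G)) t (R, M) \<and>
        is_approximation \<alpha> \<beta> (radius_of 2 G) (output_value R) \<and> real t \<le> C * real (num_edges G) powr (1 - \<delta>)"
    by (simp add: radius_approx_problem_def del: split_paired_All split_paired_Ex)
  obtain m where m: "m \<ge> 20" "C * real m powr (1 - \<delta>) \<le> real m / 2" using ex_sublinear[OF C assms] by blast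
  define w where "w = c * floorlog 2 (m + 1)"
  define s where "s a b = initial_state w (encode_graph (star m a b))" for a b
  have run: "\<exists>t R M. exec w p (s a b) t (R, M) \<and>
      is_approximation \<alpha> \<beta> (radius_of 2 (star m a b)) (output_value R) \<and> real t \<le> real m / 2"
    if "a \<noteq> b" "a = 0 \<or> a > 3" "b > 3" for a b
  proof -
    have st: "fst (star m a b) = m + 1" "num_edges (star m a b) = m" by (simp_all add: star_def num_edges_def)
    have "is_graph (star m a b)" using m(1) that by (intro is_graph_star) simp_all
    from sol[OF this, unfolded st] m obtain t R M where "exec w p (s a b) t (R, M)"
      "is_approximation \<alpha> \<beta> (radius_of 2 (star m a b)) (output_value R)" "real t \<le> C * real m powr (1 - \<delta>)"
      unfolding s_def w_def by auto
    then show ?thesis using m(2) order_trans by blast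
  qed
  obtain t R M where R: "exec w p (s 0 (m + 1)) t (R, M)" "real t \<le> real m / 2"
    "is_approximation \<alpha> \<beta> (radius_of 2 (star m 0 (m + 1))) (output_value R)"
    using run[of 0 "m + 1"] m by auto
  \<comment> \<open>The intact star has radius at most 1, so the upper bound on the output is
    finite.\<close>
  have "output_value R \<noteq> \<infinity>"
  proof -
    obtain n where "radius_of 2 (star m 0 (m + 1)) = enat n"
      using radius_star[of m] m by (cases "radius_of 2 (star m 0 (m + 1))") auto
    then have "output_value R \<le> ereal (\<alpha> * real n + \<beta>)" using R(3) unfolding is_approximation_def by simp
    then show ?thesis by (metis PInfty_neq_ereal(1) ereal_infty_less_eq(1))
  qed
  from exec_reads[OF R(1)] obtain A where A: "finite A" "card A \<le> t"
    "\<forall>N. (\<forall>a\<in>A. N a = snd (s 0 (m + 1)) a) \<longrightarrow> (\<exists>N'. exec w p (fst (s 0 (m + 1)), N) t (fst (R, M), N') \<and>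
      agree_preserved (snd (s 0 (m + 1))) N (snd (R, M)) N')"
    by (elim exE conjE) (rule that)
  \<comment> \<open>Spokes neither cell of which is read; there are at least
    \<open>m - 3 - t \<ge> 2\<close> of them.\<close>
  let ?I = "{4..m} - (\<lambda>x. x div 2) ` A"
  have "card ((\<lambda>x. x div 2) ` A) \<le> t" using card_image_le[OF A(1)] A(2) order_trans by blast
  then have "card ?I \<ge> card {4..m} - t" using diff_card_le_card_Diff[of "(\<lambda>x. x div 2) ` A" "{4..m}"] A(1) by simp
  moreover have "t + 5 \<le> m" using R(2) m(1) by linarith
  ultimately have "card ?I \<ge> 2" by simp
  then have "\<not> (\<forall>a\<in>?I. \<forall>b\<in>?I. a = b)" using card_le_Suc0_iff_eq[of ?I] by simp
  then obtain a b where ab: "a \<in> ?I" "b \<in> ?I" "a \<noteq> b" by blast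
  have same: "snd (s a b) x = snd (s 0 (m + 1)) x" if "x \<in> A" for x
  proof -
    have "star_edge a b i = star_edge 0 (m + 1) i" if "i \<in> {1..m}" "x = 2 * i \<or> x = 2 * i + 1" for i
    proof -
      have "x div 2 = i" using that(2) by auto
      then have "i \<noteq> a" "i \<noteq> b" using ab \<open>x \<in> A\<close> by auto
      then show ?thesis using that(1) by (simp add: star_edge_def)
    qed
    from encode_star_nth[of m x a b 0 "m + 1", OF this] show ?thesis unfolding s_def initial_state_def by simp
  qed
  have "fst (s a b) = fst (s 0 (m + 1))" unfolding s_def initial_state_def by simp
  moreover have "\<exists>N'. exec w p (fst (s 0 (m + 1)), snd (s a b)) t (fst (R, M), N')"
    using A(3)[rule_format, of "snd (s a b)"] same by blast
  ultimately obtain N' where N': "exec w p (s a b) t (R, N')" by (metis fst_conv prod.collapse)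
  obtain t2 R2 M2 where R2: "exec w p (s a b) t2 (R2, M2)"
    "is_approximation \<alpha> \<beta> (radius_of 2 (star m a b)) (output_value R2)"
    using run[of a b] ab by auto
  have "R2 = R" using exec_deterministic[OF N' R2(1)] by simp
  moreover have "radius_of 2 (star m a b) = \<infinity>" using ab by (intro radius_broken_star) auto
  ultimately have "output_value R = \<infinity>" using R2(2) unfolding is_approximation_def by simp
  then show False using \<open>output_value R \<noteq> \<infinity>\<close> by simp
qed

theorem mainTheorem3:
  fixes k l :: nat
  assumes "k \<ge> 2" and "l \<ge> 1" and "SETH"
  shows "(\<forall>\<delta>::real. \<delta> > 0 \<longrightarrow>
            \<not> solvable_in_time (radius_gap_problem (k + 1) (3 * l) (5 * l))
                (\<lambda>G. real (num_edges G) powr (real k - \<delta>)))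
       \<and> (\<forall>(\<epsilon>::real) (\<beta>::real). 0 < \<epsilon> \<and> \<epsilon> < 1 \<and> \<beta> \<ge> 0 \<longrightarrow>
            (\<forall>\<delta>::real. \<delta> > 0 \<longrightarrow>
               \<not> solvable_in_time (radius_approx_problem k (5 / 3 - \<epsilon>) \<beta>)
                   (\<lambda>G. real (num_edges G) powr (real k - 1 - \<delta>))))"
proof (intro conjI allI impI)
  fix \<delta> :: real assume "\<delta> > 0"
  then show "\<not> solvable_in_time (radius_gap_problem (k + 1) (3 * l) (5 * l))
                (\<lambda>G. real (num_edges G) powr (real k - \<delta>))"
    using radius_gap_hard[OF assms] by simp
next
  fix \<epsilon> \<beta> \<delta> :: real
  assume \<epsilon>: "0 < \<epsilon> \<and> \<epsilon> < 1 \<and> \<beta> \<ge> 0" and \<delta>: "\<delta> > 0"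
  show "\<not> solvable_in_time (radius_approx_problem k (5 / 3 - \<epsilon>) \<beta>)
                   (\<lambda>G. real (num_edges G) powr (real k - 1 - \<delta>))"
  \<comment> \<open>The hardness result for \<open>j + 1 = k\<close> centres needs
    \<open>j \<ge> 2\<close> groups, so \<open>k = 2\<close> is left to the unconditional
    bound.\<close>
  proof (cases "k = 2")
    case True
    then show ?thesis using two_radius_approx_hard[OF \<delta>] by simp
  next
    case False
    define j where "j = k - 1"
    have j: "k = j + 1" "j \<ge> 2" using assms(1) False unfolding j_def by auto
    have "real k - 1 - \<delta> = real j - \<delta>" using j(1) by simp
    then show ?thesis using radius_approx_hard[OF j(2) assms(3), of \<epsilon> \<delta> \<beta>] \<epsilon> \<delta> unfolding j(1) by simp
  qed
qed

end
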